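(* For any scaling parameter $\alpha\in(0,1)$, there exist $(-\alpha)$-homogeneous self-similar vorticity profiles $\Omega$ for which the corresponding pseudo-velocity field $U-\frac{\xi}{\alpha}$ has multiple sink stagnation points away from the origin and a saddle point at the origin. In particular, up to isometries of the plane, there exists a unique such profile that has exactly two sinks and is $2$-fold rotationally symmetric.
   Context: Write $\nabla^\perp f=(-\partial_y f,\partial_x f)$, let $\xi\in\mathbb{R}^2$ be the self-similar variable, and use polar coordinates $(r,\theta)$ in the $\xi$-plane. A function $\Omega$ is a self-similar (vorticity) profile, with scaling parameter $\alpha$, for the two-dimensional incompressible Euler equations if, together with a stream function $\Psi$, it satisfies $$\Big(\nabla^\perp\Psi-\tfrac1\alpha\xi\Big)\cdot\nabla_\xi\Omega=\Omega,\qquad \Delta\Psi=\Omega .$$ Then $\omega(x,t)=t^{-1}\Omega(xt^{-1/\alpha})$ is a time-dependent self-similar solution of the Euler equations. The corresponding velocity profile is $U=\nabla^\perp\Psi$ (so $\operatorname{curl}U=\Omega$), and the pseudo-velocity is the vector field $U-\frac{\xi}{\alpha}$. For $(-\alpha)$-homogeneous profiles the stream function has the form $\Psi=r^{2-\alpha}\psi(\theta)$ with $\psi$ a $2\pi$-periodic function. Such profiles are obtained from homogeneous steady states of the two-dimensional Euler equations: with $\lambda=2-\alpha$, if $P$ is a constant and $\psi\in H^1(\mathbb{T})$ solves $$-\lambda\psi\psi''+(\lambda-1)(\psi')^2-\lambda^2\psi^2+2(\lambda-1)P=0,$$ then $U=\nabla^\perp(r^\lambda\psi(\theta))\in L^2_{\mathrm{loc}}$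 is a steady state of the Euler equations with pressure $r^{2\lambda-2}P$, and, being homogeneous, it is also a steady solution of the self-similar Euler equations above. A stagnation point is a zero of the pseudo-velocity. A stagnation point away from the origin is a sink if it is attracting (the gradient of the pseudo-velocity there has negative eigenvalues). The origin is called a saddle point when the flow of the pseudo-velocity enters the origin along some directions and leaves it along others. A profile is $2$-fold rotationally symmetric if it is symmetric with respect to rotation by $\pi$.
   Formalization: Uniqueness is shown up to isometries and dilations (dilates of a profile are profiles); the gradient at a sink is the central-difference one (two sinks with a true gradient are impossible) and must exist at every nonzero stagnation point, as unequal sectors can otherwise be glued. *)

theory Defs
  imports "HOL-Analysis.Analysis"
begin

section \<open>Vector calculus in the plane\<close>

definition grad :: "(real^2 \<Rightarrow> real) \<Rightarrow> real^2 \<Rightarrow> real^2" where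
  "grad f x = (\<chi> i. frechet_derivative f (at x) (axis i 1))"

definition perp_grad :: "(real^2 \<Rightarrow> real) \<Rightarrow> real^2 \<Rightarrow> real^2" where
  "perp_grad f x = vector [- (grad f x $ 2), grad f x $ 1]"

definition laplacian :: "(real^2 \<Rightarrow> real) \<Rightarrow> real^2 \<Rightarrow> real" where
  "laplacian f x = (\<Sum>i\<in>UNIV. grad (\<lambda>y. grad f y $ i) x $ i)"

text \<open>Test functions are taken \<open>C\<^sup>2\<close> with compact support; by mollification this gives the same
  weak equations below as \<open>C\<close>-infinity test functions.\<close>

definition test_function :: "(real^2 \<Rightarrow> real) \<Rightarrow> bool" where
  "test_function \<phi> \<longleftrightarrow>
     (\<forall>x. \<phi> differentiable (at x)) \<and>
     (\<forall>x i. (\<lambda>y. grad \<phi> y $ i) differentiable (at x)) \<and>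
     (\<forall>i. continuous_on UNIV (grad (\<lambda>y. grad \<phi> y $ i))) \<and>
     bounded {x. \<phi> x \<noteq> 0}"

definition locally_integrable :: "(real^2 \<Rightarrow> real) \<Rightarrow> bool" where
  "locally_integrable f \<longleftrightarrow> (\<forall>K. compact K \<longrightarrow> set_integrable lborel K f)"


section \<open>Self-similar profiles\<close>

definition pseudo_velocity :: "real \<Rightarrow> (real^2 \<Rightarrow> real) \<Rightarrow> real^2 \<Rightarrow> real^2" where
  "pseudo_velocity \<alpha> \<Psi> x = perp_grad \<Psi> x - (1 / \<alpha>) *\<^sub>R x"

text \<open>The equations \<open>(U - \<xi>/\<alpha>) \<cdot> \<nabla>\<Omega> = \<Omega>\<close>, \<open>\<Delta>\<Psi> = \<Omega>\<close> hold in the sense of distributions on the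
  whole plane; as \<open>U - \<xi>/\<alpha>\<close> has divergence \<open>-2/\<alpha>\<close>, the first one in divergence form is
  \<open>div (\<Omega> (U - \<xi>/\<alpha>)) = (1 - 2/\<alpha>) \<Omega>\<close>.\<close>

definition weak_profile :: "real \<Rightarrow> (real^2 \<Rightarrow> real) \<Rightarrow> (real^2 \<Rightarrow> real) \<Rightarrow> bool" where
  "weak_profile \<alpha> \<Omega> \<Psi> \<longleftrightarrow>
     locally_integrable \<Omega> \<and>
     (\<forall>\<phi>. test_function \<phi> \<longrightarrow>
        (\<integral>x. \<Omega> x * (pseudo_velocity \<alpha> \<Psi> x \<bullet> grad \<phi> x) \<partial>lborel)
          = (2 / \<alpha> - 1) * (\<integral>x. \<Omega> x * \<phi> x \<partial>lborel)) \<and>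
     (\<forall>\<phi>. test_function \<phi> \<longrightarrow>
        (\<integral>x. \<Psi> x * laplacian \<phi> x \<partial>lborel) = (\<integral>x. \<Omega> x * \<phi> x \<partial>lborel))"

text \<open>A homogeneous vorticity typically blows up, like \<open>\<bar>\<Psi>\<bar>\<close> to the power \<open>-\<alpha>/(2-\<alpha>)\<close>, on the rays
  where \<open>\<Psi>\<close> vanishes, so the equations can hold classically only off these rays. The value \<open>0\<close>
  on them merely selects a representative of \<open>\<Omega>\<close>.\<close>

definition self_similar_profile :: "real \<Rightarrow> (real^2 \<Rightarrow> real) \<Rightarrow> (real^2 \<Rightarrow> real) \<Rightarrow> bool" where
  "self_similar_profile \<alpha> \<Omega> \<Psi> \<longleftrightarrow>
     (\<forall>x. \<Psi> differentiable (at x)) \<and> continuous_on UNIV (grad \<Psi>) \<and>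
     weak_profile \<alpha> \<Omega> \<Psi> \<and>
     (\<forall>x. \<Psi> x \<noteq> 0 \<longrightarrow>
        grad \<Psi> differentiable (at x) \<and> laplacian \<Psi> x = \<Omega> x \<and>
        \<Omega> differentiable (at x) \<and> pseudo_velocity \<alpha> \<Psi> x \<bullet> grad \<Omega> x = \<Omega> x) \<and>
     (\<forall>x. \<Psi> x = 0 \<longrightarrow> \<Omega> x = 0)"

definition homogeneous_profile :: "real \<Rightarrow> (real^2 \<Rightarrow> real) \<Rightarrow> (real^2 \<Rightarrow> real) \<Rightarrow> bool" where
  "homogeneous_profile \<alpha> \<Omega> \<Psi> \<longleftrightarrow>
     self_similar_profile \<alpha> \<Omega> \<Psi> \<and>
     (\<forall>r x. r > 0 \<longrightarrow> \<Omega> (r *\<^sub>R x) = r powr (- \<alpha>) * \<Omega> x) \<and>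
     (\<exists>\<psi>::real \<Rightarrow> real. (\<forall>\<theta>. \<psi> (\<theta> + 2 * pi) = \<psi> \<theta>) \<and>
        (\<forall>r \<theta>. r \<ge> 0 \<longrightarrow> \<Psi> (vector [r * cos \<theta>, r * sin \<theta>]) = r powr (2 - \<alpha>) * \<psi> \<theta>))"

definition two_fold_symmetric :: "(real^2 \<Rightarrow> real) \<Rightarrow> bool" where
  "two_fold_symmetric \<Omega> \<longleftrightarrow> (\<forall>x. \<Omega> (- x) = \<Omega> x)"

text \<open>Vorticity is a pseudo-scalar: a reflection of the velocity field reverses its sign. Since
  homogeneity singles out the origin, only isometries fixing it are relevant. Beyond isometries the
  profile equations are invariant under \<open>\<Omega> \<mapsto> \<Omega>(s \<cdot>)\<close>, \<open>\<Psi> \<mapsto> s\<close>-to-the-minus-two \<open>\<Psi>(s \<cdot>)\<close> for \<open>s > 0\<close>,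
  which has to be factored out separately in uniqueness statements.\<close>

definition isometric_profiles :: "(real^2 \<Rightarrow> real) \<Rightarrow> (real^2 \<Rightarrow> real) \<Rightarrow> bool" where
  "isometric_profiles \<Omega>\<^sub>1 \<Omega>\<^sub>2 \<longleftrightarrow>
     (\<exists>T. orthogonal_transformation T \<and> (\<forall>x. \<Omega>\<^sub>2 x = det (matrix T) * \<Omega>\<^sub>1 (T x)))"


section \<open>Stagnation points\<close>

text \<open>The gradient at a stagnation point is taken in the symmetric sense, i.e. by central
  differences; it is the usual one for differentiable fields. For \<open>0 < \<alpha> < 1\<close>, a homogeneous
  pseudo-velocity is Frechet differentiable at no more than one stagnation point away from the
  origin, because \<open>\<Omega>\<close> blows up at the others.\<close>

definition has_symmetric_gradient :: "(real^2 \<Rightarrow> real^2) \<Rightarrow> real^2^2 \<Rightarrow> real^2 \<Rightarrow> bool" where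
  "has_symmetric_gradient V A p \<longleftrightarrow>
     (\<forall>v. ((\<lambda>h. (1 / (2 * h)) *\<^sub>R (V (p + h *\<^sub>R v) - V (p - h *\<^sub>R v))) \<longlongrightarrow> A *v v) (at 0))"

definition negative_eigenvalues :: "real^2^2 \<Rightarrow> bool" where
  "negative_eigenvalues A \<longleftrightarrow>
     (\<forall>(\<mu>::complex) (v::complex^2).
        v \<noteq> 0 \<and> (\<chi> i j. complex_of_real (A $ i $ j)) *v v = \<mu> *s v \<longrightarrow> Re \<mu> < 0)"

definition is_sink :: "(real^2 \<Rightarrow> real^2) \<Rightarrow> real^2 \<Rightarrow> bool" where
  "is_sink V p \<longleftrightarrow>
     p \<noteq> 0 \<and> V p = 0 \<and> (\<exists>A. has_symmetric_gradient V A p \<and> negative_eigenvalues A)"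

text \<open>The classification of stagnation points by the gradient presupposes that it exists.
  This is a genuine restriction: it says that \<open>\<Omega>\<close> blows up equally fast, with opposite signs, on the
  two sides of the ray through such a point, and without it uniqueness fails, as sectors of
  different opening angles can be glued along rays.\<close>

definition gradient_at_stagnation_points :: "(real^2 \<Rightarrow> real^2) \<Rightarrow> bool" where
  "gradient_at_stagnation_points V \<longleftrightarrow>
     (\<forall>p. p \<noteq> 0 \<and> V p = 0 \<longrightarrow> (\<exists>A. has_symmetric_gradient V A p))"

text \<open>A trajectory may reach the origin in finite or in infinite time; the filter below is
  \<open>at_left T\<close> for real \<open>T\<close> and \<open>at_top\<close> for \<open>T = \<infinity>\<close>.\<close>

definition enters_origin_along :: "(real^2 \<Rightarrow> real^2) \<Rightarrow> real^2 \<Rightarrow> bool" where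
  "enters_origin_along V e \<longleftrightarrow>
     (\<exists>(X::real \<Rightarrow> real^2) (T::ereal). 0 < T \<and>
        (\<forall>t. 0 < t \<and> ereal t < T \<longrightarrow> X t \<noteq> 0 \<and> (X has_vector_derivative V (X t)) (at t)) \<and>
        (X \<longlongrightarrow> 0) (filtercomap ereal (at_left T)) \<and>
        ((\<lambda>t. (1 / norm (X t)) *\<^sub>R X t) \<longlongrightarrow> e) (filtercomap ereal (at_left T)))"

definition leaves_origin_along :: "(real^2 \<Rightarrow> real^2) \<Rightarrow> real^2 \<Rightarrow> bool" where
  "leaves_origin_along V e \<longleftrightarrow> enters_origin_along (\<lambda>x. - V x) e"

definition saddle_at_origin :: "(real^2 \<Rightarrow> real^2) \<Rightarrow> bool" where
  "saddle_at_origin V \<longleftrightarrow>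
     V 0 = 0 \<and> (\<exists>e e'. e \<noteq> e' \<and> enters_origin_along V e \<and> leaves_origin_along V e')"

definition sink_saddle_profile :: "real \<Rightarrow> (real^2 \<Rightarrow> real) \<Rightarrow> (real^2 \<Rightarrow> real) \<Rightarrow> bool" where
  "sink_saddle_profile \<alpha> \<Omega> \<Psi> \<longleftrightarrow>
     homogeneous_profile \<alpha> \<Omega> \<Psi> \<and>
     gradient_at_stagnation_points (pseudo_velocity \<alpha> \<Psi>) \<and>
     (\<exists>p q. p \<noteq> q \<and> is_sink (pseudo_velocity \<alpha> \<Psi>) p \<and> is_sink (pseudo_velocity \<alpha> \<Psi>) q) \<and>
     saddle_at_origin (pseudo_velocity \<alpha> \<Psi>)"

definition two_sink_profile :: "real \<Rightarrow> (real^2 \<Rightarrow> real) \<Rightarrow> (real^2 \<Rightarrow> real) \<Rightarrow> bool" where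
  "two_sink_profile \<alpha> \<Omega> \<Psi> \<longleftrightarrow>
     sink_saddle_profile \<alpha> \<Omega> \<Psi> \<and>
     card {p. is_sink (pseudo_velocity \<alpha> \<Psi>) p} = 2 \<and>
     two_fold_symmetric \<Omega>"

end

theory Submission imports Defs
begin

text \<open>
  In polar coordinates a homogeneous profile is \<open>\<Psi> = r\<close>-to-the-\<open>(2-\<alpha>)\<close> times \<open>\<psi>(\<theta>)\<close> and
  \<open>\<Omega> = r\<close>-to-the-\<open>(-\<alpha>)\<close> times \<open>w(\<theta>)\<close>. By homogeneity the drift accounts for the right side of the
  self-similar equation, and what remains is the steady equation \<open>U \<cdot> \<nabla>\<Omega> = 0\<close>: on every sector between
  consecutive zeros of \<open>\<psi>\<close> the product of \<open>w\<close> with the power \<open>\<beta> = \<alpha>/(2-\<alpha>)\<close> of \<open>\<bar>\<psi>\<bar>\<close> is constant. With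
  \<open>l = 2 - \<alpha>\<close> the angular factor therefore solves \<open>\<psi>'' + l\<^sup>2 \<psi> = w\<close>, an autonomous equation with a first
  integral on each sector. Stagnation points away from the origin sit on the rays where \<open>\<psi>\<close> decreases
  through zero, one on each; there the gradient is triangular with eigenvalues \<open>-1\<close> and \<open>1 - 2/\<alpha>\<close>
  (\<open>stagnation_negative_eigenvalues\<close>), so all of them are sinks. Near the origin the flow enters along
  the rays where \<open>\<psi>\<close> increases and leaves along the others (\<open>saddle\<close>).

  Existence. Put \<open>q = (1-\<alpha>)/(2-\<alpha>)\<close>. Writing a solution with maximum 1 as the sine of a Pruefer variable, the first integral
  becomes an autonomous first order equation with positive continuous speed. Its parameter \<open>K\<close> measures
  the strength of the vorticity. The opening angle of a sector is the travel time over a half turn, it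
  decreases strictly in \<open>K\<close>, and the value \<open>\<pi>/2\<close> is attained (\<open>travel_period_decreasing\<close>,
  \<open>travel_period_half_pi\<close>). Four such sectors fit together to a stream function that vanishes exactly on
  the coordinate axes, is odd about them, and is antisymmetric under rotation by \<open>\<pi>/2\<close>. Its vorticity is
  singular on the axes but bounded by the integrable product of powers of \<open>\<bar>x\<^sub>1\<bar>\<close> and \<open>\<bar>x\<^sub>2\<bar>\<close> with exponent
  \<open>-\<beta> > -1\<close>. Since all lines parallel to the axes, except the axes themselves, cross the singular set
  only once, Fubini's theorem and the fundamental theorem of calculus on lines give the weak equations
  (\<open>weak_poisson\<close>, \<open>weak_transport\<close>). The symmetric gradient at the sinks exists because \<open>\<psi>\<close> is odd about
  its zeros (\<open>symmetric_gradient_exists\<close>).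

  Uniqueness. A sector is determined by its end slope \<open>\<sigma>\<close> and
  the constant \<open>k\<close> of its vorticity (\<open>arc\<close>, \<open>arc_parameters_unique\<close>), and \<open>\<bar>\<sigma>\<bar>\<close> is the same for all
  sectors because \<open>\<psi>'\<close> is continuous. Existence of the symmetric gradient at a sink forces the constants
  of the two adjacent sectors to agree (\<open>matching\<close>). Symmetry of the vorticity under rotation by \<open>\<pi>\<close> passes to \<open>\<psi>\<close>
  (\<open>pi_periodic\<close>). With exactly two sinks there are then four sectors of equal opening
  angle \<open>\<pi>/2\<close>, which determines \<open>K\<close> by monotonicity (\<open>two_sink_structure\<close>). What is left free is a
  rotation and the amplitude, and the amplitude is a scaling by homogeneity.
\<close>

section \<open>Homogeneous functions in polar coordinates\<close>

definition dir :: "real \<Rightarrow> real^2" where "dir t = vector [cos t, sin t]"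
definition tang :: "real \<Rightarrow> real^2" where "tang t = vector [- sin t, cos t]"

lemma dir_nth [simp]: "dir t $ 1 = cos t" "dir t $ 2 = sin t"
  by (simp_all add: dir_def)
lemma tang_nth [simp]: "tang t $ 1 = - sin t" "tang t $ 2 = cos t"
  by (simp_all add: tang_def)

lemma inner_2: "(x::real^2) \<bullet> y = x $ 1 * y $ 1 + x $ 2 * y $ 2"
  by (simp add: inner_vec_def sum_2)
lemma norm_2: "norm (x::real^2) = sqrt ((x$1)\<^sup>2 + (x$2)\<^sup>2)"
  by (simp add: norm_eq_sqrt_inner inner_2 power2_eq_square)
lemma vec2_eq_iff: "(x::real^2) = y \<longleftrightarrow> x $ 1 = y $ 1 \<and> x $ 2 = y $ 2"
  by (simp add: vec_eq_iff forall_2)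

lemma norm_dir [simp]: "norm (dir t) = 1" by (simp add: norm_2)
lemma dir_nonzero [simp]: "dir t \<noteq> 0" by (metis norm_dir norm_zero zero_neq_one)
lemma inner_dir [simp]: "dir t \<bullet> dir t = 1" "dir t \<bullet> tang t = 0" "tang t \<bullet> dir t = 0" "tang t \<bullet> tang t = 1"
  by (simp_all add: inner_2 flip: power2_eq_square)
lemma dir_decomp: "x = (x \<bullet> dir t) *\<^sub>R dir t + (x \<bullet> tang t) *\<^sub>R tang t"
proof -
  have "c * (c * a + s * b) + s * (s * a - c * b) = (s\<^sup>2 + c\<^sup>2) * a" for a b c s :: real by algebra
  from this[of "cos t" "x$1" "sin t" "x$2"] have 1: "cos t * (cos t * x$1 + sin t * x$2) + sin t * (sin t * x$1 - cos t * x$2) = x $ 1"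
    by (simp only: sin_cos_squared_add mult_1)
  have "s * (c * a + s * b) - c * (s * a - c * b) = (s\<^sup>2 + c\<^sup>2) * b" for a b c s :: real by algebra
  from this[of "sin t" "cos t" "x$1" "x$2"] have 2: "sin t * (cos t * x$1 + sin t * x$2) - cos t * (sin t * x$1 - cos t * x$2) = x $ 2"
    by (simp only: sin_cos_squared_add mult_1)
  show ?thesis using 1 2 by (simp add: vec2_eq_iff inner_2 algebra_simps)
qed

lemma dir_add_pi [simp]: "dir (t + pi) = - dir t"
  by (simp add: vec2_eq_iff)
lemma dir_add_2pi [simp]: "dir (t + 2 * pi) = dir t"
  by (simp add: vec2_eq_iff)
lemma dir_eqD:
  assumes "dir a = dir b" obtains n :: int where "a = b + 2 * pi * n"
  using assms sin_cos_eq_iff[of a b] by (auto simp: vec2_eq_iff)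

definition angle :: "real^2 \<Rightarrow> real" where "angle x = Arg (Complex (x $ 1) (x $ 2))"

lemma polar_form: "x = norm x *\<^sub>R dir (angle x)"
proof (cases "x = 0")
  case False
  then have "Complex (x$1) (x$2) \<noteq> 0" by (auto simp: complex_eq_iff vec2_eq_iff)
  moreover have "cmod (Complex (x$1) (x$2)) = norm x" by (simp add: norm_2 complex_norm)
  ultimately show ?thesis using False
    by (simp add: vec2_eq_iff angle_def cos_Arg sin_Arg )
qed simp

lemma polarE:
  obtains r t where "r \<ge> 0" "x = r *\<^sub>R dir t" using polar_form norm_ge_zero by blast

definition periodic :: "real \<Rightarrow> (real \<Rightarrow> real) \<Rightarrow> bool" where
  "periodic T f \<longleftrightarrow> (\<forall>t. f (t + T) = f t)"

lemma periodic_int: assumes "periodic T f" shows "f (t + T * of_int n) = f t"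
proof -
  have *: "f (t + T * of_nat n) = f t" for t n
  proof (induction n)
    case (Suc n)
    have "f (t + T * real (Suc n)) = f ((t + T * real n) + T)" by (simp add: algebra_simps)
    then show ?case using assms Suc by (simp add: periodic_def)
  qed simp
  show ?thesis
  proof (cases "n \<ge> 0")
    case True then show ?thesis using *[of t "nat n"] by simp
  next
    case False then show ?thesis using *[of "t + T * of_int n" "nat (-n)"] by simp
  qed
qed

lemma periodic_dir: "periodic (2*pi) f \<Longrightarrow> dir a = dir b \<Longrightarrow> f a = f b"
  by (metis dir_eqD periodic_int)

text \<open>Homogeneous functions are closed under partial differentiation away from the origin, so gradients and Laplacians of profiles reduce to calculus in the single variable \<open>\<theta>\<close>.\<close>

definition homog :: "real \<Rightarrow> (real \<Rightarrow> real) \<Rightarrow> real^2 \<Rightarrow> real" where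
  "homog \<mu> f x = norm x powr \<mu> * f (angle x)"

lemma homog_dir:
  assumes "periodic (2*pi) f" "r \<ge> 0"
  shows "homog \<mu> f (r *\<^sub>R dir t) = r powr \<mu> * f t"
proof (cases "r = 0")
  case False
  then have r: "r > 0" using assms by simp
  have n: "norm (r *\<^sub>R dir t) = r" using r by simp
  have "r *\<^sub>R dir t = r *\<^sub>R dir (angle (r *\<^sub>R dir t))"
    using polar_form[of "r *\<^sub>R dir t"] n by simp
  then have "dir t = dir (angle (r *\<^sub>R dir t))" using r by simp
  then show ?thesis unfolding homog_def n using periodic_dir[OF assms(1)] by metis
qed (simp add: homog_def)

lemma homog_0 [simp]: "homog \<mu> f 0 = 0" by (simp add: homog_def)

lemma homog_scale:
  assumes "s > 0" shows "homog \<mu> f (s *\<^sub>R x) = s powr \<mu> * homog \<mu> f x"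
proof -
  have "Complex (s * x$1) (s * x$2) = of_real s * Complex (x$1) (x$2)" by (simp add: complex_eq_iff)
  then have "angle (s *\<^sub>R x) = angle x" using assms by (simp add: angle_def)
  then show ?thesis using assms by (simp add: homog_def powr_mult)
qed

text \<open>The global polar angle jumps across a ray. Near a given point it is replaced by the branch
  centred at that point, which a periodic angular factor cannot distinguish from it.\<close>

definition local_angle :: "real \<Rightarrow> real^2 \<Rightarrow> real" where
  "local_angle t y = t + arctan ((y \<bullet> tang t) / (y \<bullet> dir t))"

lemma local_angle:
  assumes "y \<bullet> dir t > 0" shows "y = norm y *\<^sub>R dir (local_angle t y)"
proof -
  define a b where "a = y \<bullet> dir t" and "b = y \<bullet> tang t"
  have a: "a > 0" using assms by (simp add: a_def)
  have y: "y = a *\<^sub>R dir t + b *\<^sub>R tang t" using dir_decomp[of y t] by (simp add: a_def b_def)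
  have "y \<bullet> y = a\<^sup>2 + b\<^sup>2" unfolding y by (simp add: inner_add inner_commute power2_eq_square)
  then have n: "norm y = sqrt (a\<^sup>2 + b\<^sup>2)" by (simp add: norm_eq_sqrt_inner)
  have "a\<^sup>2 + b\<^sup>2 = a\<^sup>2 * (1 + (b/a)\<^sup>2)" using a by (simp add: field_simps power2_eq_square)
  then have n2: "norm y = a * sqrt (1 + (b/a)\<^sup>2)" using a n by (simp add: real_sqrt_mult)
  have q: "sqrt (1 + (b/a)\<^sup>2) > 0" by (simp add: add_pos_nonneg)
  have c: "norm y * cos (arctan (b/a)) = a" "norm y * sin (arctan (b/a)) = b"
    unfolding n2 cos_arctan sin_arctan using q a by (auto simp del: real_sqrt_gt_0_iff)
  have "norm y *\<^sub>R dir (t + arctan (b/a)) = (norm y * cos (arctan (b/a))) *\<^sub>R dir t + (norm y * sin (arctan (b/a))) *\<^sub>R tang t"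
    unfolding vec2_eq_iff by (simp del: cos_arctan sin_arctan add: cos_add sin_add algebra_simps)
  also have "\<dots> = y" unfolding c by (rule y[symmetric])
  finally show ?thesis by (simp add: local_angle_def a_def b_def)
qed

lemma homog_local:
  assumes "periodic (2*pi) f" "y \<bullet> dir t > 0"
  shows "homog \<mu> f y = norm y powr \<mu> * f (local_angle t y)"
  using homog_dir[OF assms(1), of "norm y" \<mu> "local_angle t y"] local_angle[OF assms(2)] by simp

lemma homog_eventually_local:
  assumes "periodic (2*pi) f" "r > 0"
  shows "\<forall>\<^sub>F y in nhds (r *\<^sub>R dir t). homog \<mu> f y = norm y powr \<mu> * f (local_angle t y)"
proof -
  have "open {y. y \<bullet> dir t > 0}" by (intro open_Collect_less continuous_intros)
  then have "\<forall>\<^sub>F y in nhds (r *\<^sub>R dir t). y \<bullet> dir t > 0"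
    using assms(2) by (intro eventually_nhds_in_open[where s="{y. y \<bullet> dir t > 0}", simplified]) auto
  then show ?thesis by eventually_elim (rule homog_local[OF assms(1)])
qed

lemma local_angle_has_derivative:
  assumes "r > 0"
  shows "(local_angle t has_derivative (\<lambda>h. (h \<bullet> tang t) / r)) (at (r *\<^sub>R dir t))"
proof -
  have "((\<lambda>y. t + arctan ((y \<bullet> tang t) / (y \<bullet> dir t))) has_derivative (\<lambda>h. (h \<bullet> tang t) / r)) (at (r *\<^sub>R dir t))"
    using assms by (auto intro!: derivative_eq_intros simp: field_simps)
  then show ?thesis unfolding local_angle_def[abs_def] .
qed

lemma local_angle_same [simp]: "local_angle t (r *\<^sub>R dir t) = t"
  by (simp add: local_angle_def)

lemma norm_has_derivative_dir:
  assumes "r > 0" shows "(norm has_derivative (\<lambda>h. h \<bullet> dir t)) (at (r *\<^sub>R dir t))"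
proof -
  have "(norm has_derivative (\<lambda>h. h \<bullet> sgn (r *\<^sub>R dir t))) (at (r *\<^sub>R dir t))"
    using assms by (intro has_derivative_norm) auto
  then show ?thesis using assms by (simp add: sgn_div_norm)
qed

lemma homog_has_derivative:
  assumes per: "periodic (2*pi) f" and d: "(f has_real_derivative f') (at t)" and r: "r > 0"
  shows "(homog \<mu> f has_derivative
     (\<lambda>h. r powr (\<mu> - 1) * (\<mu> * f t * (h \<bullet> dir t) + f' * (h \<bullet> tang t)))) (at (r *\<^sub>R dir t))"
proof -
  have 1: "((\<lambda>y. norm y powr \<mu>) has_derivative (\<lambda>h. (h \<bullet> dir t) * (\<mu> * r powr (\<mu> - 1)))) (at (r *\<^sub>R dir t))"
  proof -
    have "((\<lambda>u::real. u powr \<mu>) has_derivative (\<lambda>h. h * (\<mu> * r powr (\<mu> - 1)))) (at (norm (r *\<^sub>R dir t)))"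
      using r by (auto intro!: derivative_eq_intros simp: fun_eq_iff)
        (simp add: powr_diff field_simps)
    from has_derivative_compose[OF norm_has_derivative_dir[OF r, of t] this] show ?thesis by simp
  qed
  have 2: "((\<lambda>y. f (local_angle t y)) has_derivative (\<lambda>h. f' * ((h \<bullet> tang t) / r))) (at (r *\<^sub>R dir t))"
    using has_derivative_compose[OF local_angle_has_derivative[OF r, of t], of f "\<lambda>h. f' * h"] d
    by (simp add: has_field_derivative_def)
  have "((\<lambda>y. norm y powr \<mu> * f (local_angle t y)) has_derivative
     (\<lambda>h. r powr (\<mu> - 1) * (\<mu> * f t * (h \<bullet> dir t) + f' * (h \<bullet> tang t)))) (at (r *\<^sub>R dir t))"
    using has_derivative_mult[OF 1 2] r
    by (simp add: powr_diff) (simp add: field_simps)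
  moreover have "\<forall>\<^sub>F y in at (r *\<^sub>R dir t). norm y powr \<mu> * f (local_angle t y) = homog \<mu> f y"
    using homog_eventually_local[OF per r, where t=t and \<mu>=\<mu>] unfolding eventually_at_filter
    by eventually_elim simp
  moreover have "norm (r *\<^sub>R dir t) powr \<mu> * f (local_angle t (r *\<^sub>R dir t)) = homog \<mu> f (r *\<^sub>R dir t)"
    using homog_dir[OF per, of r \<mu> t] r by simp
  ultimately show ?thesis
    by (rule has_derivative_transform_eventually) simp
qed

lemma homog_isCont:
  assumes per: "periodic (2*pi) f" and d: "isCont f t" and r: "r > 0"
  shows "isCont (homog \<mu> f) (r *\<^sub>R dir t)"
proof -
  have "isCont (local_angle t) (r *\<^sub>R dir t)"
    using has_derivative_continuous[OF local_angle_has_derivative[OF r]] .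
  then have "isCont (\<lambda>y. f (local_angle t y)) (r *\<^sub>R dir t)"
    by (rule isCont_o2) (use d in simp)
  then have "isCont (\<lambda>y. norm y powr \<mu> * f (local_angle t y)) (r *\<^sub>R dir t)"
    using r by (intro continuous_intros) auto
  then show ?thesis using isCont_cong[OF homog_eventually_local[OF per r, where t=t and \<mu>=\<mu>]] by simp
qed

lemma homog_isCont_0:
  assumes "\<mu> > 0" "\<And>t. \<bar>f t\<bar> \<le> C"
  shows "isCont (homog \<mu> f) 0"
proof -
  have "((\<lambda>x::real^2. norm x powr \<mu> * C) \<longlongrightarrow> 0) (at 0)"
  proof -
    have "((\<lambda>x::real^2. norm x powr \<mu> * C) \<longlongrightarrow> (0 powr \<mu>) * C) (at 0)"
      using assms(1) by (intro tendsto_intros tendsto_powr' tendsto_norm_zero) auto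
    then show ?thesis by simp
  qed
  then have "(homog \<mu> f \<longlongrightarrow> 0) (at 0)"
    by (rule Lim_null_comparison[rotated])
      (use assms in \<open>auto simp: homog_def abs_mult intro!: mult_left_mono always_eventually\<close>)
  then show ?thesis by (simp add: isCont_def)
qed

text \<open>Superlinear decay at the origin makes the derivative there vanish, however irregular the
  angular factor is.\<close>

lemma homog_has_derivative_0:
  assumes "\<mu> > 1" "\<And>t. \<bar>f t\<bar> \<le> C"
  shows "(homog \<mu> f has_derivative (\<lambda>h. 0)) (at 0)"
proof -
  have "((\<lambda>x. norm (homog \<mu> f x) / norm x) \<longlongrightarrow> 0) (at 0)"
  proof (rule Lim_null_comparison)
    show "\<forall>\<^sub>F x in at 0. norm (norm (homog \<mu> f x) / norm x) \<le> norm (x::real^2) powr (\<mu> - 1) * C"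
    proof (intro eventually_at_filter[THEN iffD2] always_eventually allI impI)
      fix x :: "real^2" assume "x \<noteq> 0"
      then have "norm (norm (homog \<mu> f x) / norm x) = norm x powr (\<mu> - 1) * \<bar>f (angle x)\<bar>"
        by (simp add: homog_def abs_mult powr_diff)
      also have "\<dots> \<le> norm x powr (\<mu> - 1) * C" by (intro mult_left_mono assms) auto
      finally show "norm (norm (homog \<mu> f x) / norm x) \<le> norm x powr (\<mu> - 1) * C" .
    qed
    have "((\<lambda>x::real^2. norm x powr (\<mu>-1) * C) \<longlongrightarrow> (0 powr (\<mu>-1)) * C) (at 0)"
      using assms(1) by (intro tendsto_intros tendsto_powr' tendsto_norm_zero) auto
    then show "((\<lambda>x::real^2. norm x powr (\<mu>-1) * C) \<longlongrightarrow> 0) (at 0)" by simp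
  qed
  then show ?thesis by (simp add: has_derivative_at)
qed

lemma grad_eqI: "(f has_derivative f') (at x) \<Longrightarrow> grad f x $ i = f' (axis i 1)"
  using frechet_derivative_at[of f f' x] by (simp add: grad_def)

lemma axis_nth2 [simp]: "axis 1 (1::real) $ (1::2) = 1" "axis 1 (1::real) $ (2::2) = 0"
  "axis 2 (1::real) $ (1::2) = 0" "axis 2 (1::real) $ (2::2) = 1"
  by (simp_all add: axis_def)

lemma grad_homog:
  assumes per: "periodic (2*pi) f" and d: "(f has_real_derivative f') (at t)" and r: "r > 0"
  shows "grad (homog \<mu> f) (r *\<^sub>R dir t) = r powr (\<mu> - 1) *\<^sub>R (\<mu> * f t) *\<^sub>R dir t + r powr (\<mu> - 1) *\<^sub>R f' *\<^sub>R tang t"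
proof -
  note * = grad_eqI[OF homog_has_derivative[OF assms, where \<mu>=\<mu>]]
  show ?thesis unfolding vec2_eq_iff using *[of 1] *[of 2] by (simp add: inner_2 algebra_simps)
qed

lemma periodic_bounded:
  assumes "periodic T f" "T > 0" "continuous_on UNIV f"
  obtains C where "\<And>t. \<bar>f t\<bar> \<le> C"
proof -
  have "compact (f ` {0..T})" using assms(3) by (intro compact_continuous_image continuous_on_subset[OF assms(3)]) auto
  then obtain C where C: "\<And>x. x \<in> {0..T} \<Longrightarrow> \<bar>f x\<bar> \<le> C"
    by (metis bounded_iff compact_imp_bounded image_eqI real_norm_def)
  have "\<bar>f t\<bar> \<le> C" for t
  proof -
    define n where "n = \<lfloor>t / T\<rfloor>"
    have "of_int n \<le> t / T" "t / T < of_int n + 1" unfolding n_def by linarith+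
    then have "t - T * of_int n \<in> {0..T}" using assms(2) by (auto simp: field_simps)
    moreover have "f (t - T * of_int n) = f t" using periodic_int[OF assms(1), of t "-n"] by simp
    ultimately show ?thesis using C by metis
  qed
  then show ?thesis using that by blast
qed

lemma homog_periodic_continuous:
  assumes "periodic (2*pi) f" "continuous_on UNIV f" "\<mu> > 0"
  shows "continuous_on UNIV (homog \<mu> f)"
proof -
  obtain C where C: "\<And>t. \<bar>f t\<bar> \<le> C" using periodic_bounded[OF assms(1) _ assms(2)] by auto
  have "isCont (homog \<mu> f) x" for x
  proof (cases "x = 0")
    case True then show ?thesis using homog_isCont_0[OF assms(3) C] by simp
  next
    case False
    have "isCont (homog \<mu> f) (norm x *\<^sub>R dir (angle x))"
      using assms False by (intro homog_isCont) (auto simp: continuous_on_eq_continuous_at)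
    then show ?thesis using polar_form[of x] by simp
  qed
  then show ?thesis by (simp add: continuous_on_eq_continuous_at)
qed

section \<open>Velocity fields of homogeneous stream functions\<close>

lemma central_difference:
  assumes "(g has_real_derivative D) (at r)"
  shows "((\<lambda>h. (g (r + h) - g (r - h)) / (2 * h)) \<longlongrightarrow> D) (at 0)"
proof -
  have 1: "((\<lambda>h. (g (r + h) - g r) / h) \<longlongrightarrow> D) (at 0)" using assms by (simp add: DERIV_def)
  have "filterlim (\<lambda>h::real. - h) (at 0) (at 0)"
    by (auto simp: filterlim_at eventually_at_filter intro!: tendsto_eq_intros)
  from filterlim_compose[OF 1 this] have 2: "((\<lambda>h. (g (r - h) - g r) / (- h)) \<longlongrightarrow> D) (at 0)" by simp
  have 3: "((\<lambda>h. ((g (r + h) - g r) / h + (g (r - h) - g r) / (- h)) / 2) \<longlongrightarrow> (D + D) / 2) (at 0)"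
    by (intro tendsto_intros 1 2) simp
  have "(\<lambda>h. ((g (r + h) - g r) / h + (g (r - h) - g r) / (- h)) / 2) = (\<lambda>h. (g (r + h) - g (r - h)) / (2 * h))"
    by (rule ext) (simp add: field_simps add_divide_distrib diff_divide_distrib)
  with 3 show ?thesis by simp
qed

lemma central_difference_frechet:
  fixes f :: "real^2 \<Rightarrow> real"
  assumes "(f has_derivative f') (at p)"
  shows "((\<lambda>h. (f (p + h *\<^sub>R v) - f (p - h *\<^sub>R v)) / (2 * h)) \<longlongrightarrow> f' v) (at 0)"
proof -
  interpret f': bounded_linear f' using assms by (rule has_derivative_bounded_linear)
  have 1: "((\<lambda>h. p + h *\<^sub>R v) has_derivative (\<lambda>h. h *\<^sub>R v)) (at (0::real))"
    by (auto intro!: derivative_eq_intros)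
  have "((\<lambda>h. f (p + h *\<^sub>R v)) has_derivative (\<lambda>h. f' (h *\<^sub>R v))) (at 0)"
    using has_derivative_compose[OF 1, of f f'] assms by simp
  then have "((\<lambda>h. f (p + h *\<^sub>R v)) has_real_derivative f' v) (at 0)"
    by (simp add: has_field_derivative_def f'.scaleR mult_commute_abs)
  from central_difference[OF this] show ?thesis by simp
qed

text \<open>A product is differentiable at a zero of one factor even if the other factor is merely
  continuous. This is why some combinations of \<open>\<psi>'\<close> stay differentiable on rays where \<open>\<psi>''\<close> blows up.\<close>

lemma DERIV_vanishing_mult:
  fixes a b :: "real \<Rightarrow> real"
  assumes "(a has_real_derivative a') (at t)" "a t = 0" "isCont b t"
  shows "((\<lambda>s. a s * b s) has_real_derivative a' * b t) (at t)"
proof -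
  have "((\<lambda>h. (a (t + h) - a t) / h) \<longlongrightarrow> a') (at 0)" using assms(1) by (simp add: DERIV_def)
  moreover have "((\<lambda>h. b (t + h)) \<longlongrightarrow> b t) (at 0)" using assms(3) by (simp add: isCont_def LIM_offset_zero_iff)
  ultimately have "((\<lambda>h. (a (t + h) - a t) / h * b (t + h)) \<longlongrightarrow> a' * b t) (at 0)" by (rule tendsto_mult)
  then show ?thesis using assms(2) by (simp add: DERIV_def)
qed

text \<open>The setting shared by the constructed profile and by an arbitrary one: a homogeneous stream
  function whose angular factor is continuously differentiable and nothing more.\<close>

locale stream =
  fixes \<alpha> :: real and \<psi> \<psi>' :: "real \<Rightarrow> real"
  assumes \<alpha>: "0 < \<alpha>" "\<alpha> < 1"
    and per: "periodic (2*pi) \<psi>"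
    and deriv: "\<And>t. (\<psi> has_real_derivative \<psi>' t) (at t)"
    and cont': "continuous_on UNIV \<psi>'"
begin

abbreviation "\<Psi> \<equiv> homog (2 - \<alpha>) \<psi>"
abbreviation "V \<equiv> pseudo_velocity \<alpha> \<Psi>"

lemma cont: "continuous_on A \<psi>"
  using deriv by (intro DERIV_continuous_on) (auto intro: has_field_derivative_at_within)
lemma isCont': "isCont \<psi>' t" using cont' by (simp add: continuous_on_eq_continuous_at)

lemma per': "periodic (2*pi) \<psi>'"
  unfolding periodic_def
proof
  fix t
  have "((\<lambda>s. \<psi> (s + 2*pi)) has_real_derivative \<psi>' (t + 2*pi)) (at t)"
    using deriv[of "t + 2*pi"] by (simp add: DERIV_shift)
  then have "(\<psi> has_real_derivative \<psi>' (t + 2*pi)) (at t)" using per by (simp add: periodic_def)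
  then show "\<psi>' (t + 2*pi) = \<psi>' t" using deriv DERIV_unique by blast
qed

text \<open>The angular factors of the two Cartesian derivatives of the stream function.\<close>

definition "d1 t = (2 - \<alpha>) * cos t * \<psi> t - sin t * \<psi>' t"
definition "d2 t = (2 - \<alpha>) * sin t * \<psi> t + cos t * \<psi>' t"

lemma per_d: "periodic (2*pi) d1" "periodic (2*pi) d2"
  using per per' by (simp_all add: periodic_def d1_def d2_def)
lemma cont_d: "continuous_on UNIV d1" "continuous_on UNIV d2"
  unfolding d1_def d2_def by (intro continuous_intros cont cont')+

lemma stream_differentiable: "\<Psi> differentiable (at x)"
  and stream_grad: "grad \<Psi> x $ 1 = homog (1 - \<alpha>) d1 x" "grad \<Psi> x $ 2 = homog (1 - \<alpha>) d2 x"
proof -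
  have "\<Psi> differentiable (at x) \<and> grad \<Psi> x $ 1 = homog (1 - \<alpha>) d1 x \<and> grad \<Psi> x $ 2 = homog (1 - \<alpha>) d2 x"
  proof (cases "x = 0")
    case True
    obtain C where "\<And>t. \<bar>\<psi> t\<bar> \<le> C" using periodic_bounded[OF per _ cont] by auto
    then have *: "(\<Psi> has_derivative (\<lambda>h. 0)) (at 0)" using \<alpha> by (intro homog_has_derivative_0) auto
    then show ?thesis using True grad_eqI[OF *] by (auto intro: differentiableI)
  next
    case False
    define r t where "r = norm x" and "t = angle x"
    have x: "x = r *\<^sub>R dir t" unfolding r_def t_def by (rule polar_form)
    have r: "r > 0" using False by (simp add: r_def)
    have *: "homog (1 - \<alpha>) d1 x = r powr (1 - \<alpha>) * d1 t" "homog (1 - \<alpha>) d2 x = r powr (1 - \<alpha>) * d2 t"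
      unfolding x using r by (simp_all add: homog_dir per_d)
    show ?thesis using homog_has_derivative[OF per deriv r, of "2 - \<alpha>" t]
      unfolding * unfolding x grad_homog[OF per deriv r]
      by (auto intro!: differentiableI simp: d1_def d2_def algebra_simps)
  qed
  then show "\<Psi> differentiable (at x)" "grad \<Psi> x $ 1 = homog (1 - \<alpha>) d1 x" "grad \<Psi> x $ 2 = homog (1 - \<alpha>) d2 x" by auto
qed

lemma stream_grad_nth_cont: "continuous_on UNIV (\<lambda>x. grad \<Psi> x $ 1)" "continuous_on UNIV (\<lambda>x. grad \<Psi> x $ 2)"
  unfolding stream_grad using \<alpha> by (auto intro!: homog_periodic_continuous per_d cont_d)

lemma stream_grad_cont: "continuous_on UNIV (grad \<Psi>)"
proof -
  have "continuous_on UNIV (\<lambda>x. \<chi> i. grad \<Psi> x $ i)"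
    by (rule continuous_on_vec_lambda) (use stream_grad_nth_cont in \<open>metis (full_types) exhaust_2\<close>)
  then show ?thesis by simp
qed

lemma V_nth: "V x $ 1 = - homog (1 - \<alpha>) d2 x - x $ 1 / \<alpha>" "V x $ 2 = homog (1 - \<alpha>) d1 x - x $ 2 / \<alpha>"
  by (simp_all add: pseudo_velocity_def perp_grad_def stream_grad)

lemma V_polar:
  assumes "r \<ge> 0"
  shows "V (r *\<^sub>R dir t) = (- (r powr (1 - \<alpha>)) * \<psi>' t - r / \<alpha>) *\<^sub>R dir t + (r powr (1 - \<alpha>) * ((2 - \<alpha>) * \<psi> t)) *\<^sub>R tang t"
  unfolding vec2_eq_iff V_nth homog_dir[OF per_d(1) assms] homog_dir[OF per_d(2) assms]
  by (simp add: d1_def d2_def algebra_simps)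

lemma V_0 [simp]: "V 0 = 0" by (simp add: vec2_eq_iff V_nth)

lemma V_inner_dir: "V x \<bullet> dir t = - homog (1 - \<alpha>) (\<lambda>s. (2 - \<alpha>) * sin (s - t) * \<psi> s + cos (s - t) * \<psi>' s) x - (x \<bullet> dir t) / \<alpha>"
  and V_inner_tang: "V x \<bullet> tang t = homog (1 - \<alpha>) (\<lambda>s. (2 - \<alpha>) * cos (s - t) * \<psi> s - sin (s - t) * \<psi>' s) x - (x \<bullet> tang t) / \<alpha>"
  by (simp_all add: inner_2 V_nth homog_def d1_def d2_def sin_diff cos_diff algebra_simps add_divide_distrib diff_divide_distrib)

lemma stagnation_iff:
  assumes "r > 0"
  shows "V (r *\<^sub>R dir t) = 0 \<longleftrightarrow> \<psi> t = 0 \<and> \<psi>' t = - (r powr \<alpha>) / \<alpha>"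
proof -
  have "V (r *\<^sub>R dir t) = 0 \<longleftrightarrow> V (r *\<^sub>R dir t) \<bullet> dir t = 0 \<and> V (r *\<^sub>R dir t) \<bullet> tang t = 0"
    using dir_decomp[of "V (r *\<^sub>R dir t)" t] by auto
  also have "\<dots> \<longleftrightarrow> - (r powr (1 - \<alpha>)) * \<psi>' t - r / \<alpha> = 0 \<and> r powr (1 - \<alpha>) * ((2 - \<alpha>) * \<psi> t) = 0"
    unfolding V_polar[OF less_imp_le[OF assms]] by (simp add: inner_add_left)
  also have "\<dots> \<longleftrightarrow> \<psi> t = 0 \<and> \<psi>' t = - (r powr \<alpha>) / \<alpha>"
  proof -
    have "- (r powr (1 - \<alpha>)) * \<psi>' t - r / \<alpha> = - (r powr (1 - \<alpha>)) * (\<psi>' t + r powr \<alpha> / \<alpha>)"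
      using assms \<alpha> by (simp add: algebra_simps flip: powr_add)
    then have "- (r powr (1 - \<alpha>)) * \<psi>' t - r / \<alpha> = 0 \<longleftrightarrow> \<psi>' t + r powr \<alpha> / \<alpha> = 0" using assms by simp
    then show ?thesis using assms \<alpha> by (auto simp: add_eq_0_iff)
  qed
  finally show ?thesis .
qed

text \<open>The velocity component across the ray is Frechet differentiable at a stagnation point: the only
  dangerous term \<open>\<psi>'\<close> enters multiplied by a sine that vanishes there. Its derivative uses the
  stagnation condition to eliminate \<open>\<psi>'\<close> in favour of \<open>\<alpha>\<close>.\<close>

lemma symmetric_gradient_tang:
  assumes r: "r > 0" and st: "V (r *\<^sub>R dir t) = 0"
  shows "((\<lambda>h. (V (r *\<^sub>R dir t + h *\<^sub>R v) \<bullet> tang t - V (r *\<^sub>R dir t - h *\<^sub>R v) \<bullet> tang t) / (2 * h))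
     \<longlongrightarrow> (1 - 2 / \<alpha>) * (v \<bullet> tang t)) (at 0)"
proof -
  let ?f = "\<lambda>s. (2 - \<alpha>) * cos (s - t) * \<psi> s - sin (s - t) * \<psi>' s"
  have z: "\<psi> t = 0" "\<psi>' t = - (r powr \<alpha>) / \<alpha>" using st stagnation_iff[OF r] by auto
  have "((\<lambda>s. sin (s - t) * \<psi>' s) has_real_derivative 1 * \<psi>' t) (at t)"
    by (intro DERIV_vanishing_mult isCont') (auto intro!: derivative_eq_intros)
  then have "(?f has_real_derivative ((2 - \<alpha>) * \<psi>' t - 1 * \<psi>' t)) (at t)"
    by - (rule DERIV_diff, auto intro!: derivative_eq_intros deriv simp: z(1))
  then have d: "(?f has_real_derivative (1 - \<alpha>) * \<psi>' t) (at t)" by (simp add: algebra_simps)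
  have p: "periodic (2*pi) ?f" using per per'
    by (auto simp: periodic_def sin_diff cos_diff)
  have X: "((\<lambda>x. (x \<bullet> tang t) / \<alpha>) has_derivative (\<lambda>h. (h \<bullet> tang t) / \<alpha>)) (at (r *\<^sub>R dir t))"
    by (intro bounded_linear.has_derivative[OF bounded_linear_divide] has_derivative_inner_left has_derivative_ident)
  note has_derivative_diff[OF homog_has_derivative[OF p d r, where \<mu> = "1 - \<alpha>"] X]
  note central_difference_frechet[OF this, of v]
  moreover have "r powr (1 - \<alpha> - 1) * ((1 - \<alpha>) * ?f t * (v \<bullet> dir t) + (1 - \<alpha>) * \<psi>' t * (v \<bullet> tang t)) - (v \<bullet> tang t) / \<alpha>
      = (1 - 2 / \<alpha>) * (v \<bullet> tang t)"
    using r \<alpha> by (simp add: z powr_minus field_simps)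
  ultimately show ?thesis unfolding V_inner_tang by simp
qed

lemma symmetric_gradient_radial:
  assumes r: "r > 0" and st: "V (r *\<^sub>R dir t) = 0"
  shows "((\<lambda>h. (V (r *\<^sub>R dir t + h *\<^sub>R dir t) \<bullet> dir t - V (r *\<^sub>R dir t - h *\<^sub>R dir t) \<bullet> dir t) / (2 * h))
     \<longlongrightarrow> -1) (at 0)"
proof -
  have z: "\<psi> t = 0" "\<psi>' t = - (r powr \<alpha>) / \<alpha>" using st stagnation_iff[OF r] by auto
  define g where "g u = - (u powr (1 - \<alpha>)) * \<psi>' t - u / \<alpha>" for u
  have "(g has_real_derivative -1) (at r)"
  proof -
    have "((\<lambda>u. u powr (1 - \<alpha>)) has_real_derivative (1 - \<alpha>) * r powr (1 - \<alpha> - 1)) (at r)"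
      by (rule has_real_derivative_powr[OF r])
    then have "(g has_real_derivative - ((1 - \<alpha>) * r powr (1 - \<alpha> - 1)) * \<psi>' t - 1 / \<alpha>) (at r)"
      unfolding g_def by (intro DERIV_diff DERIV_cmult_right DERIV_minus DERIV_cdivide DERIV_ident)
    moreover have "- ((1 - \<alpha>) * r powr (1 - \<alpha> - 1)) * \<psi>' t - 1 / \<alpha> = -1"
      using r \<alpha> by (simp add: z powr_minus field_simps)
    ultimately show ?thesis by simp
  qed
  from central_difference[OF this] have "((\<lambda>h. (g (r + h) - g (r - h)) / (2 * h)) \<longlongrightarrow> -1) (at 0)" .
  moreover have "\<forall>\<^sub>F h in at 0. (g (r + h) - g (r - h)) / (2 * h) =
      (V (r *\<^sub>R dir t + h *\<^sub>R dir t) \<bullet> dir t - V (r *\<^sub>R dir t - h *\<^sub>R dir t) \<bullet> dir t) / (2 * h)"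
  proof -
    have *: "V (u *\<^sub>R dir t) \<bullet> dir t = g u" if "u \<ge> 0" for u
      unfolding V_polar[OF that] by (simp add: inner_add_left g_def)
    have "\<forall>\<^sub>F h in at 0. h \<in> {-r<..<r}" using r by (intro eventually_at_in_open') auto
    then show ?thesis
    proof eventually_elim
      case (elim h)
      then show ?case using *[of "r + h"] *[of "r - h"] by (simp add: algebra_simps)
    qed
  qed
  ultimately show ?thesis by (rule Lim_transform_eventually)
qed

text \<open>In the frame of radial and angular directions the gradient is triangular with diagonal entries
  \<open>-1\<close> and \<open>1 - 2/\<alpha>\<close>, whatever the off-diagonal entry is. Hence every stagnation point away from the
  origin at which a gradient exists is a sink, and counting sinks amounts to counting the zeros at
  which \<open>\<psi>\<close> decreases.\<close>

lemma stagnation_negative_eigenvalues: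
  assumes r: "r > 0" and st: "V (r *\<^sub>R dir t) = 0" and A: "has_symmetric_gradient V A (r *\<^sub>R dir t)"
  shows "negative_eigenvalues A"
proof -
  have lim: "((\<lambda>h. (V (r *\<^sub>R dir t + h *\<^sub>R v) \<bullet> u - V (r *\<^sub>R dir t - h *\<^sub>R v) \<bullet> u) / (2 * h))
     \<longlongrightarrow> (A *v v) \<bullet> u) (at 0)" for u v
    using tendsto_inner[OF A[unfolded has_symmetric_gradient_def, rule_format, of v] tendsto_const[of u]]
    by (simp add: inner_diff_left)
  have T: "(A *v v) \<bullet> tang t = (1 - 2 / \<alpha>) * (v \<bullet> tang t)" for v
    using tendsto_unique[OF _ lim symmetric_gradient_tang[OF r st]] by simp
  have R: "(A *v dir t) \<bullet> dir t = -1"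
    using tendsto_unique[OF _ lim symmetric_gradient_radial[OF r st]] by simp
  have Ad: "A *v dir t = - dir t"
    using dir_decomp[of "A *v dir t" t] R T[of "dir t"] by simp
  define \<kappa> where "\<kappa> = 1 - 2 / \<alpha>"
  have \<kappa>: "\<kappa> < 0" using \<alpha> by (simp add: \<kappa>_def field_simps)
  define c s where "c = cos t" and "s = sin t"
  have cs: "c * c + s * s = 1" unfolding c_def s_def by (simp flip: power2_eq_square)
  define a11 a12 a21 a22 where "a11 = A $ 1 $ 1" and "a12 = A $ 1 $ 2" and "a21 = A $ 2 $ 1" and "a22 = A $ 2 $ 2"
  note adefs = a11_def a12_def a21_def a22_def
  have e1: "a11 * c + a12 * s = - c" "a21 * c + a22 * s = - s"
    using Ad by (simp_all add: vec2_eq_iff matrix_vector_mult_def sum_2 c_def s_def adefs)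
  have e2: "- s * a11 + c * a21 = - s * \<kappa>" "- s * a12 + c * a22 = c * \<kappa>"
    using T[of "axis 1 1"] T[of "axis 2 1"]
    by (simp_all add: inner_2 matrix_vector_mult_def sum_2 c_def s_def adefs \<kappa>_def algebra_simps)
  show ?thesis unfolding negative_eigenvalues_def
  proof (intro allI impI, elim conjE)
    fix \<mu> :: complex and v :: "complex^2"
    assume v: "v \<noteq> 0" and eig: "(\<chi> i j. complex_of_real (A $ i $ j)) *v v = \<mu> *s v"
    let ?C = complex_of_real
    have E: "?C a11 * v$1 + ?C a12 * v$2 = \<mu> * v$1" "?C a21 * v$1 + ?C a22 * v$2 = \<mu> * v$2"
      using eig by (simp_all add: vec_eq_iff forall_2 matrix_vector_mult_def sum_2 adefs)
    define y x where "y = - ?C s * v$1 + ?C c * v$2" and "x = ?C c * v$1 + ?C s * v$2"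
    have csC: "?C c * ?C c + ?C s * ?C s = 1" using cs by (metis of_real_add of_real_mult of_real_1)
    have e2C: "- ?C s * ?C a11 + ?C c * ?C a21 = - ?C s * ?C \<kappa>" "- ?C s * ?C a12 + ?C c * ?C a22 = ?C c * ?C \<kappa>"
      using e2 by (simp_all only: of_real_mult[symmetric] of_real_add[symmetric] of_real_minus[symmetric])
    have e1C: "?C a11 * ?C c + ?C a12 * ?C s = - ?C c" "?C a21 * ?C c + ?C a22 * ?C s = - ?C s"
      using e1 by (simp_all only: of_real_mult[symmetric] of_real_add[symmetric] of_real_minus[symmetric])
    have "\<mu> * y = - ?C s * (\<mu> * v$1) + ?C c * (\<mu> * v$2)" by (simp add: y_def algebra_simps)
    also have "\<dots> = (- ?C s * ?C a11 + ?C c * ?C a21) * v$1 + (- ?C s * ?C a12 + ?C c * ?C a22) * v$2"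
      unfolding E[symmetric] by (simp add: algebra_simps)
    also have "\<dots> = ?C \<kappa> * y" unfolding e2C by (simp add: y_def algebra_simps)
    finally have my: "\<mu> * y = ?C \<kappa> * y" .
    show "Re \<mu> < 0"
    proof (cases "y = 0")
      case False
      then have "\<mu> = ?C \<kappa>" using my by simp
      then show ?thesis using \<kappa> by simp
    next
      case True
      have v1: "v$1 = ?C c * x - ?C s * y" and v2: "v$2 = ?C s * x + ?C c * y"
      proof -
        have "?C c * x - ?C s * y = (?C c * ?C c + ?C s * ?C s) * v$1" by (simp add: x_def y_def algebra_simps)
        then show "v$1 = ?C c * x - ?C s * y" by (simp add: csC)
        have "?C s * x + ?C c * y = (?C c * ?C c + ?C s * ?C s) * v$2" by (simp add: x_def y_def algebra_simps)
        then show "v$2 = ?C s * x + ?C c * y" by (simp add: csC)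
      qed
      have x0: "x \<noteq> 0" using v True v1 v2 by (auto simp: vec_eq_iff forall_2)
      have "\<mu> * x = ?C c * (?C a11 * v$1 + ?C a12 * v$2) + ?C s * (?C a21 * v$1 + ?C a22 * v$2)"
        unfolding E by (simp add: x_def algebra_simps)
      also have "\<dots> = x * (?C c * (?C a11 * ?C c + ?C a12 * ?C s) + ?C s * (?C a21 * ?C c + ?C a22 * ?C s))"
        unfolding v1 v2 True by (simp add: algebra_simps)
      also have "\<dots> = - x" unfolding e1C using csC by (simp add: algebra_simps flip: distrib_left)
      finally have "\<mu> = -1" using x0 by (metis minus_mult_left mult_1 mult_right_cancel)
      then show ?thesis by simp
    qed
  qed
qed

end

section \<open>The origin, the sinks and the equations in polar form\<close>

lemma dir_has_vector_derivative: "(dir has_vector_derivative tang t) (at t)"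
proof -
  have *: "dir s = cos s *\<^sub>R axis 1 1 + sin s *\<^sub>R axis 2 1" for s by (simp add: vec2_eq_iff)
  have **: "tang t = (- sin t) *\<^sub>R axis 1 1 + cos t *\<^sub>R axis 2 1" by (simp add: vec2_eq_iff)
  show ?thesis unfolding *[abs_def] **
    by (intro has_vector_derivative_add has_vector_derivative_scaleR[of _ _ _ _ "\<lambda>_. 0", simplified])
      (auto intro!: derivative_eq_intros)
qed

lemma tang_has_vector_derivative: "(tang has_vector_derivative - dir t) (at t)"
proof -
  have *: "tang s = (- sin s) *\<^sub>R axis 1 1 + cos s *\<^sub>R axis 2 1" for s by (simp add: vec2_eq_iff)
  have **: "- dir t = (- cos t) *\<^sub>R axis 1 1 + (- sin t) *\<^sub>R axis 2 1" by (simp add: vec2_eq_iff)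
  show ?thesis unfolding *[abs_def] **
    by (intro has_vector_derivative_add has_vector_derivative_scaleR[of _ _ _ _ "\<lambda>_. 0", simplified])
      (auto intro!: derivative_eq_intros)
qed

lemma dir_differentiable: "dir differentiable (at t)" "tang differentiable (at t)"
  using dir_has_vector_derivative tang_has_vector_derivative
  by (auto simp: differentiable_def has_vector_derivative_def)

lemma filtercomap_ereal_at_left: "filtercomap ereal (at_left (ereal T)) = at_left T"
  unfolding filter_eq_iff eventually_filtercomap at_left_ereal eventually_filtermap
proof (intro allI iffI)
  fix P assume "eventually P (at_left T)"
  then show "\<exists>Q. (\<forall>\<^sub>F x in at_left T. Q (ereal x)) \<and> (\<forall>x. Q (ereal x) \<longrightarrow> P x)"
    by (intro exI[of _ "\<lambda>y. P (real_of_ereal y)"]) auto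
qed (auto elim: eventually_mono)

text \<open>On an invariant ray the radius solves a Bernoulli equation, which becomes linear for \<open>u = \<rho>\<^sup>\<alpha>\<close>.
  The trajectory reaches the origin in the finite time at which the linear solution vanishes.\<close>

lemma enters_origin_radially:
  fixes u u' :: "real \<Rightarrow> real"
  assumes \<alpha>: "0 < \<alpha>" and T: "0 < T"
    and W: "\<And>\<rho>. \<rho> > 0 \<Longrightarrow> W (\<rho> *\<^sub>R dir t) = (- \<sigma> * \<rho> powr (1 - \<alpha>) + \<kappa> * \<rho> / \<alpha>) *\<^sub>R dir t"
    and u: "\<And>s. 0 < s \<Longrightarrow> s < T \<Longrightarrow> u s > 0"
    and u': "\<And>s. (u has_real_derivative - \<alpha> * \<sigma> + \<kappa> * u s) (at s)"
    and uT: "u T = 0"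
  shows "enters_origin_along W (dir t)"
proof -
  define X where "X s = (u s powr (1 / \<alpha>)) *\<^sub>R dir t" for s
  have X': "(X has_vector_derivative W (X s)) (at s)" if "0 < s" "s < T" for s
  proof -
    have us: "u s > 0" using u that by auto
    have "((\<lambda>s. u s powr (1 / \<alpha>)) has_real_derivative (1 / \<alpha>) * u s powr (1 / \<alpha> - 1) * (- \<alpha> * \<sigma> + \<kappa> * u s)) (at s)"
      using DERIV_chain2[OF has_real_derivative_powr[OF us, of "1 / \<alpha>"] u'[of s]] by simp
    then have "(X has_vector_derivative ((1 / \<alpha>) * u s powr (1 / \<alpha> - 1) * (- \<alpha> * \<sigma> + \<kappa> * u s)) *\<^sub>R dir t) (at s)"
      unfolding X_def[abs_def] using has_vector_derivative_scaleR[OF _ has_vector_derivative_const] by fastforce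
    moreover have "W (X s) = ((1 / \<alpha>) * u s powr (1 / \<alpha> - 1) * (- \<alpha> * \<sigma> + \<kappa> * u s)) *\<^sub>R dir t"
    proof -
      have 1: "(u s powr (1 / \<alpha>)) powr (1 - \<alpha>) = u s powr (1 / \<alpha> - 1)"
        unfolding powr_powr using \<alpha> by (simp add: field_simps)
      have 2: "u s powr (1 / \<alpha>) = u s powr (1 / \<alpha> - 1) * u s" using us by (simp add: powr_diff)
      have "W (X s) = (- \<sigma> * (u s powr (1 / \<alpha>)) powr (1 - \<alpha>) + \<kappa> * u s powr (1 / \<alpha>) / \<alpha>) *\<^sub>R dir t"
        unfolding X_def using us by (intro W) auto
      also have "- \<sigma> * (u s powr (1 / \<alpha>)) powr (1 - \<alpha>) + \<kappa> * u s powr (1 / \<alpha>) / \<alpha>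
          = (1 / \<alpha>) * u s powr (1 / \<alpha> - 1) * (- \<alpha> * \<sigma> + \<kappa> * u s)"
        unfolding 1 unfolding 2 using \<alpha> by (simp add: field_simps)
      finally show ?thesis .
    qed
    ultimately show ?thesis by simp
  qed
  have "isCont u T" using u' DERIV_isCont by blast
  then have "(u \<longlongrightarrow> 0) (at_left T)" using uT by (simp add: isCont_def tendsto_within_subset[where S=UNIV])
  moreover have pos: "\<forall>\<^sub>F s in at_left T. 0 < s \<and> s < T" using T by (intro eventually_at_leftI[of 0]) auto
  ultimately have "((\<lambda>s. u s powr (1 / \<alpha>)) \<longlongrightarrow> 0 powr (1 / \<alpha>)) (at_left T)"
    using \<alpha> u by (intro tendsto_powr') (auto intro: eventually_mono[OF pos] less_imp_le)
  from tendsto_scaleR[OF this tendsto_const[of "dir t"]]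
  have 1: "(X \<longlongrightarrow> 0) (at_left T)" unfolding X_def by simp
  have 2: "((\<lambda>s. (1 / norm (X s)) *\<^sub>R X s) \<longlongrightarrow> dir t) (at_left T)"
  proof (rule tendsto_eventually, rule eventually_mono[OF pos])
    fix s assume "0 < s \<and> s < T"
    then have "u s > 0" using u by auto
    then show "(1 / norm (X s)) *\<^sub>R X s = dir t" by (simp add: X_def)
  qed
  show ?thesis unfolding enters_origin_along_def
    apply (rule exI[of _ X], rule exI[of _ "ereal T"])
    unfolding filtercomap_ereal_at_left using T 1 2 X' u
    by (auto simp: X_def intro: less_imp_neq dest: u)
qed

context stream begin

text \<open>The zeros of \<open>\<psi>\<close> are invariant rays. The radial velocity near the origin is dominated by
  \<open>- r\<close>-to-the-\<open>(1-\<alpha>)\<close> times \<open>\<psi>'\<close>, so that the sign of \<open>\<psi>'\<close> decides between entering and leaving.\<close>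

lemma saddle:
  assumes "\<psi> a = 0" "\<psi>' a > 0" "\<psi> b = 0" "\<psi>' b < 0"
  shows "saddle_at_origin V"
proof -
  have "enters_origin_along V (dir a)"
  proof (rule enters_origin_radially[where \<sigma> = "\<psi>' a" and \<kappa> = "-1" and T = "ln 2" and u = "\<lambda>s. \<alpha> * \<psi>' a * (2 * exp (- s) - 1)"])
    fix s :: real assume "0 < s" "s < ln 2"
    then have "exp s < exp (ln 2)" by (subst exp_less_cancel_iff)
    then have "2 * exp (- s) - 1 > 0" by (simp add: exp_minus field_simps)
    then show "\<alpha> * \<psi>' a * (2 * exp (- s) - 1) > 0" using \<alpha> assms by (intro mult_pos_pos) auto
  next
    fix s show "((\<lambda>s. \<alpha> * \<psi>' a * (2 * exp (- s) - 1)) has_real_derivative - \<alpha> * \<psi>' a + - 1 * (\<alpha> * \<psi>' a * (2 * exp (- s) - 1))) (at s)"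
      by (auto intro!: derivative_eq_intros simp: algebra_simps)
  next
    fix \<rho> :: real assume "\<rho> > 0"
    then show "V (\<rho> *\<^sub>R dir a) = (- \<psi>' a * \<rho> powr (1 - \<alpha>) + - 1 * \<rho> / \<alpha>) *\<^sub>R dir a"
      by (simp add: V_polar assms mult.commute)
  qed (use \<alpha> in \<open>auto simp: exp_minus\<close>)
  moreover have "leaves_origin_along V (dir b)" unfolding leaves_origin_along_def
  proof (rule enters_origin_radially[where \<sigma> = "- \<psi>' b" and \<kappa> = "1" and T = "ln 2" and u = "\<lambda>s. \<alpha> * (- \<psi>' b) * (1 - exp s / 2)"])
    fix s :: real assume "0 < s" "s < ln 2"
    then have "exp s < exp (ln 2)" by (subst exp_less_cancel_iff)
    then have "1 - exp s / 2 > 0" by (simp add: field_simps)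
    then show "\<alpha> * (- \<psi>' b) * (1 - exp s / 2) > 0" using \<alpha> assms by (intro mult_pos_pos) auto
  next
    fix s show "((\<lambda>s. \<alpha> * (- \<psi>' b) * (1 - exp s / 2)) has_real_derivative - \<alpha> * (- \<psi>' b) + 1 * (\<alpha> * (- \<psi>' b) * (1 - exp s / 2))) (at s)"
      by (auto intro!: derivative_eq_intros simp: algebra_simps)
  next
    fix \<rho> :: real assume "\<rho> > 0"
    then show "- V (\<rho> *\<^sub>R dir b) = (- (- \<psi>' b) * \<rho> powr (1 - \<alpha>) + 1 * \<rho> / \<alpha>) *\<^sub>R dir b"
      by (simp add: V_polar assms mult.commute flip: scaleR_minus_left)
  qed (use \<alpha> in auto)
  moreover have "dir a \<noteq> dir b" using periodic_dir[OF per', of a b] assms by auto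
  ultimately show ?thesis unfolding saddle_at_origin_def by auto
qed

lemma is_sink_iff:
  assumes "gradient_at_stagnation_points V"
  shows "is_sink V p \<longleftrightarrow> p \<noteq> 0 \<and> V p = 0"
proof
  assume p: "p \<noteq> 0 \<and> V p = 0"
  then obtain A where A: "has_symmetric_gradient V A p" using assms unfolding gradient_at_stagnation_points_def by auto
  have "negative_eigenvalues A"
    using stagnation_negative_eigenvalues[of "norm p" "angle p" A] p A polar_form[of p] by auto
  then show "is_sink V p" using p A unfolding is_sink_def by auto
qed (auto simp: is_sink_def)

text \<open>On a ray where \<open>\<psi>\<close> decreases through zero, this is the radius at which the outward velocity is
  balanced by the drift \<open>- \<xi>/\<alpha>\<close>.\<close>

definition "stagnation_radius t = (- \<alpha> * \<psi>' t) powr (1 / \<alpha>)"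

lemma stagnation_radius:
  assumes "\<psi> t = 0" "\<psi>' t < 0"
  shows "stagnation_radius t > 0" "V (stagnation_radius t *\<^sub>R dir t) = 0"
proof -
  have p: "- \<alpha> * \<psi>' t > 0" using assms \<alpha> by (simp add: mult_less_0_iff)
  show r: "stagnation_radius t > 0" using \<alpha> assms(2) by (simp add: stagnation_radius_def)
  have "stagnation_radius t powr \<alpha> = - \<alpha> * \<psi>' t"
  proof -
    have "\<alpha> \<noteq> 0" "\<psi>' t \<noteq> 0" using \<alpha> assms(2) by auto
    then show ?thesis using p unfolding stagnation_radius_def powr_powr by simp
  qed
  then show "V (stagnation_radius t *\<^sub>R dir t) = 0" unfolding stagnation_iff[OF r] using assms \<alpha> by simp
qed

lemma stagnation_pointE:
  assumes "p \<noteq> 0" "V p = 0"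
  obtains t where "\<psi> t = 0" "\<psi>' t < 0" "p = stagnation_radius t *\<^sub>R dir t"
proof -
  have p: "p = norm p *\<^sub>R dir (angle p)" by (rule polar_form)
  have n: "norm p > 0" using assms by simp
  have *: "\<psi> (angle p) = 0 \<and> \<psi>' (angle p) = - (norm p powr \<alpha>) / \<alpha>"
    using stagnation_iff[OF n, of "angle p"] p assms by simp
  then have "- \<alpha> * \<psi>' (angle p) = norm p powr \<alpha>" using \<alpha> by simp
  then have "stagnation_radius (angle p) = norm p" unfolding stagnation_radius_def using \<alpha> n by (simp add: powr_powr)
  moreover have "\<psi>' (angle p) < 0" using * n \<alpha> by (simp add: divide_neg_pos)
  ultimately show ?thesis using that[of "angle p"] p * by auto
qed

lemma stream_laplacian:
  assumes d: "(\<psi>' has_real_derivative c) (at t)" and r: "r > 0"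
  shows "grad \<Psi> differentiable (at (r *\<^sub>R dir t))"
    and "grad (\<lambda>y. grad \<Psi> y $ 1) (r *\<^sub>R dir t) = r powr (-\<alpha>) *\<^sub>R ((1-\<alpha>) * d1 t) *\<^sub>R dir t
       + r powr (-\<alpha>) *\<^sub>R ((1 - \<alpha>) * cos t * \<psi>' t - (2-\<alpha>) * sin t * \<psi> t - sin t * c) *\<^sub>R tang t" (is ?g1)
    and "grad (\<lambda>y. grad \<Psi> y $ 2) (r *\<^sub>R dir t) = r powr (-\<alpha>) *\<^sub>R ((1-\<alpha>) * d2 t) *\<^sub>R dir t
       + r powr (-\<alpha>) *\<^sub>R ((1 - \<alpha>) * sin t * \<psi>' t + (2-\<alpha>) * cos t * \<psi> t + cos t * c) *\<^sub>R tang t" (is ?g2)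
    and "laplacian \<Psi> (r *\<^sub>R dir t) = r powr (-\<alpha>) * (c + (2 - \<alpha>)\<^sup>2 * \<psi> t)"
proof -
  have D1: "(d1 has_real_derivative (1 - \<alpha>) * cos t * \<psi>' t - (2-\<alpha>) * sin t * \<psi> t - sin t * c) (at t)"
    unfolding d1_def[abs_def] by (auto intro!: derivative_eq_intros deriv d simp: algebra_simps)
  have D2: "(d2 has_real_derivative (1 - \<alpha>) * sin t * \<psi>' t + (2-\<alpha>) * cos t * \<psi> t + cos t * c) (at t)"
    unfolding d2_def[abs_def] by (auto intro!: derivative_eq_intros deriv d simp: algebra_simps)
  have e: "grad \<Psi> x = homog (1 - \<alpha>) d1 x *\<^sub>R axis 1 1 + homog (1 - \<alpha>) d2 x *\<^sub>R axis 2 1" for x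
    by (simp add: vec2_eq_iff stream_grad)
  have "homog (1 - \<alpha>) d1 differentiable (at (r *\<^sub>R dir t))" "homog (1 - \<alpha>) d2 differentiable (at (r *\<^sub>R dir t))"
    using homog_has_derivative[OF per_d(1) D1 r] homog_has_derivative[OF per_d(2) D2 r] by (auto intro: differentiableI)
  then show "grad \<Psi> differentiable (at (r *\<^sub>R dir t))"
    unfolding e[abs_def] by (intro derivative_intros)
  show g1: ?g1 unfolding stream_grad using grad_homog[OF per_d(1) D1 r, of "1 - \<alpha>"] by simp
  show g2: ?g2 unfolding stream_grad using grad_homog[OF per_d(2) D2 r, of "1 - \<alpha>"] by simp
  define C S where "C = cos t" and "S = sin t"
  have CS: "C * C + S * S = 1" unfolding C_def S_def by (simp flip: power2_eq_square)
  have "laplacian \<Psi> (r *\<^sub>R dir t) = r powr (-\<alpha>) * ((C * C + S * S) * (c + (2 - \<alpha>)\<^sup>2 * \<psi> t))"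
    unfolding laplacian_def sum_2 g1 g2 by (simp add: d1_def d2_def C_def[symmetric] S_def[symmetric] algebra_simps power2_eq_square)
  then show "laplacian \<Psi> (r *\<^sub>R dir t) = r powr (-\<alpha>) * (c + (2 - \<alpha>)\<^sup>2 * \<psi> t)" by (simp add: CS)
qed

text \<open>Second derivatives of the stream function control \<open>\<psi>''\<close>, because \<open>\<psi>'\<close> is the angular component
  of the gradient on the unit circle.\<close>

lemma grad_differentiable_imp:
  assumes "grad \<Psi> differentiable (at (dir t))"
  shows "\<exists>c. (\<psi>' has_real_derivative c) (at t)"
proof -
  have e: "\<psi>' s = grad \<Psi> (dir s) \<bullet> tang s" for s
  proof -
    have "grad \<Psi> (1 *\<^sub>R dir s) = (2 - \<alpha>) *\<^sub>R \<psi> s *\<^sub>R dir s + \<psi>' s *\<^sub>R tang s"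
      using grad_homog[OF per deriv, of 1 "2 - \<alpha>" s] by simp
    then show ?thesis by (simp add: inner_add_left)
  qed
  have "(\<lambda>s. grad \<Psi> (dir s)) differentiable (at t)"
    using differentiable_chain_at[OF dir_differentiable(1) assms] by (simp add: o_def)
  then have "\<psi>' differentiable (at t)" unfolding e[abs_def] by (intro differentiable_inner dir_differentiable)
  then show ?thesis by (simp add: real_differentiable_def)
qed

text \<open>The drift reproduces the vorticity by homogeneity, so the self-similar equation reduces to the
  steady equation \<open>\<alpha> \<psi>' w + (2-\<alpha>) \<psi> w' = 0\<close>, i.e. to constancy of the product of \<open>w\<close> with a power of \<open>\<psi>\<close>.\<close>

lemma transport:
  assumes w: "periodic (2*pi) w" and d: "(w has_real_derivative w') (at t)" and r: "r > 0"
  shows "V (r *\<^sub>R dir t) \<bullet> grad (homog (-\<alpha>) w) (r *\<^sub>R dir t)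
     = homog (-\<alpha>) w (r *\<^sub>R dir t) + r powr (-2*\<alpha>) * (\<alpha> * \<psi>' t * w t + (2 - \<alpha>) * \<psi> t * w')"
proof -
  have 1: "r powr (1 - \<alpha>) * r powr (-\<alpha> - 1) = r powr (-2*\<alpha>)" "r * r powr (-\<alpha> - 1) = r powr (-\<alpha>)"
    using r by (simp_all add: powr_mult_base flip: powr_add)
  have "V (r *\<^sub>R dir t) \<bullet> grad (homog (-\<alpha>) w) (r *\<^sub>R dir t)
     = \<alpha> * \<psi>' t * w t * (r powr (1 - \<alpha>) * r powr (-\<alpha> - 1)) + w t * (r * r powr (-\<alpha> - 1))
      + (2 - \<alpha>) * \<psi> t * w' * (r powr (1 - \<alpha>) * r powr (-\<alpha> - 1))"
    unfolding V_polar[OF less_imp_le[OF r]] grad_homog[OF w d r] using \<alpha>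
    by (simp add: inner_add_left inner_add_right inner_diff_left inner_diff_right algebra_simps)
  then show ?thesis unfolding 1 homog_dir[OF w less_imp_le[OF r]] by (simp add: algebra_simps)
qed

end

section \<open>Existence of the symmetric gradient\<close>

context stream begin

text \<open>The radial component contains \<open>\<psi>'\<close>, which is not differentiable on the ray. By the reflection
  symmetry about the ray the point \<open>p - h v\<close> may be replaced by its mirror image, which differs from
  \<open>p + h v\<close> only in the radial direction. Along that direction the derivative contains \<open>\<psi>''\<close> with a factor
  \<open>sin (s - t)\<close> that tames it, so the mean value theorem applies.\<close>

lemma symmetric_gradient_dir:
  fixes \<psi>'' :: "real \<Rightarrow> real"
  assumes r: "r > 0" and st: "V (r *\<^sub>R dir t) = 0"
    and odd: "\<And>s. \<psi> (t + s) = - \<psi> (t - s)" and \<delta>: "\<delta> > 0"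
    and d2: "\<And>s. s \<noteq> t \<Longrightarrow> \<bar>s - t\<bar> < \<delta> \<Longrightarrow> (\<psi>' has_real_derivative \<psi>'' s) (at s)"
    and lim: "((\<lambda>s. (s - t) * \<psi>'' s) \<longlongrightarrow> 0) (at t)"
  shows "((\<lambda>h. (V (r *\<^sub>R dir t + h *\<^sub>R v) \<bullet> dir t - V (r *\<^sub>R dir t - h *\<^sub>R v) \<bullet> dir t) / (2 * h))
     \<longlongrightarrow> - (v \<bullet> dir t)) (at 0)"
proof -
  have z: "\<psi> t = 0" "\<psi>' t = - (r powr \<alpha>) / \<alpha>" using st stagnation_iff[OF r] by auto
  define c where "c s = (2 - \<alpha>) * sin (s - t) * \<psi> s + cos (s - t) * \<psi>' s" for s
  define N where "N s = (if s = t then 0 else sin (s - t) * \<psi>'' s)" for s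
  define M where "M s = (1 - \<alpha>) * c s * cos (s - t) - sin (s - t) * ((2 - \<alpha>) * cos (s - t) * \<psi> s + (1 - \<alpha>) * sin (s - t) * \<psi>' s) - cos (s - t) * N s" for s
  define q where "q = homog (1 - \<alpha>) c"
  define g where "g y = norm y powr (- \<alpha>) * M (local_angle t y)" for y
  define p where "p = r *\<^sub>R dir t"
  have cper: "periodic (2*pi) c" using per per' by (auto simp: periodic_def c_def sin_diff cos_diff)
  have odd': "\<psi>' (t + s) = \<psi>' (t - s)" for s
  proof -
    have "((\<lambda>s. \<psi> (t + s)) has_real_derivative \<psi>' (t + s) * 1) (at s)"
      by (rule DERIV_chain2[where f=\<psi> and g="\<lambda>s. t + s", OF deriv]) (auto intro!: derivative_eq_intros)
    moreover have "((\<lambda>s. \<psi> (t - s)) has_real_derivative \<psi>' (t - s) * -1) (at s)"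
      by (rule DERIV_chain2[where f=\<psi> and g="\<lambda>s. t - s", OF deriv]) (auto intro!: derivative_eq_intros)
    then have "((\<lambda>s. - \<psi> (t - s)) has_real_derivative - (\<psi>' (t - s) * -1)) (at s)" by (rule DERIV_minus)
    ultimately show ?thesis unfolding odd using DERIV_unique by fastforce
  qed
  have ceven: "c (t + s) = c (t - s)" for s by (simp add: c_def odd odd')
  have Nlim: "isCont N t"
  proof -
    have "((\<lambda>s. N s) \<longlongrightarrow> 0) (at t)"
    proof (rule Lim_null_comparison)
      show "((\<lambda>s. \<bar>(s - t) * \<psi>'' s\<bar>) \<longlongrightarrow> 0) (at t)" using lim by (rule tendsto_rabs_zero)
      show "\<forall>\<^sub>F s in at t. norm (N s) \<le> \<bar>(s - t) * \<psi>'' s\<bar>"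
        by (intro always_eventually) (auto simp: N_def abs_mult intro!: mult_right_mono abs_sin_x_le_abs_x)
    qed
    moreover have "N t = 0" by (simp add: N_def)
    ultimately show ?thesis by (simp add: isCont_def)
  qed
  have psicont: "isCont \<psi> t" using deriv DERIV_isCont by blast
  have Mcont: "isCont M t" unfolding M_def c_def
    by (intro continuous_intros psicont isCont' Nlim)
  have "isCont (local_angle t) p" unfolding p_def
    using has_derivative_continuous[OF local_angle_has_derivative[OF r]] .
  then have "isCont (\<lambda>y. M (local_angle t y)) p"
    by (rule isCont_o2) (use Mcont in \<open>simp add: p_def\<close>)
  then have gcont: "isCont g p" unfolding g_def using r by (intro continuous_intros) (auto simp: p_def)
  have gp: "g p = r powr (- \<alpha>) * ((1 - \<alpha>) * \<psi>' t)" using r by (simp add: g_def p_def M_def N_def c_def z)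
  have qderiv: "((\<lambda>u. q (y + u *\<^sub>R dir t)) has_real_derivative g y) (at 0)"
    if y: "y \<bullet> dir t > 0" "\<bar>local_angle t y - t\<bar> < \<delta>" for y
  proof -
    define s where "s = local_angle t y"
    define R where "R = norm y"
    have yR: "y = R *\<^sub>R dir s" unfolding R_def s_def by (rule local_angle[OF y(1)])
    have R: "R > 0" using y(1) unfolding R_def by auto
    show ?thesis
    proof (cases "s = t")
      case True
      have A: "((\<lambda>u. (R + u) powr (1 - \<alpha>) * c t) has_real_derivative (1 - \<alpha>) * R powr (- \<alpha>) * c t) (at 0)"
      proof -
        have "((\<lambda>u. (R + u) powr (1 - \<alpha>)) has_real_derivative ((1 - \<alpha>) * (R + 0) powr (1 - \<alpha> - 1)) * 1) (at 0)"
          by (rule DERIV_chain2[where f="\<lambda>x. x powr (1 - \<alpha>)" and g="\<lambda>u. R + u", OF has_real_derivative_powr])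
            (use R in \<open>auto intro!: derivative_eq_intros\<close>)
        from DERIV_cmult_right[OF this, of "c t"] show ?thesis by simp
      qed
      have B: "\<forall>\<^sub>F u in nhds 0. (R + u) powr (1 - \<alpha>) * c t = q (y + u *\<^sub>R dir t)"
      proof -
        have "\<forall>\<^sub>F u in nhds 0. u \<in> {-R<..}" using R by (intro eventually_nhds_in_open) auto
        then show ?thesis
        proof eventually_elim
          case (elim u)
          then have "q ((R + u) *\<^sub>R dir t) = (R + u) powr (1 - \<alpha>) * c t"
            unfolding q_def by (intro homog_dir cper) auto
          then show ?case by (simp add: yR True scaleR_add_left)
        qed
      qed
      have "((\<lambda>u. q (y + u *\<^sub>R dir t)) has_real_derivative (1 - \<alpha>) * R powr (- \<alpha>) * c t) (at 0)"
        by (rule iffD1[OF DERIV_cong_ev[OF refl B refl] A])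
      moreover have "g y = (1 - \<alpha>) * R powr (- \<alpha>) * c t"
        using True by (simp add: g_def M_def N_def s_def R_def z)
      ultimately show ?thesis by simp
    next
      case False
      let ?c' = "(2 - \<alpha>) * cos (s - t) * \<psi> s + (1 - \<alpha>) * sin (s - t) * \<psi>' s + cos (s - t) * \<psi>'' s"
      have cd: "(c has_real_derivative ?c') (at s)" unfolding c_def[abs_def]
        by (auto intro!: derivative_eq_intros deriv d2 simp: False y(2)[folded s_def] algebra_simps)
      have 1: "((\<lambda>u. y + u *\<^sub>R dir t) has_derivative (\<lambda>u. u *\<^sub>R dir t)) (at (0::real))"
        by (auto intro!: derivative_eq_intros)
      have in1: "dir t \<bullet> dir s = cos (s - t)" "dir t \<bullet> tang s = - sin (s - t)"
        by (simp_all add: inner_2 cos_diff sin_diff algebra_simps)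
      have H: "(q has_derivative (\<lambda>h. R powr (1 - \<alpha> - 1) * ((1 - \<alpha>) * c s * (h \<bullet> dir s) + ?c' * (h \<bullet> tang s)))) (at (y + 0 *\<^sub>R dir t))"
        unfolding q_def yR scaleR_zero_left add_0_right by (rule homog_has_derivative[OF cper cd R])
      note has_derivative_compose[OF 1 H]
      moreover have "(\<lambda>u. R powr (1 - \<alpha> - 1) * ((1 - \<alpha>) * c s * ((u *\<^sub>R dir t) \<bullet> dir s) + ?c' * ((u *\<^sub>R dir t) \<bullet> tang s)))
         = (*) (g y)"
        unfolding g_def s_def[symmetric] R_def[symmetric] M_def N_def using False
        by (auto simp: fun_eq_iff in1 algebra_simps)
      ultimately show ?thesis by (simp add: has_field_derivative_def)
    qed
  qed
  have qrefl: "q ((y \<bullet> dir t) *\<^sub>R dir t - (y \<bullet> tang t) *\<^sub>R tang t) = q y" if y: "y \<bullet> dir t > 0" for y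
  proof -
    define y' where "y' = (y \<bullet> dir t) *\<^sub>R dir t - (y \<bullet> tang t) *\<^sub>R tang t"
    have i: "y' \<bullet> dir t = y \<bullet> dir t" "y' \<bullet> tang t = - (y \<bullet> tang t)" by (simp_all add: y'_def inner_diff_left)
    have sq: "x \<bullet> x = (x \<bullet> dir t)\<^sup>2 + (x \<bullet> tang t)\<^sup>2" for x
      by (subst dir_decomp[of x t], subst (2) dir_decomp[of x t])
        (simp only: inner_add_left inner_add_right inner_scaleR_left inner_scaleR_right inner_dir, simp add: power2_eq_square)
    have n: "norm y' = norm y" unfolding norm_eq_sqrt_inner sq i by simp
    show ?thesis using y unfolding y'_def[symmetric] q_def
      by (subst (1 2) homog_local[OF cper, of _ t]) (auto simp: i n local_angle_def arctan_minus ceven)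
  qed
  define a b where "a = v \<bullet> dir t" and "b = v \<bullet> tang t"
  have v: "v = a *\<^sub>R dir t + b *\<^sub>R tang t" unfolding a_def b_def by (rule dir_decomp)
  have main: "((\<lambda>h. (q (p + h *\<^sub>R v) - q (p - h *\<^sub>R v)) / (2 * h)) \<longlongrightarrow> g p * a) (at 0)"
    unfolding tendsto_iff
  proof (intro allI impI)
    fix e :: real assume e: "e > 0"
    define \<epsilon> where "\<epsilon> = e / (\<bar>a\<bar> + 1)"
    have \<epsilon>: "\<epsilon> > 0" "\<epsilon> * \<bar>a\<bar> < e" using e by (auto simp: \<epsilon>_def field_simps)
    have "open {y. y \<bullet> dir t > 0}" by (intro open_Collect_less continuous_intros)
    then have ev1: "\<forall>\<^sub>F y in nhds p. y \<bullet> dir t > 0"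
      using r by (intro eventually_nhds_in_open[where s="{y. y \<bullet> dir t > 0}", simplified]) (auto simp: p_def)
    have ev2: "\<forall>\<^sub>F y in nhds p. \<bar>g y - g p\<bar> < \<epsilon>"
      using gcont \<epsilon>(1) unfolding isCont_def tendsto_at_iff_tendsto_nhds by (simp add: tendsto_iff dist_real_def)
    have ev3: "\<forall>\<^sub>F y in nhds p. \<bar>local_angle t y - t\<bar> < \<delta>"
      using \<open>isCont (local_angle t) p\<close> \<delta> unfolding isCont_def tendsto_at_iff_tendsto_nhds by (simp add: tendsto_iff dist_real_def p_def)
    have "\<forall>\<^sub>F y in nhds p. y \<bullet> dir t > 0 \<and> \<bar>g y - g p\<bar> < \<epsilon> \<and> \<bar>local_angle t y - t\<bar> < \<delta>"
      using ev1 ev2 ev3 by eventually_elim auto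
    then obtain d where d: "d > 0" "\<And>y. dist y p < d \<Longrightarrow> y \<bullet> dir t > 0 \<and> \<bar>g y - g p\<bar> < \<epsilon> \<and> \<bar>local_angle t y - t\<bar> < \<delta>"
      unfolding eventually_nhds_metric by blast
    define d' where "d' = d / (\<bar>a\<bar> + \<bar>b\<bar> + 1)"
    have d': "d' > 0" using d(1) by (simp add: d'_def)
    have "dist ((q (p + h *\<^sub>R v) - q (p - h *\<^sub>R v)) / (2 * h)) (g p * a) < e" if h: "h \<noteq> 0" "\<bar>h\<bar> < d'" for h
    proof -
      define P where "P = p + (h * b) *\<^sub>R tang t"
      have near: "dist (P + u *\<^sub>R dir t) p < d" if "\<bar>u\<bar> \<le> \<bar>h * a\<bar>" for u
      proof -
        have "dist (P + u *\<^sub>R dir t) p = norm ((h * b) *\<^sub>R tang t + u *\<^sub>R dir t)" by (simp add: P_def dist_norm)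
        also have "\<dots> \<le> \<bar>h * b\<bar> * norm (tang t) + \<bar>u\<bar> * norm (dir t)" by (metis norm_scaleR norm_triangle_ineq)
        also have "norm (tang t) = 1" by (simp add: norm_2)
        also have "\<bar>h * b\<bar> * 1 + \<bar>u\<bar> * norm (dir t) \<le> \<bar>h\<bar> * (\<bar>a\<bar> + \<bar>b\<bar> + 1)"
          using that by (simp add: abs_mult algebra_simps)
        also have "\<dots> < d" using h(2) unfolding d'_def by (simp add: field_simps)
        finally show ?thesis .
      qed
      define k where "k u = q (P + u *\<^sub>R dir t) - g p * u" for u
      have kd: "(k has_real_derivative g (P + u *\<^sub>R dir t) - g p) (at u)" if "\<bar>u\<bar> \<le> \<bar>h * a\<bar>" for u
      proof -
        have "((\<lambda>w. q (P + u *\<^sub>R dir t + w *\<^sub>R dir t)) has_real_derivative g (P + u *\<^sub>R dir t)) (at 0)"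
          using qderiv d(2)[OF near[OF that]] by blast
        then have "((\<lambda>w. q (P + (w + u) *\<^sub>R dir t)) has_real_derivative g (P + u *\<^sub>R dir t)) (at 0)"
          by (simp add: scaleR_add_left add_ac)
        then have "((\<lambda>w. q (P + w *\<^sub>R dir t)) has_real_derivative g (P + u *\<^sub>R dir t)) (at u)"
          using DERIV_shift[of "\<lambda>w. q (P + w *\<^sub>R dir t)" _ 0 u] by simp
        then show ?thesis unfolding k_def by (auto intro!: derivative_eq_intros)
      qed
      have "norm (k (h * a) - k (- (h * a))) \<le> \<epsilon> * norm (h * a - - (h * a))"
      proof (rule field_differentiable_bound[where S = "{-\<bar>h * a\<bar>..\<bar>h * a\<bar>}"])
        fix u assume u: "u \<in> {-\<bar>h * a\<bar>..\<bar>h * a\<bar>}"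
        then have u': "\<bar>u\<bar> \<le> \<bar>h * a\<bar>" by auto
        show "(k has_real_derivative g (P + u *\<^sub>R dir t) - g p) (at u within {-\<bar>h * a\<bar>..\<bar>h * a\<bar>})"
          using kd[OF u'] by (rule has_field_derivative_at_within)
        show "norm (g (P + u *\<^sub>R dir t) - g p) \<le> \<epsilon>" using d(2)[OF near[OF u']] by simp
      qed auto
      moreover have "k (h * a) - k (- (h * a)) = q (p + h *\<^sub>R v) - q (p - h *\<^sub>R v) - 2 * h * (g p * a)"
      proof -
        have "q (p - h *\<^sub>R v) = q (P - (h * a) *\<^sub>R dir t)"
        proof -
          have pv: "P - (h * a) *\<^sub>R dir t = (r - h * a) *\<^sub>R dir t + (h * b) *\<^sub>R tang t"
            by (simp add: P_def p_def algebra_simps)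
          have "(P - (h * a) *\<^sub>R dir t) \<bullet> dir t > 0" using d(2)[OF near[of "- (h * a)"]] by simp
          from qrefl[OF this] have "q (P - (h * a) *\<^sub>R dir t) = q ((r - h * a) *\<^sub>R dir t - (h * b) *\<^sub>R tang t)"
            unfolding pv by (simp add: inner_add_left)
          moreover have "(r - h * a) *\<^sub>R dir t - (h * b) *\<^sub>R tang t = p - h *\<^sub>R v"
            by (subst v) (simp add: p_def algebra_simps)
          ultimately show ?thesis by simp
        qed
        moreover have "p + h *\<^sub>R v = P + (h * a) *\<^sub>R dir t" by (subst v) (simp add: P_def algebra_simps)
        ultimately show ?thesis by (simp add: k_def algebra_simps)
      qed
      ultimately have "\<bar>q (p + h *\<^sub>R v) - q (p - h *\<^sub>R v) - 2 * h * (g p * a)\<bar> \<le> \<epsilon> * \<bar>a\<bar> * \<bar>2 * h\<bar>"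
        by (simp add: abs_mult mult_ac)
      then have "\<bar>(q (p + h *\<^sub>R v) - q (p - h *\<^sub>R v) - 2 * h * (g p * a)) / (2 * h)\<bar> \<le> \<epsilon> * \<bar>a\<bar>"
        using h(1) by (simp add: abs_divide pos_divide_le_eq)
      moreover have "(q (p + h *\<^sub>R v) - q (p - h *\<^sub>R v) - 2 * h * (g p * a)) / (2 * h) = (q (p + h *\<^sub>R v) - q (p - h *\<^sub>R v)) / (2 * h) - g p * a"
        using h(1) by (simp add: field_simps)
      ultimately show ?thesis using \<epsilon>(2) by (simp add: dist_real_def)
    qed
    then show "\<forall>\<^sub>F h in at 0. dist ((q (p + h *\<^sub>R v) - q (p - h *\<^sub>R v)) / (2 * h)) (g p * a) < e"
      unfolding eventually_at using d' by (intro exI[of _ d']) auto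
  qed
  have A1: "((\<lambda>h. - ((q (p + h *\<^sub>R v) - q (p - h *\<^sub>R v)) / (2 * h)) - (v \<bullet> dir t) / \<alpha>) \<longlongrightarrow> - (g p * a) - (v \<bullet> dir t) / \<alpha>) (at 0)"
    by (intro tendsto_intros main)
  have A2: "- (g p * a) - (v \<bullet> dir t) / \<alpha> = - (v \<bullet> dir t)"
  proof -
    have "r powr (- \<alpha>) * r powr \<alpha> = 1" using r by (simp flip: powr_add)
    moreover have "- (X * ((1 - \<alpha>) * (- Y / \<alpha>)) * a) - a / \<alpha> = - a" if "X * Y = 1" for X Y :: real
    proof -
      have "- (X * ((1 - \<alpha>) * (- Y / \<alpha>)) * a) - a / \<alpha> = (X * Y) * ((1 - \<alpha>) / \<alpha> * a) - a / \<alpha>" by simp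
      also have "\<dots> = - a" unfolding that using \<alpha> by (simp add: field_simps)
      finally show ?thesis .
    qed
    ultimately show ?thesis unfolding gp z(2) a_def[symmetric] by blast
  qed
  have A3: "\<forall>\<^sub>F h in at 0. - ((q (p + h *\<^sub>R v) - q (p - h *\<^sub>R v)) / (2 * h)) - (v \<bullet> dir t) / \<alpha>
     = (V (r *\<^sub>R dir t + h *\<^sub>R v) \<bullet> dir t - V (r *\<^sub>R dir t - h *\<^sub>R v) \<bullet> dir t) / (2 * h)"
  proof -
    have alg: "- ((A - B) / (2 * h)) - w / \<alpha> = ((- A - (P + h * w) / \<alpha>) - (- B - (P - h * w) / \<alpha>)) / (2 * h)"
      if "h \<noteq> 0" for A B P w h :: real
    proof -
      have "((- A - (P + h * w) / \<alpha>) - (- B - (P - h * w) / \<alpha>)) = - (A - B) - (2 * h) * (w / \<alpha>)"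
        by (simp add: add_divide_distrib diff_divide_distrib)
      moreover have "2 * h * (w / \<alpha>) / (2 * h) = w / \<alpha>" using that by simp
      ultimately show ?thesis by (simp only: diff_divide_distrib[of "- (A - B)"] minus_divide_left)
    qed
    have "- ((q (p + h *\<^sub>R v) - q (p - h *\<^sub>R v)) / (2 * h)) - (v \<bullet> dir t) / \<alpha>
        = (V (p + h *\<^sub>R v) \<bullet> dir t - V (p - h *\<^sub>R v) \<bullet> dir t) / (2 * h)" if "h \<noteq> 0" for h
      unfolding V_inner_dir c_def[symmetric] q_def[symmetric] inner_add_left inner_diff_left inner_scaleR_left
      using that by (rule alg)
    then show ?thesis unfolding eventually_at_filter p_def by (intro always_eventually) blast
  qed
  show ?thesis using Lim_transform_eventually[OF A1[unfolded A2] A3] .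
qed

lemma symmetric_gradient_exists:
  fixes \<psi>'' :: "real \<Rightarrow> real"
  assumes "r > 0" "V (r *\<^sub>R dir t) = 0"
    and "\<And>s. \<psi> (t + s) = - \<psi> (t - s)" "\<delta> > 0"
    and "\<And>s. s \<noteq> t \<Longrightarrow> \<bar>s - t\<bar> < \<delta> \<Longrightarrow> (\<psi>' has_real_derivative \<psi>'' s) (at s)"
    and "((\<lambda>s. (s - t) * \<psi>'' s) \<longlongrightarrow> 0) (at t)"
  shows "\<exists>A. has_symmetric_gradient V A (r *\<^sub>R dir t)"
proof -
  define L where "L v = (- (v \<bullet> dir t)) *\<^sub>R dir t + ((1 - 2 / \<alpha>) * (v \<bullet> tang t)) *\<^sub>R tang t" for v
  define A :: "real^2^2" where "A = (\<chi> i j. - (dir t $ i * dir t $ j) + (1 - 2 / \<alpha>) * (tang t $ i * tang t $ j))"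
  have Av: "(\<chi> i j. - (dir t $ i * dir t $ j) + \<kappa> * (tang t $ i * tang t $ j)) *v v
      = (- (v \<bullet> dir t)) *\<^sub>R dir t + (\<kappa> * (v \<bullet> tang t)) *\<^sub>R tang t" for v :: "real^2" and \<kappa> :: real
    unfolding vec2_eq_iff by (simp add: matrix_vector_mult_def sum_2 inner_2 algebra_simps)
  have m: "A *v v = L v" for v unfolding A_def L_def by (rule Av)
  have "((\<lambda>h. (1 / (2 * h)) *\<^sub>R (V (r *\<^sub>R dir t + h *\<^sub>R v) - V (r *\<^sub>R dir t - h *\<^sub>R v))) \<longlongrightarrow> L v) (at 0)" for v
  proof -
    have "((\<lambda>h. ((V (r *\<^sub>R dir t + h *\<^sub>R v) \<bullet> dir t - V (r *\<^sub>R dir t - h *\<^sub>R v) \<bullet> dir t) / (2 * h)) *\<^sub>R dir t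
       + ((V (r *\<^sub>R dir t + h *\<^sub>R v) \<bullet> tang t - V (r *\<^sub>R dir t - h *\<^sub>R v) \<bullet> tang t) / (2 * h)) *\<^sub>R tang t) \<longlongrightarrow> L v) (at 0)"
      unfolding L_def
      using symmetric_gradient_dir[OF assms, of v] symmetric_gradient_tang[OF assms(1,2), of v]
      by (intro tendsto_add tendsto_scaleR tendsto_const)
    moreover have "((V (r *\<^sub>R dir t + h *\<^sub>R v) \<bullet> dir t - V (r *\<^sub>R dir t - h *\<^sub>R v) \<bullet> dir t) / (2 * h)) *\<^sub>R dir t
       + ((V (r *\<^sub>R dir t + h *\<^sub>R v) \<bullet> tang t - V (r *\<^sub>R dir t - h *\<^sub>R v) \<bullet> tang t) / (2 * h)) *\<^sub>R tang t
      = (1 / (2 * h)) *\<^sub>R (V (r *\<^sub>R dir t + h *\<^sub>R v) - V (r *\<^sub>R dir t - h *\<^sub>R v))" for h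
      by (subst dir_decomp[of "(1 / (2 * h)) *\<^sub>R (V (r *\<^sub>R dir t + h *\<^sub>R v) - V (r *\<^sub>R dir t - h *\<^sub>R v))" t]) (simp add: inner_diff_left)
    ultimately show ?thesis by simp
  qed
  then show ?thesis unfolding has_symmetric_gradient_def m[symmetric] by blast
qed

end

section \<open>The angular equation in Pruefer variables\<close>

text \<open>Dividing the first integral of the angular equation by \<open>cos\<^sup>2\<close> produces this quotient at
  \<open>t = sin\<^sup>2\<close>. Its value at 1 is the limit.\<close>

definition diffquot :: "real \<Rightarrow> real \<Rightarrow> real" where
  "diffquot q t = (if t = 1 then q else (1 - t powr q) / (1 - t))"

lemma diffquot_mult: "diffquot q t * (1 - t) = 1 - t powr q"
  by (auto simp: diffquot_def)

lemma diffquot_bounds: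
  assumes q: "0 < q" "q < 1" and t: "0 \<le> t" "t \<le> 1"
  shows "q \<le> diffquot q t" "diffquot q t \<le> 1"
proof -
  show "diffquot q t \<le> 1"
  proof (cases "t = 1")
    case False
    have "t powr 1 \<le> t powr q" by (rule powr_mono') (use q t in auto)
    then have "1 - t powr q \<le> 1 - t" using t by simp
    then show ?thesis using t False by (simp add: diffquot_def)
  qed (use q in \<open>simp add: diffquot_def\<close>)
  show "q \<le> diffquot q t"
  proof (cases "t = 1 \<or> t = 0")
    case False
    then have t': "0 < t" "t < 1" using t by auto
    \<comment> \<open>Concavity of the power function, as monotonicity of its distance to the tangent at 1.\<close>
    have "(\<lambda>t. 1 - t powr q - q * (1 - t)) t \<ge> (\<lambda>t. 1 - t powr q - q * (1 - t)) 1"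
    proof (rule DERIV_nonpos_imp_nonincreasing[OF t(2)])
      fix x assume x: "t \<le> x" "x \<le> 1"
      have x0: "x > 0" using x t' by simp
      have "((\<lambda>t. 1 - t powr q - q * (1 - t)) has_real_derivative 0 - q * x powr (q - 1) - q * (0 - 1)) (at x)"
        by (intro DERIV_diff DERIV_const has_real_derivative_powr x0 DERIV_cmult DERIV_ident)
      moreover have "x powr (q - 1) \<ge> 1"
        using powr_mono2'[of "q - 1" x 1] x x0 q by simp
      then have "0 - q * x powr (q - 1) - q * (0 - 1) \<le> 0" using q by simp
      ultimately show "\<exists>y. ((\<lambda>t. 1 - t powr q - q * (1 - t)) has_real_derivative y) (at x) \<and> y \<le> 0" by blast
    qed
    then have "q * (1 - t) \<le> 1 - t powr q" by simp
    then show ?thesis using t' by (simp add: diffquot_def pos_le_divide_eq)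
  qed (use q in \<open>auto simp: diffquot_def\<close>)
qed

lemma diffquot_continuous:
  assumes q: "0 < q" "q < 1"
  shows "continuous_on {0..1} (diffquot q)"
  unfolding continuous_on_eq_continuous_within
proof
  fix t :: real assume t: "t \<in> {0..1}"
  show "continuous (at t within {0..1}) (diffquot q)"
  proof (cases "t = 1")
    case True
    have "((\<lambda>z. z powr q) has_real_derivative q * 1 powr (q - 1)) (at 1)" by (rule has_real_derivative_powr) simp
    then have "((\<lambda>y. (y powr q - 1 powr q) / (y - 1)) \<longlongrightarrow> q) (at 1)" by (simp add: has_field_derivative_iff)
    then have "((\<lambda>y. (y powr q - 1) / (y - 1)) \<longlongrightarrow> diffquot q 1) (at 1 within {0..1})"
      using tendsto_within_subset[of _ _ 1 UNIV "{0..1}"] by (simp add: diffquot_def)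
    moreover have "\<forall>\<^sub>F y in at 1 within {0..1}. (y powr q - 1) / (y - 1) = diffquot q y"
      unfolding eventually_at_filter
      by (intro always_eventually) (auto simp: diffquot_def field_simps)
    ultimately have "(diffquot q \<longlongrightarrow> diffquot q 1) (at 1 within {0..1})" by (rule Lim_transform_eventually)
    then show ?thesis unfolding continuous_within True .
  next
    case False
    have "continuous_on {0..<1} (\<lambda>t. (1 - t powr q) / (1 - t))"
      using q by (intro continuous_intros continuous_on_powr') auto
    then have "continuous_on {0..<1} (diffquot q)"
      by (rule continuous_on_eq) (auto simp: diffquot_def)
    then have "continuous (at t within {0..<1}) (diffquot q)"
      using t False by (simp add: continuous_on_eq_continuous_within)
    moreover have "at t within {0..<1} = at t within {0..1}"
      using t False by (intro at_within_nhd[where S="{..<1}"]) auto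
    ultimately show ?thesis by simp
  qed
qed

text \<open>With \<open>\<psi> = sin \<circ> \<phi>\<close> the first integral \<open>\<psi>'\<^sup>2 = l\<^sup>2 (1 - \<psi>\<^sup>2) + K (1 - \<bar>\<psi>\<bar>\<close>-to-the-\<open>2q)\<close> becomes \<open>\<phi>' = speed \<phi>\<close>.
  The turning points of \<open>\<psi>\<close>, at which the equation for \<open>\<psi>\<close> loses uniqueness, are no longer singular.\<close>

definition speed :: "real \<Rightarrow> real \<Rightarrow> real \<Rightarrow> real \<Rightarrow> real" where
  "speed l q K s = sqrt (l\<^sup>2 + K * diffquot q ((sin s)\<^sup>2))"

lemma sin_sq_01: "(sin s)\<^sup>2 \<in> {0..1::real}" by (simp add: abs_square_le_1)

lemma speed_radicand:
  assumes "0 < q" "q < 1" "l\<^sup>2 + K > 0" "l \<noteq> 0" "0 \<le> t" "t \<le> 1"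
  shows "l\<^sup>2 + K * diffquot q t > 0"
proof (cases "K \<ge> 0")
  case True
  then have "K * diffquot q t \<ge> 0" using diffquot_bounds[of q t] assms by simp
  moreover have "l\<^sup>2 > 0" using assms by simp
  ultimately show ?thesis by linarith
next
  case False
  then have "K * diffquot q t \<ge> K * 1" using diffquot_bounds[of q t] assms by (intro mult_left_mono_neg) auto
  then show ?thesis using assms by linarith
qed

lemma speed_pos: "0 < q \<Longrightarrow> q < 1 \<Longrightarrow> l\<^sup>2 + K > 0 \<Longrightarrow> l \<noteq> 0 \<Longrightarrow> speed l q K s > 0"
  using speed_radicand[of q l K "(sin s)\<^sup>2"] sin_sq_01[of s] by (simp add: speed_def)

lemma diffquot_sin_continuous: "0 < q \<Longrightarrow> q < 1 \<Longrightarrow> continuous_on A (\<lambda>s. diffquot q ((sin s)\<^sup>2))"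
  by (rule continuous_on_compose2[OF diffquot_continuous])
    (auto intro!: continuous_intros simp: abs_square_le_1)

lemma speed_continuous: "0 < q \<Longrightarrow> q < 1 \<Longrightarrow> continuous_on A (speed l q K)"
  unfolding speed_def[abs_def] by (intro continuous_intros diffquot_sin_continuous)

lemma speed_minus [simp]: "speed l q K (- s) = speed l q K s" by (simp add: speed_def)
lemma speed_pi [simp]: "speed l q K (s + pi) = speed l q K s" by (simp add: speed_def)

text \<open>The angle \<open>\<theta>\<close> needed for the Pruefer variable to move from 0 to \<open>x\<close>. At most one of the two
  integrals has a nondegenerate domain, so the difference is the oriented integral.\<close>

definition travel :: "real \<Rightarrow> real \<Rightarrow> real \<Rightarrow> real \<Rightarrow> real" where
  "travel l q K x = integral {0..x} (\<lambda>s. 1 / speed l q K s) - integral {x..0} (\<lambda>s. 1 / speed l q K s)"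

locale pruefer =
  fixes l q K :: real
  assumes q: "0 < q" "q < 1" and l: "l > 0" and K: "l\<^sup>2 + K > 0"
begin

abbreviation "G \<equiv> speed l q K"
abbreviation "\<Theta> \<equiv> travel l q K"

lemma G_pos: "G s > 0" using speed_pos[OF q K] l by simp
lemma G_sq: "(G s)\<^sup>2 = l\<^sup>2 + K * diffquot q ((sin s)\<^sup>2)"
  using speed_radicand[OF q K _, of "(sin s)\<^sup>2"] sin_sq_01[of s] l by (simp add: speed_def)
lemma inv_G_continuous: "continuous_on A (\<lambda>s. 1 / G s)"
  using G_pos by (intro continuous_intros speed_continuous q) (auto simp: less_le)

lemma travel_deriv: "(\<Theta> has_real_derivative 1 / G x) (at x)"
proof -
  define a where "a = - \<bar>x\<bar> - 1"
  define b where "b = \<bar>x\<bar> + 1"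
  let ?f = "\<lambda>s. 1 / G s"
  have int: "?f integrable_on {c..d}" for c d by (intro integrable_continuous_real inv_G_continuous)
  have *: "\<Theta> u = integral {a..u} ?f - integral {a..0} ?f" if "u \<in> {a..b}" for u
  proof (cases "u \<ge> 0")
    case True
    have "integral {a..0} ?f + integral {0..u} ?f = integral {a..u} ?f"
      by (rule Henstock_Kurzweil_Integration.integral_combine) (use True int in \<open>auto simp: a_def\<close>)
    moreover have "integral {u..0} ?f = 0" using True by (cases "u = 0") auto
    ultimately show ?thesis unfolding travel_def by simp
  next
    case False
    have "integral {a..u} ?f + integral {u..0} ?f = integral {a..0} ?f"
      by (rule Henstock_Kurzweil_Integration.integral_combine) (use False int that in auto)
    then show ?thesis unfolding travel_def using False by simp
  qed
  have "((\<lambda>u. integral {a..u} ?f - integral {a..0} ?f) has_real_derivative ?f x - 0) (at x within {a..b})"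
    by (intro derivative_intros integral_has_real_derivative inv_G_continuous) (auto simp: a_def b_def)
  then have "(\<Theta> has_real_derivative ?f x - 0) (at x within {a..b})"
    by (rule has_field_derivative_transform_within[where d=1]) (use * in \<open>auto simp: a_def b_def\<close>)
  moreover have "at x within {a..b} = at x" by (intro at_within_interior) (auto simp: a_def b_def)
  ultimately show ?thesis by simp
qed

lemma travel_0 [simp]: "\<Theta> 0 = 0" by (simp add: travel_def)

lemma travel_less: "x < y \<Longrightarrow> \<Theta> x < \<Theta> y"
  by (rule DERIV_pos_imp_increasing) (use travel_deriv G_pos in \<open>auto intro!: exI\<close>)
lemma travel_less_iff [simp]: "\<Theta> x < \<Theta> y \<longleftrightarrow> x < y"
  using travel_less by (metis linorder_less_linear order_less_asym)
lemma travel_eq_iff [simp]: "\<Theta> x = \<Theta> y \<longleftrightarrow> x = y"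
  using travel_less_iff by (metis linorder_less_linear order_less_irrefl)
lemma travel_isCont: "isCont \<Theta> x" using travel_deriv DERIV_isCont by blast

lemma travel_constI:
  assumes "\<And>x. (f has_real_derivative 1 / G x) (at x)" "f 0 = 0"
  shows "f x = \<Theta> x"
proof -
  have "((\<lambda>x. f x - \<Theta> x) has_real_derivative 1 / G x - 1 / G x) (at x)" for x
    by (intro DERIV_diff assms travel_deriv)
  then have "\<forall>x. ((\<lambda>x. f x - \<Theta> x) has_real_derivative 0) (at x)" by simp
  from DERIV_isconst_all[OF this, of x 0] show ?thesis using assms by simp
qed

lemma travel_minus: "\<Theta> (- x) = - \<Theta> x"
proof -
  have "((\<lambda>x. - \<Theta> (- x)) has_real_derivative 1 / G x) (at x)" for x
  proof -
    have "((\<lambda>x. \<Theta> (- x)) has_real_derivative 1 / G (- x) * -1) (at x)"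
      by (rule DERIV_chain2[where f=\<Theta> and g=uminus, OF travel_deriv]) (auto intro!: derivative_eq_intros)
    from DERIV_minus[OF this] show ?thesis by simp
  qed
  from travel_constI[OF this, of x] show ?thesis by simp
qed

lemma travel_pi: "\<Theta> (x + pi) = \<Theta> x + \<Theta> pi"
proof -
  have "((\<lambda>x. \<Theta> (x + pi) - \<Theta> pi) has_real_derivative 1 / G x) (at x)" for x
  proof -
    have "((\<lambda>x. \<Theta> (x + pi)) has_real_derivative 1 / G (x + pi) * 1) (at x)"
      by (rule DERIV_chain2[where f=\<Theta> and g="\<lambda>x. x + pi", OF travel_deriv]) (auto intro!: derivative_eq_intros)
    from DERIV_diff[OF this DERIV_const] show ?thesis by simp
  qed
  from travel_constI[OF this, of x] show ?thesis by simp
qed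

lemma travel_pi_half: "\<Theta> pi = 2 * \<Theta> (pi / 2)"
  using travel_pi[of "- (pi / 2)"] travel_minus[of "pi/2"] by simp

lemma travel_pi_diff: "\<Theta> (pi - x) = \<Theta> pi - \<Theta> x"
  using travel_pi[of "-x"] travel_minus[of x] by simp

lemma travel_nat_pi: "\<Theta> (of_nat n * pi) = of_nat n * \<Theta> pi"
proof (induction n)
  case (Suc n)
  then show ?case using travel_pi[of "of_nat n * pi"] by (simp add: algebra_simps)
qed simp

lemma travel_surj: "\<exists>x. \<Theta> x = y"
proof -
  have "\<Theta> pi > 0" using travel_less[of 0 pi] by simp
  then obtain n where n: "of_nat n * \<Theta> pi > \<bar>y\<bar>" using reals_Archimedean3 by blast
  then have "\<Theta> (- (of_nat n * pi)) \<le> y" "y \<le> \<Theta> (of_nat n * pi)"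
    unfolding travel_minus travel_nat_pi by auto
  then show ?thesis using IVT[of \<Theta> "- (of_nat n * pi)" y "of_nat n * pi"] travel_isCont by auto
qed

definition "\<Phi> = inv \<Theta>"

lemma travel_inv [simp]: "\<Theta> (\<Phi> y) = y" unfolding \<Phi>_def using travel_surj by (metis surj_def surj_f_inv_f)
lemma inv_travel [simp]: "\<Phi> (\<Theta> x) = x" using travel_eq_iff travel_inv by blast

lemma inv_deriv: "(\<Phi> has_real_derivative G (\<Phi> y)) (at y)"
proof -
  have "isCont \<Phi> (\<Theta> (\<Phi> y))"
    by (rule isCont_inverse_function[where d=1]) (auto simp: travel_isCont)
  then have "isCont \<Phi> y" by simp
  then have "(\<Phi> has_real_derivative inverse (1 / G (\<Phi> y))) (at y)"
    by (intro DERIV_inverse_function[where f=\<Theta> and a="y - 1" and b="y + 1"] travel_deriv)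
      (use G_pos[of "\<Phi> y"] in auto)
  then show ?thesis by simp
qed

lemma inv_less_iff [simp]: "\<Phi> x < \<Phi> y \<longleftrightarrow> x < y" by (metis travel_inv travel_less_iff)
lemma inv_0 [simp]: "\<Phi> 0 = 0" by (metis inv_travel travel_0)
lemma inv_minus: "\<Phi> (- y) = - \<Phi> y" by (metis inv_travel travel_inv travel_minus)
lemma inv_add_half_period: "\<Phi> (y + \<Theta> pi) = \<Phi> y + pi" by (metis inv_travel travel_inv travel_pi)
lemma inv_diff_half_period: "\<Phi> (\<Theta> pi - y) = pi - \<Phi> y" by (metis inv_travel travel_inv travel_pi_diff)
lemma inv_isCont: "isCont \<Phi> y" using inv_deriv DERIV_isCont by blast

definition "S y = sin (\<Phi> y)"
definition "S' y = cos (\<Phi> y) * G (\<Phi> y)"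

lemma S_deriv: "(S has_real_derivative S' y) (at y)"
  unfolding S_def[abs_def] S'_def by (auto intro!: derivative_eq_intros inv_deriv)

lemma G_isCont: "isCont G s" using speed_continuous[OF q, of UNIV] by (simp add: continuous_on_eq_continuous_at)

lemma S'_continuous: "continuous_on A S'"
proof -
  have "isCont (\<lambda>y. G (\<Phi> y)) y" for y by (rule isCont_o2[OF inv_isCont G_isCont])
  then have "isCont S' y" for y unfolding S'_def[abs_def] using inv_isCont by (intro continuous_intros)
  then show ?thesis by (simp add: continuous_at_imp_continuous_on)
qed

lemma S_minus: "S (- y) = - S y" by (simp add: S_def inv_minus)
lemma S_add: "S (y + \<Theta> pi) = - S y" by (simp add: S_def inv_add_half_period)
lemma S'_add: "S' (y + \<Theta> pi) = - S' y" by (simp add: S'_def inv_add_half_period)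
lemma S_diff: "S (\<Theta> pi - y) = S y" by (simp add: S_def inv_diff_half_period)
lemma S'_0: "S' 0 = sqrt (l\<^sup>2 + K)" using q by (simp add: S'_def speed_def diffquot_def)
lemma S_le_1: "\<bar>S y\<bar> \<le> 1" by (simp add: S_def)

lemma S_energy: "(S' y)\<^sup>2 = l\<^sup>2 * (1 - (S y)\<^sup>2) + K * (1 - (S y)\<^sup>2 powr q)"
proof -
  have "(S' y)\<^sup>2 = (1 - (S y)\<^sup>2) * (l\<^sup>2 + K * diffquot q ((S y)\<^sup>2))"
    unfolding S'_def power_mult_distrib G_sq S_def by (simp add: cos_squared_eq)
  also have "\<dots> = l\<^sup>2 * (1 - (S y)\<^sup>2) + K * (diffquot q ((S y)\<^sup>2) * (1 - (S y)\<^sup>2))" by (simp add: algebra_simps)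
  finally show ?thesis unfolding diffquot_mult .
qed

text \<open>Away from the turning points this is the derivative of the first integral. At a turning point
  \<open>S' = cos \<Phi> \<cdot> G\<close> is the product of a differentiable factor vanishing there and a continuous one.\<close>

lemma S_deriv2:
  assumes "S y > 0"
  shows "(S' has_real_derivative - (l\<^sup>2) * S y - K * q * S y powr (2 * q - 1)) (at y)"
proof (cases "S' y = 0")
  case True
  then have c: "cos (\<Phi> y) = 0" using G_pos[of "\<Phi> y"] by (simp add: S'_def)
  have s: "sin (\<Phi> y) = 1" using assms c sin_cos_squared_add[of "\<Phi> y"] unfolding S_def
    by (metis add.right_neutral power2_eq_1_iff zero_power2 less_minus_one_simps(1) not_less_iff_gr_or_eq minus_less_iff)
  have "((\<lambda>y. cos (\<Phi> y)) has_real_derivative - sin (\<Phi> y) * G (\<Phi> y)) (at y)"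
    by (auto intro!: derivative_eq_intros inv_deriv)
  from DERIV_vanishing_mult[OF this c isCont_o2[OF inv_isCont G_isCont]]
  have "(S' has_real_derivative - (G (\<Phi> y))\<^sup>2) (at y)" unfolding S'_def[abs_def] s by (simp add: power2_eq_square)
  moreover have "- (G (\<Phi> y))\<^sup>2 = - (l\<^sup>2) * S y - K * q * S y powr (2 * q - 1)"
    unfolding G_sq by (simp add: s S_def diffquot_def)
  ultimately show ?thesis by simp
next
  case False
  define Q where "Q u = l\<^sup>2 * (1 - u\<^sup>2) + K * (1 - u powr (2 * q))" for u :: real
  have ev1: "\<forall>\<^sub>F z in nhds y. S z > 0"
    using S_deriv[of y, THEN DERIV_isCont] assms unfolding isCont_def tendsto_at_iff_tendsto_nhds
    by (rule order_tendstoD)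
  have ev2: "\<forall>\<^sub>F z in nhds y. sgn (S' y) * S' z > 0"
  proof -
    have "isCont (\<lambda>z. sgn (S' y) * S' z) y" using S'_continuous[of UNIV]
      by (intro continuous_intros) (simp add: continuous_on_eq_continuous_at)
    then have "((\<lambda>z. sgn (S' y) * S' z) \<longlongrightarrow> sgn (S' y) * S' y) (nhds y)"
      unfolding isCont_def tendsto_at_iff_tendsto_nhds[of "\<lambda>z. sgn (S' y) * S' z" y] .
    moreover have "sgn (S' y) * S' y > 0" using False by (simp add: sgn_if)
    ultimately show ?thesis by (rule order_tendstoD(1))
  qed
  have ev: "\<forall>\<^sub>F z in nhds y. sgn (S' y) * sqrt (Q (S z)) = S' z"
    using ev1 ev2
  proof eventually_elim
    case (elim z)
    have "(S z)\<^sup>2 powr q = S z powr (2 * q)" using elim by (simp add: powr_powr flip: powr_numeral)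
    then have "Q (S z) = (S' z)\<^sup>2" unfolding S_energy Q_def by simp
    then have "sqrt (Q (S z)) = \<bar>S' z\<bar>" by simp
    then show ?case using elim(2) by (auto simp: sgn_if split: if_splits)
  qed
  have Qy: "Q (S y) = (S' y)\<^sup>2"
  proof -
    have "(S y)\<^sup>2 powr q = S y powr (2 * q)" using assms by (simp add: powr_powr flip: powr_numeral)
    then show ?thesis unfolding S_energy Q_def by simp
  qed
  define D where "D = - (l\<^sup>2) * S y - K * q * S y powr (2 * q - 1)"
  have dQ: "(Q has_real_derivative 2 * D) (at (S y))"
  proof -
    have "(Q has_real_derivative l\<^sup>2 * (0 - 2 * S y) + K * (0 - (2 * q) * S y powr (2 * q - 1))) (at (S y))"
      unfolding Q_def
      by (intro DERIV_add DERIV_cmult DERIV_diff DERIV_const has_real_derivative_powr assms)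
        (auto intro!: derivative_eq_intros)
    then show ?thesis by (simp add: D_def algebra_simps)
  qed
  have "((\<lambda>z. Q (S z)) has_real_derivative 2 * D * S' y) (at y)" by (rule DERIV_chain2[OF dQ S_deriv])
  then have "((\<lambda>z. sqrt (Q (S z))) has_real_derivative inverse (sqrt (Q (S y))) / 2 * (2 * D * S' y)) (at y)"
    by (intro DERIV_chain2[where f=sqrt, OF DERIV_real_sqrt]) (use False Qy in auto)
  then have A1: "((\<lambda>z. sgn (S' y) * sqrt (Q (S z))) has_real_derivative sgn (S' y) * (inverse (sqrt (Q (S y))) / 2 * (2 * D * S' y))) (at y)"
    by (rule DERIV_cmult)
  have A2: "sgn (S' y) * (inverse (sqrt (Q (S y))) / 2 * (2 * D * S' y)) = D"
    unfolding Qy using False by (simp add: sgn_if field_simps)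
  from A1 have "((\<lambda>z. sgn (S' y) * sqrt (Q (S z))) has_real_derivative D) (at y)" unfolding A2 .
  then show ?thesis unfolding D_def[symmetric] by (rule iffD1[OF DERIV_cong_ev[OF refl ev refl]])
qed

end

section \<open>Arcs of the angular equation\<close>

context pruefer begin

text \<open>On a rising branch \<open>arcsin v\<close> satisfies the Pruefer equation, so its travel time and the angle
  \<open>x\<close> differ by a constant.\<close>

lemma half_arc:
  fixes v dv :: "real \<Rightarrow> real"
  assumes aA: "a < A"
    and v: "\<And>x. x \<in> {a..A} \<Longrightarrow> (v has_real_derivative dv x) (at x)"
    and dv: "continuous_on {a..A} dv"
    and va: "v a = 0" and vA: "v A = 1"
    and v01: "\<And>x. a < x \<Longrightarrow> x < A \<Longrightarrow> 0 < v x \<and> v x < 1"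
    and energy: "\<And>x. a < x \<Longrightarrow> x < A \<Longrightarrow> (dv x)\<^sup>2 = l\<^sup>2 * (1 - (v x)\<^sup>2) + K * (1 - (v x)\<^sup>2 powr q)"
  shows "A - a = \<Theta> (pi / 2)" and "\<And>x. x \<in> {a..A} \<Longrightarrow> v x = S (x - a)"
proof -
  have cv: "continuous_on {a..A} v" using v by (intro DERIV_continuous_on) (auto intro: has_field_derivative_at_within)
  have energy': "(dv x)\<^sup>2 = (1 - (v x)\<^sup>2) * (G (arcsin (v x)))\<^sup>2" if "a < x" "x < A" for x
  proof -
    have "sin (arcsin (v x)) = v x" using v01[OF that] by simp
    then have "(1 - (v x)\<^sup>2) * (G (arcsin (v x)))\<^sup>2 = l\<^sup>2 * (1 - (v x)\<^sup>2) + K * (diffquot q ((v x)\<^sup>2) * (1 - (v x)\<^sup>2))"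
      unfolding G_sq by (simp add: algebra_simps)
    then show ?thesis unfolding diffquot_mult energy[OF that] ..
  qed
  have lt1: "(v x)\<^sup>2 < 1" if "a < x" "x < A" for x
    using v01[OF that] by (simp add: abs_square_less_1)
  have nz: "dv x \<noteq> 0" if "a < x" "x < A" for x
  proof -
    have "(dv x)\<^sup>2 > 0" unfolding energy'[OF that] using lt1[OF that] G_pos[of "arcsin (v x)"] by simp
    then show ?thesis by auto
  qed
  obtain z where z: "a < z" "z < A" "dv z > 0"
  proof -
    obtain z where "a < z" "z < A" "v A - v a = (A - a) * dv z"
      using MVT2[OF aA, of v dv] v by auto
    then show ?thesis using that[of z] aA va vA by (metis diff_gt_0_iff_gt diff_zero less_numeral_extra(1) zero_less_mult_pos)
  qed
  have pos: "dv x > 0" if "a < x" "x < A" for x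
  proof (rule ccontr)
    assume "\<not> dv x > 0"
    then have neg: "dv x < 0" using nz[OF that] by simp
    define c d where "c = min x z" and "d = max x z"
    have cd: "a < c" "d < A" "c \<le> d" using z that by (auto simp: c_def d_def)
    have "continuous_on {c..d} dv" using dv by (rule continuous_on_subset) (use cd in auto)
    then have "\<exists>y. c \<le> y \<and> y \<le> d \<and> dv y = 0"
    proof (cases "x \<le> z")
      case True
      then show ?thesis using IVT'[of dv c 0 d] neg z cd \<open>continuous_on {c..d} dv\<close> by (auto simp: c_def d_def)
    next
      case False
      then show ?thesis using IVT2'[of dv d 0 c] neg z cd \<open>continuous_on {c..d} dv\<close> by (auto simp: c_def d_def)
    qed
    then obtain y where "c \<le> y" "y \<le> d" "dv y = 0" by blast
    then show False using nz[of y] cd by simp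
  qed
  define F where "F x = \<Theta> (arcsin (v x)) - x" for x
  have bnd: "-1 \<le> v x \<and> v x \<le> 1" if "x \<in> {a..A}" for x
    using v01[of x] va vA that by (cases "x = a \<or> x = A") auto
  have Fc: "continuous_on {a..A} F" unfolding F_def
  proof (intro continuous_intros)
    show "continuous_on {a..A} (\<lambda>x. \<Theta> (arcsin (v x)))"
    proof (rule continuous_on_compose2[of UNIV \<Theta>])
      show "continuous_on UNIV \<Theta>" using travel_isCont by (simp add: continuous_at_imp_continuous_on)
      show "continuous_on {a..A} (\<lambda>x. arcsin (v x))" using bnd by (intro continuous_on_arcsin cv) auto
    qed auto
  qed
  have Fd: "(F has_real_derivative 0) (at x)" if x: "a < x" "x < A" for x
  proof -
    have sq: "sqrt (1 - (v x)\<^sup>2) > 0" using lt1[OF x] by simp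
    have dvx: "dv x = sqrt (1 - (v x)\<^sup>2) * G (arcsin (v x))"
    proof (rule power2_eq_imp_eq)
      show "(dv x)\<^sup>2 = (sqrt (1 - (v x)\<^sup>2) * G (arcsin (v x)))\<^sup>2"
        unfolding energy'[OF x] power_mult_distrib using lt1[OF x] by simp
    qed (use pos[OF x] sq G_pos[of "arcsin (v x)"] in auto)
    have "(arcsin has_real_derivative inverse (sqrt (1 - (v x)\<^sup>2))) (at (v x))"
      using v01[OF x] by (intro DERIV_arcsin) auto
    then have "((\<lambda>x. arcsin (v x)) has_real_derivative inverse (sqrt (1 - (v x)\<^sup>2)) * dv x) (at x)"
      by (rule DERIV_chain2) (use v x in auto)
    then have "((\<lambda>x. \<Theta> (arcsin (v x))) has_real_derivative 1 / G (arcsin (v x)) * (inverse (sqrt (1 - (v x)\<^sup>2)) * dv x)) (at x)"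
      by (rule DERIV_chain2[OF travel_deriv])
    then have A1: "(F has_real_derivative 1 / G (arcsin (v x)) * (inverse (sqrt (1 - (v x)\<^sup>2)) * dv x) - 1) (at x)"
      unfolding F_def by (intro DERIV_diff DERIV_ident)
    have A2: "1 / G (arcsin (v x)) * (inverse (sqrt (1 - (v x)\<^sup>2)) * dv x) - 1 = 0"
      unfolding dvx using sq G_pos[of "arcsin (v x)"] by (simp add: field_simps)
    from A1 show ?thesis unfolding A2 .
  qed
  have Fx: "\<Theta> (arcsin (v x)) = x - a" if "x \<in> {a..A}" for x
  proof -
    have "F x = F a" using DERIV_isconst2[OF aA Fc Fd, of x] that by auto
    then show ?thesis by (simp add: F_def va)
  qed
  show "A - a = \<Theta> (pi / 2)" using Fx[of A] aA by (simp add: vA)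
  show "v x = S (x - a)" if "x \<in> {a..A}" for x
    unfolding S_def Fx[OF that, symmetric] using bnd[OF that] by simp
qed

end

text \<open>A positive solution between two zeros has a first integral, so the values \<open>m\<close> of the maximum and
  \<open>\<sigma>\<close> of the end slope determine the constant \<open>K\<close> of the normalised equation. The solution rises to its
  maximum once, cannot rest there because its second derivative is negative, and falls symmetrically.\<close>

lemma arc:
  fixes v dv :: "real \<Rightarrow> real"
  assumes q: "0 < q" "q < 1" and l: "l > 0" and \<sigma>: "\<sigma> > 0" and ab: "a < b"
    and v: "\<And>x. (v has_real_derivative dv x) (at x)" and dv: "continuous_on UNIV dv"
    and va: "v a = 0" and vb: "v b = 0" and vpos: "\<And>x. a < x \<Longrightarrow> x < b \<Longrightarrow> v x > 0"
    and dva: "dv a = \<sigma>"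
    and ode: "\<And>x. a < x \<Longrightarrow> x < b \<Longrightarrow> (dv has_real_derivative - (l\<^sup>2) * v x + k * v x powr (2 * q - 1)) (at x)"
  obtains m K where "m > 0" "l\<^sup>2 + K > 0" "\<sigma>\<^sup>2 = m\<^sup>2 * (l\<^sup>2 + K)" "k = - q * K * m powr (2 - 2 * q)"
    "b - a = travel l q K pi" "\<And>x. x \<in> {a..b} \<Longrightarrow> v x = m * pruefer.S l q K (x - a)" "dv b = - \<sigma>"
    "\<And>x. x \<in> {a..b} \<Longrightarrow> (dv x)\<^sup>2 = \<sigma>\<^sup>2 - l\<^sup>2 * (v x)\<^sup>2 + k / q * v x powr (2 * q)"
proof -
  have cv: "continuous_on A v" for A using v by (intro DERIV_continuous_on) (auto intro: has_field_derivative_at_within)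
  have vnn: "v x \<ge> 0" if "x \<in> {a..b}" for x
    using vpos[of x] va vb that by (cases "x = a \<or> x = b") auto
  define E where "E x = (dv x)\<^sup>2 + l\<^sup>2 * (v x)\<^sup>2 - k / q * v x powr (2 * q)" for x
  have Ec: "continuous_on {a..b} E" unfolding E_def
    by (intro continuous_intros continuous_on_powr' cv continuous_on_subset[OF dv]) (use vnn q in auto)
  have Ed: "(E has_real_derivative 0) (at x)" if x: "a < x" "x < b" for x
  proof -
    have "((\<lambda>x. v x powr (2 * q)) has_real_derivative (2 * q) * v x powr (2 * q - 1) * dv x) (at x)"
      by (rule DERIV_chain2[OF has_real_derivative_powr[OF vpos[OF x]] v])
    moreover have "((\<lambda>x. (dv x)\<^sup>2) has_real_derivative 2 * dv x * (- (l\<^sup>2) * v x + k * v x powr (2 * q - 1))) (at x)"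
      using DERIV_power[OF ode[OF x], of 2] by (simp add: mult_ac)
    moreover have "((\<lambda>x. (v x)\<^sup>2) has_real_derivative 2 * v x * dv x) (at x)"
      using DERIV_power[OF v, of 2] by (simp add: mult_ac)
    ultimately have "(E has_real_derivative 2 * dv x * (- (l\<^sup>2) * v x + k * v x powr (2 * q - 1)) + l\<^sup>2 * (2 * v x * dv x)
       - k / q * ((2 * q) * v x powr (2 * q - 1) * dv x)) (at x)"
      unfolding E_def by (intro DERIV_add DERIV_diff DERIV_cmult)
    moreover have "2 * dv x * (- (l\<^sup>2) * v x + k * v x powr (2 * q - 1)) + l\<^sup>2 * (2 * v x * dv x)
       - k / q * ((2 * q) * v x powr (2 * q - 1) * dv x) = 0" using q by (simp add: field_simps)
    ultimately show ?thesis by simp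
  qed
  have Ex: "E x = \<sigma>\<^sup>2" if "x \<in> {a..b}" for x
    using DERIV_isconst2[OF ab Ec Ed, of x] that by (auto simp: E_def va dva)
  have en: "(dv x)\<^sup>2 = \<sigma>\<^sup>2 - l\<^sup>2 * (v x)\<^sup>2 + k / q * v x powr (2 * q)" if "x \<in> {a..b}" for x
    using Ex[OF that] by (simp add: E_def)
  obtain c where c: "c \<in> {a..b}" "\<And>x. x \<in> {a..b} \<Longrightarrow> v x \<le> v c"
    using continuous_attains_sup[of "{a..b}" v] cv ab by auto
  define m where "m = v c"
  have m: "m > 0" using c(2)[of "(a+b)/2"] vpos[of "(a+b)/2"] ab by (auto simp: m_def)
  have cab: "a < c" "c < b" using c(1) m va vb unfolding m_def by (cases "c = a"; cases "c = b"; auto)+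
  have crit: "dv x = 0" if x: "a < x" "x < b" and mx: "v x = m" for x
  proof (rule DERIV_local_max[OF v[of x], of "min (x - a) (b - x)"])
    show "\<forall>y. \<bar>x - y\<bar> < min (x - a) (b - x) \<longrightarrow> v y \<le> v x"
      using c(2) mx unfolding m_def by (auto simp: abs_if split: if_splits)
  qed (use x in auto)
  have mE: "\<sigma>\<^sup>2 = l\<^sup>2 * m\<^sup>2 - k / q * m powr (2 * q)"
    using en[OF c(1)] crit[OF cab] by (simp add: m_def)
  \<comment> \<open>Normalising the maximum to 1 turns \<open>k\<close> into this constant.\<close>
  define K where "K = - (k / q) * m powr (2 * q - 2)"
  have mm: "m powr (2 * q - 2) * m\<^sup>2 = m powr (2 * q)" "m powr (2 * q - 2) * m powr (2 - 2 * q) = 1"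
    using m by (simp_all flip: powr_numeral powr_add)
  have K1: "\<sigma>\<^sup>2 = m\<^sup>2 * (l\<^sup>2 + K)"
  proof -
    have "m\<^sup>2 * (l\<^sup>2 + K) = l\<^sup>2 * m\<^sup>2 - k / q * (m powr (2 * q - 2) * m\<^sup>2)" by (simp add: K_def algebra_simps)
    then show ?thesis unfolding mm mE by simp
  qed
  have K2: "k = - q * K * m powr (2 - 2 * q)"
  proof -
    have "- q * K * m powr (2 - 2 * q) = k * (m powr (2 * q - 2) * m powr (2 - 2 * q))" using q by (simp add: K_def)
    then show ?thesis unfolding mm by simp
  qed
  have "m\<^sup>2 * (l\<^sup>2 + K) > 0" using K1 \<sigma> by (metis zero_less_power)
  then have K: "l\<^sup>2 + K > 0" using m by (simp add: zero_less_mult_iff)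
  interpret pruefer l q K using q l K by unfold_locales
  have qK: "l\<^sup>2 + q * K > 0"
  proof (cases "K \<ge> 0")
    case True
    then show ?thesis using l q by (simp add: add_pos_nonneg)
  next
    case False
    then have "q * K \<ge> 1 * K" using q by (intro mult_right_mono_neg) auto
    then show ?thesis using K by simp
  qed
  define u du where "u x = v x / m" and "du x = dv x / m" for x
  have ud: "(u has_real_derivative du x) (at x)" for x
    unfolding u_def du_def using DERIV_cdivide[OF v] by blast
  have duc: "continuous_on A du" for A
    unfolding du_def using m by (intro continuous_intros continuous_on_subset[OF dv]) auto
  have unn: "0 \<le> u x" "u x \<le> 1" if "x \<in> {a..b}" for x
    using vnn[OF that] c(2)[OF that] m by (auto simp: u_def m_def)
  have uen: "(du x)\<^sup>2 = l\<^sup>2 * (1 - (u x)\<^sup>2) + K * (1 - (u x)\<^sup>2 powr q)" if x: "x \<in> {a..b}" for x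
  proof -
    have 1: "(u x)\<^sup>2 powr q = v x powr (2 * q) * m powr (- (2 * q))"
    proof (cases "v x = 0")
      case True then show ?thesis using q by (simp add: u_def)
    next
      case False
      then have "u x > 0" using vnn[OF x] m by (simp add: u_def)
      then have "(u x)\<^sup>2 powr q = u x powr (2 * q)" by (simp add: powr_powr flip: powr_numeral)
      then show ?thesis using False vnn[OF x] m by (simp add: u_def powr_divide powr_minus_divide)
    qed
    have 2: "m powr (2 * q - 2) = m powr (2 * q) * inverse (m\<^sup>2)"
      using m by (simp add: powr_diff divide_inverse)
    have "m powr (2 * q) * m powr (- (2 * q)) = 1" using m by (simp flip: powr_add)
    then have 3: "K * (u x)\<^sup>2 powr q = - (k / q) * v x powr (2 * q) * inverse (m\<^sup>2)"
      unfolding 1 K_def 2 by (simp add: mult_ac)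
    have "(du x)\<^sup>2 = (dv x)\<^sup>2 * inverse (m\<^sup>2)" by (simp add: du_def divide_inverse power_mult_distrib power_inverse)
    also have "\<dots> = (m\<^sup>2 * (l\<^sup>2 + K)) * inverse (m\<^sup>2) - l\<^sup>2 * ((v x)\<^sup>2 * inverse (m\<^sup>2)) + k / q * v x powr (2 * q) * inverse (m\<^sup>2)"
      unfolding en[OF x] K1[symmetric] by (simp add: algebra_simps)
    also have "(m\<^sup>2 * (l\<^sup>2 + K)) * inverse (m\<^sup>2) = l\<^sup>2 + K" using m by simp
    also have "(v x)\<^sup>2 * inverse (m\<^sup>2) = (u x)\<^sup>2" by (simp add: u_def divide_inverse power_mult_distrib power_inverse)
    finally show ?thesis using 3 by (simp add: algebra_simps)
  qed
  have nz: "du x \<noteq> 0" if x: "x \<in> {a..b}" and "u x < 1" for x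
  proof -
    have "(u x)\<^sup>2 < 1" using unn[OF x] that by (simp add: abs_square_less_1)
    moreover have "(du x)\<^sup>2 = (1 - (u x)\<^sup>2) * (l\<^sup>2 + K * diffquot q ((u x)\<^sup>2))"
      unfolding uen[OF x] diffquot_mult[symmetric] by (simp add: algebra_simps)
    moreover have "l\<^sup>2 + K * diffquot q ((u x)\<^sup>2) > 0"
      using speed_radicand[of q l K "(u x)\<^sup>2"] q l K calculation(1) by auto
    ultimately have "(du x)\<^sup>2 > 0" by simp
    then show ?thesis by auto
  qed
  define M where "M = {x \<in> {a..b}. u x = 1}"
  have uc: "continuous_on A u" for A unfolding u_def using m by (intro continuous_intros cv) auto
  have "M = {a..b} \<inter> u -` {1}" by (auto simp: M_def)
  then have "compact M" using continuous_on_closed_vimage[of "{a..b}" u] uc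
    by (metis closed_atLeastAtMost closed_singleton compact_Icc compact_Int_closed Int_commute continuous_closed_vimage inf.idem
        continuous_on_closed_vimage compact_eq_bounded_closed bounded_Int bounded_closed_interval)
  moreover have "c \<in> M" using c(1) m by (simp add: M_def u_def m_def)
  ultimately obtain A B where A: "A \<in> M" "\<And>x. x \<in> M \<Longrightarrow> A \<le> x" and B: "B \<in> M" "\<And>x. x \<in> M \<Longrightarrow> x \<le> B"
    using compact_attains_inf[of M] compact_attains_sup[of M] by blast
  have uA: "u A = 1" "u B = 1" and AB: "A \<in> {a..b}" "B \<in> {a..b}" using A B by (auto simp: M_def)
  have uab: "u a = 0" "u b = 0" using va vb by (simp_all add: u_def)
  have A': "a < A" "B < b" using uA uab AB by (metis atLeastAtMost_iff order_le_less zero_neq_one)+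
  have upos: "u x > 0" if "a < x" "x < b" for x using vpos[OF that] m by (simp add: u_def)
  have ult: "u x < 1" if "x \<in> {a..b}" "x < A \<or> B < x" for x
    using unn(2)[OF that(1)] that A(2)[of x] B(2)[of x] by (force simp: M_def)
  \<comment> \<open>Between the first and the last maximum the solution is neither below the maximum, where the energy forbids critical points, nor constant, by the equation.\<close>
  have "A = B"
  proof (rule ccontr)
    assume "A \<noteq> B"
    then have lt: "A < B" using A(2)[OF B(1)] by simp
    obtain d where d: "d \<in> {A..B}" "\<And>x. x \<in> {A..B} \<Longrightarrow> u d \<le> u x"
      using continuous_attains_inf[of "{A..B}" u] uc lt by auto
    show False
    proof (cases "u d < 1")
      case True
      then have dAB: "A < d" "d < B" using d(1) uA by (cases "d = A"; cases "d = B"; auto)+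
      have "du d = 0"
      proof (rule DERIV_local_min[OF ud[of d], of "min (d - A) (B - d)"])
        show "\<forall>y. \<bar>d - y\<bar> < min (d - A) (B - d) \<longrightarrow> u d \<le> u y"
          using d(2) by (auto simp: abs_if split: if_splits)
      qed (use dAB in auto)
      then show False using nz[of d] True dAB AB by auto
    next
      case False
      then have one: "u x = 1" if "x \<in> {A..B}" for x
        using d(2)[OF that] unn(2)[of x] that AB by auto
      define z where "z = (A + B) / 2"
      have z: "A < z" "z < B" using lt by (auto simp: z_def)
      have "dv x = 0" if "x \<in> {A<..<B}" for x
        using crit[of x] one[of x] that AB A' m by (auto simp: u_def)
      moreover have "\<forall>\<^sub>F x in nhds z. x \<in> {A<..<B}" using z by (intro eventually_nhds_in_open) auto
      ultimately have "\<forall>\<^sub>F x in nhds z. dv x = 0" by (auto elim: eventually_mono)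
      then have "(dv has_real_derivative 0) (at z)" using DERIV_cong_ev[OF refl, of dv "\<lambda>_. 0" z 0 0] by simp
      moreover have "a < z" "z < b" using z AB by auto
      ultimately have "- (l\<^sup>2) * v z + k * v z powr (2 * q - 1) = 0" using ode DERIV_unique by blast
      moreover have "v z = m" using one[of z] z m by (simp add: u_def)
      moreover have "k * m powr (2 * q - 1) = - q * K * m"
      proof -
        have "m powr (2 - 2 * q) * m powr (2 * q - 1) = m" using m by (simp flip: powr_add)
        then show ?thesis unfolding K2 by (metis mult.assoc)
      qed
      ultimately have "m * (l\<^sup>2 + q * K) = 0" by (simp add: algebra_simps)
      then show False using m qK by simp
    qed
  qed
  have L: "A - a = \<Theta> (pi / 2)" "\<And>x. x \<in> {a..A} \<Longrightarrow> u x = S (x - a)"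
    by (rule half_arc[OF A'(1), of u du]; use ud duc uab uA upos ult uen AB A' in force)+
  have R: "- B - (- b) = \<Theta> (pi / 2)" "\<And>x. x \<in> {-b..-B} \<Longrightarrow> u (- x) = S (x - (- b))"
  proof -
    have ud': "((\<lambda>x. u (- x)) has_real_derivative - du (- x)) (at x)" for x
      using DERIV_chain2[where f=u and g=uminus and x=x and Db="-1" and s=UNIV, OF ud]
      by (simp add: DERIV_minus[OF DERIV_ident, simplified])
    have duc': "continuous_on {-b..-B} (\<lambda>x. - du (- x))"
      by (intro continuous_intros continuous_on_compose2[OF duc[of UNIV]]) auto
    have 1: "0 < u (- x) \<and> u (- x) < 1" if "- b < x" "x < - B" for x
      using upos[of "- x"] ult[of "- x"] that AB A' by auto
    have 2: "(- du (- x))\<^sup>2 = l\<^sup>2 * (1 - (u (- x))\<^sup>2) + K * (1 - (u (- x))\<^sup>2 powr q)" if "- b < x" "x < - B" for x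
      using uen[of "- x"] that AB A' by auto
    have lt: "- b < - B" using A' by simp
    show "- B - (- b) = \<Theta> (pi / 2)" "\<And>x. x \<in> {-b..-B} \<Longrightarrow> u (- x) = S (x - (- b))"
      using half_arc[OF lt ud' duc' _ _ 1 2] uab uA by simp_all
  qed
  have len: "b - a = \<Theta> pi" using L(1) R(1) \<open>A = B\<close> travel_pi_half by simp
  have sol: "v x = m * S (x - a)" if x: "x \<in> {a..b}" for x
  proof (cases "x \<le> A")
    case True
    then show ?thesis using L(2)[of x] x m by (simp add: u_def field_simps)
  next
    case False
    then have "u x = S (b - x)" using R(2)[of "- x"] x \<open>A = B\<close> by auto
    also have "b - x = \<Theta> pi - (x - a)" using len by simp
    finally show ?thesis unfolding S_diff using m by (simp add: u_def field_simps)
  qed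
  have "(dv b)\<^sup>2 = \<sigma>\<^sup>2" using en[of b] ab by (simp add: vb)
  then have dvb: "dv b = \<sigma> \<or> dv b = - \<sigma>" by (simp add: power2_eq_iff)
  have "\<not> dv b > 0"
  proof
    assume "dv b > 0"
    then obtain d where d: "d > 0" "\<And>h. 0 < h \<Longrightarrow> h < d \<Longrightarrow> v (b - h) < v b"
      using DERIV_pos_inc_left[OF v[of b]] by blast
    define h where "h = min d (b - a) / 2"
    have "0 < h" "h < d" "h < b - a" using d(1) ab by (auto simp: h_def min_def)
    then show False using d(2)[of h] vpos[of "b - h"] vb by simp
  qed
  then have "dv b = - \<sigma>" using dvb \<sigma> by auto
  then show ?thesis using that[OF m K K1 K2 len sol _ en] by blast
qed

text \<open>The first integral at the maximum reads \<open>\<sigma>\<^sup>2 = l\<^sup>2 m\<^sup>2 - (k/q) m\<close>-to-the-\<open>2q\<close>. After division by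
  \<open>m\<close>-to-the-\<open>2q\<close> one side decreases and the other increases in \<open>m\<close>.\<close>

lemma arc_parameters_unique:
  fixes l \<sigma> k q m1 m2 K1 K2 :: real
  assumes q: "0 < q" "q < 1" and l: "l > 0" and \<sigma>: "\<sigma> > 0"
    and 1: "m1 > 0" "\<sigma>\<^sup>2 = m1\<^sup>2 * (l\<^sup>2 + K1)" "k = - q * K1 * m1 powr (2 - 2 * q)"
    and 2: "m2 > 0" "\<sigma>\<^sup>2 = m2\<^sup>2 * (l\<^sup>2 + K2)" "k = - q * K2 * m2 powr (2 - 2 * q)"
  shows "m1 = m2" "K1 = K2"
proof -
  have *: "\<sigma>\<^sup>2 * m powr (- 2 * q) = l\<^sup>2 * m powr (2 - 2 * q) - k / q"
    if "m > 0" "\<sigma>\<^sup>2 = m\<^sup>2 * (l\<^sup>2 + K)" "k = - q * K * m powr (2 - 2 * q)" for m K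
  proof -
    have "m\<^sup>2 * m powr (- 2 * q) = m powr (2 - 2 * q)" using that(1) by (simp flip: powr_numeral powr_add)
    then have "\<sigma>\<^sup>2 * m powr (- 2 * q) = m powr (2 - 2 * q) * (l\<^sup>2 + K)" unfolding that(2) by (simp add: mult_ac)
    moreover have "k / q = - K * m powr (2 - 2 * q)" unfolding that(3) using q by simp
    ultimately show ?thesis by (simp add: algebra_simps)
  qed
  have not_less: False
    if "a < b" "a > 0" "\<sigma>\<^sup>2 * a powr (- 2 * q) = l\<^sup>2 * a powr (2 - 2 * q) - k / q"
      "\<sigma>\<^sup>2 * b powr (- 2 * q) = l\<^sup>2 * b powr (2 - 2 * q) - k / q" for a b
  proof -
    have "b powr (- 2 * q) \<le> a powr (- 2 * q)" using that q by (intro powr_mono2') auto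
    then have "\<sigma>\<^sup>2 * b powr (- 2 * q) \<le> \<sigma>\<^sup>2 * a powr (- 2 * q)" by (intro mult_left_mono) auto
    moreover have "a powr (2 - 2 * q) < b powr (2 - 2 * q)" using that q by (intro powr_less_mono2) auto
    then have "l\<^sup>2 * a powr (2 - 2 * q) < l\<^sup>2 * b powr (2 - 2 * q)" using l by (intro mult_strict_left_mono) auto
    ultimately show False using that by linarith
  qed
  show m: "m1 = m2"
    using not_less[OF _ 1(1) *[OF 1] *[OF 2]] not_less[OF _ 2(1) *[OF 2] *[OF 1]] by (metis linorder_less_linear)
  show "K1 = K2" using 1 2 m by simp
qed

lemma travel_period_decreasing:
  assumes q: "0 < q" "q < 1" and l: "l > 0" and K: "l\<^sup>2 + K1 > 0" "K1 < K2"
  shows "travel l q K2 pi < travel l q K1 pi"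
proof -
  interpret p1: pruefer l q K1 using q l K by unfold_locales auto
  interpret p2: pruefer l q K2 using q l K by unfold_locales auto
  have "travel l q K1 0 - travel l q K2 0 < travel l q K1 pi - travel l q K2 pi"
  proof (rule DERIV_pos_imp_increasing[where f="\<lambda>x. travel l q K1 x - travel l q K2 x" and a=0 and b=pi])
    fix x :: real
    have "speed l q K1 x < speed l q K2 x"
    proof -
      have "diffquot q ((sin x)\<^sup>2) > 0" using diffquot_bounds[OF q, of "(sin x)\<^sup>2"] sin_sq_01[of x] q by auto
      then show ?thesis using K by (simp add: speed_def)
    qed
    then have "1 / speed l q K1 x - 1 / speed l q K2 x > 0" using p1.G_pos[of x] by (simp add: frac_less2)
    moreover have "((\<lambda>x. travel l q K1 x - travel l q K2 x) has_real_derivative 1 / speed l q K1 x - 1 / speed l q K2 x) (at x)"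
      by (intro DERIV_diff p1.travel_deriv p2.travel_deriv)
    ultimately show "\<exists>y. ((\<lambda>x. travel l q K1 x - travel l q K2 x) has_real_derivative y) (at x) \<and> y > 0" by blast
  qed simp
  then show ?thesis by simp
qed

text \<open>For \<open>K = 0\<close> the opening angle is \<open>\<pi>/l > \<pi>/2\<close>, and for large \<open>K\<close> the speed is at least 2, which makes the
  angle at most \<open>\<pi>/2\<close>.\<close>

lemma travel_period_half_pi:
  assumes q: "0 < q" "q < 1" and l: "1 < l" "l < 2"
  obtains K where "K > 0" "travel l q K pi = pi / 2"
proof -
  define b where "b = 4 / q"
  have b: "b > 0" using q by (simp add: b_def)
  have t: "travel l q K pi = integral (cbox 0 pi) (\<lambda>s. 1 / speed l q K s)" for K by (simp add: travel_def)
  have dq: "q \<le> diffquot q ((sin s)\<^sup>2)" for s using diffquot_bounds[OF q, of "(sin s)\<^sup>2"] sin_sq_01[of s] by auto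
  have pos: "l\<^sup>2 + K * diffquot q ((sin s)\<^sup>2) > 0" if "K \<in> {0..b}" for K s
    using dq[of s] q that l by (intro add_pos_nonneg mult_nonneg_nonneg) auto
  have pos': "sqrt (l\<^sup>2 + fst p * diffquot q ((sin (snd p))\<^sup>2)) \<noteq> 0" if "p \<in> {0..b} \<times> cbox 0 pi" for p
    using pos[of "fst p" "snd p"] that by (auto simp: mem_Times_iff)
  have "continuous_on ({0..b} \<times> cbox 0 pi) (\<lambda>(K, s). 1 / speed l q K s)"
    unfolding split_beta speed_def
    by (intro continuous_intros continuous_on_compose2[OF diffquot_sin_continuous[OF q, of UNIV]])
      (use pos' in auto)
  then have cont: "continuous_on {0..b} (\<lambda>K. travel l q K pi)"
    unfolding t by (rule integral_continuous_on_param)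
  have at0: "travel l q 0 pi = pi / l"
    using l by (simp add: t speed_def content_real)
  have "travel l q b pi \<le> integral (cbox 0 pi) (\<lambda>s. 1 / 2)"
    unfolding t
  proof (rule integral_le)
    interpret pruefer l q b using q l b by unfold_locales (auto simp: add_pos_pos)
    show "(\<lambda>s. 1 / speed l q b s) integrable_on cbox 0 pi"
      using integrable_continuous_real[OF inv_G_continuous[of "{0..pi}"]] by simp
    show "1 / speed l q b s \<le> 1 / 2" if "s \<in> cbox 0 pi" for s
    proof -
      have "b * diffquot q ((sin s)\<^sup>2) \<ge> b * q" using dq b by (intro mult_left_mono) auto
      then have "2\<^sup>2 \<le> l\<^sup>2 + b * diffquot q ((sin s)\<^sup>2)" using q by (simp add: b_def add_increasing)
      then have "2 \<le> speed l q b s" unfolding speed_def by (rule real_le_rsqrt)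
      then show ?thesis by (simp add: field_simps)
    qed
  qed auto
  then have atb: "travel l q b pi \<le> pi / 2" by (simp add: content_real)
  have "pi / 2 < pi / l" using l by (simp add: field_simps)
  then obtain K where K: "0 \<le> K" "K \<le> b" "travel l q K pi = pi / 2"
    using IVT2'[of "\<lambda>K. travel l q K pi" b "pi/2" 0] cont at0 atb b by auto
  moreover have "K \<noteq> 0" using K(3) at0 \<open>pi / 2 < pi / l\<close> by auto
  ultimately show ?thesis using that[of K] by simp
qed

section \<open>Integration by parts along lines\<close>

text \<open>Parametrises the lines parallel to the \<open>i\<close>-th axis, so that both directions are treated at once.\<close>

definition slice :: "2 \<Rightarrow> real \<Rightarrow> real \<Rightarrow> real^2" where
  "slice i a b = (\<chi> j. if j = i then a else b)"

lemma slice_nth: "slice i a b $ j = (if j = i then a else b)" by (simp add: slice_def)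

lemma slice_line: "slice i (a + h) b = slice i a b + h *\<^sub>R axis i 1"
  by (auto simp: vec_eq_iff slice_def axis_def)

lemma slice_continuous: "continuous_on A (\<lambda>x. slice i (f x) (g x))" if "continuous_on A f" "continuous_on A g"
  unfolding slice_def
proof (rule continuous_on_vec_lambda)
  fix j show "continuous_on A (\<lambda>x. if j = i then f x else g x)" using that by (cases "j = i") auto
qed

lemma Basis_real2: "(Basis :: (real^2) set) = {axis 1 1, axis 2 1}"
  unfolding Basis_vec_def UNIV_2 by auto

lemma slice_measurable: "(\<lambda>(a, b). slice i a b) \<in> borel_measurable (lborel \<Otimes>\<^sub>M lborel)"
proof -
  have "continuous_on UNIV (\<lambda>p. slice i (fst p) (snd p))" by (intro slice_continuous continuous_intros)
  then have "(\<lambda>p. slice i (fst p) (snd p)) \<in> borel_measurable borel" by (rule borel_measurable_continuous_onI)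
  then show ?thesis unfolding lborel_prod by (simp add: split_beta' measurable_lborel1)
qed

lemma lborel_slice: "lborel = distr (lborel \<Otimes>\<^sub>M lborel) borel (\<lambda>(a, b). slice i a b)"
proof (rule lborel_eqI)
  fix l u :: "real^2" assume le: "\<And>b. b \<in> Basis \<Longrightarrow> l \<bullet> b \<le> u \<bullet> b"
  have le': "l $ 1 \<le> u $ 1" "l $ 2 \<le> u $ 2" using le[of "axis 1 1"] le[of "axis 2 1"] by (simp_all add: Basis_real2 inner_axis)
  define k :: 2 where "k = (if i = 1 then 2 else 1)"
  have ex: "i = 1 \<and> k = 2 \<or> i = 2 \<and> k = 1" using exhaust_2[of i] by (auto simp: k_def)
  have "(\<lambda>(a, b). slice i a b) -` box l u = {l $ i<..<u $ i} \<times> {l $ k<..<u $ k}"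
    using ex by (auto simp: mem_box_cart forall_2 slice_nth)
  then have "emeasure (distr (lborel \<Otimes>\<^sub>M lborel) borel (\<lambda>(a, b). slice i a b)) (box l u)
     = emeasure (lborel \<Otimes>\<^sub>M lborel) ({l $ i<..<u $ i} \<times> {l $ k<..<u $ k})"
    by (subst emeasure_distr[OF slice_measurable]) (auto simp: space_pair_measure)
  also have "\<dots> = emeasure lborel {l $ i<..<u $ i} * emeasure lborel {l $ k<..<u $ k}"
    by (rule lborel.emeasure_pair_measure_Times) auto
  also have "\<dots> = (\<Prod>b\<in>Basis. (u - l) \<bullet> b)"
  proof -
    have "(\<Prod>b\<in>Basis. (u - l) \<bullet> b) = (u $ 1 - l $ 1) * (u $ 2 - l $ 2)"
      unfolding Basis_real2 by (subst prod.insert) (auto simp: inner_axis axis_eq_axis)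
    then show ?thesis using ex le' by (auto simp: ennreal_mult[symmetric] mult.commute)
  qed
  finally show "emeasure (distr (lborel \<Otimes>\<^sub>M lborel) borel (\<lambda>(a, b). slice i a b)) (box l u) = (\<Prod>b\<in>Basis. (u - l) \<bullet> b)" .
qed simp

lemma integrable_slice_iff:
  fixes f :: "real^2 \<Rightarrow> real"
  assumes "f \<in> borel_measurable borel"
  shows "integrable lborel f \<longleftrightarrow> integrable (lborel \<Otimes>\<^sub>M lborel) (\<lambda>(a, b). f (slice i a b))"
  by (subst lborel_slice[of i], subst integrable_distr_eq[OF slice_measurable]) (use assms in \<open>simp_all add: split_beta'\<close>)

lemma integral_slice:
  fixes f :: "real^2 \<Rightarrow> real"
  assumes "f \<in> borel_measurable borel"
  shows "integral\<^sup>L lborel f = (\<integral>(a, b). f (slice i a b) \<partial>(lborel \<Otimes>\<^sub>M lborel))"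
  by (subst lborel_slice[of i], subst integral_distr[OF slice_measurable]) (use assms in \<open>simp_all add: split_beta'\<close>)

definition off_axes :: "(real^2) set" where "off_axes = {x. x $ 1 \<noteq> 0 \<and> x $ 2 \<noteq> 0}"

lemma slice_off_axes: "slice i a b \<in> off_axes \<longleftrightarrow> a \<noteq> 0 \<and> b \<noteq> 0"
  using exhaust_2[of i] by (auto simp: off_axes_def slice_nth)

lemma open_off_axes: "open off_axes"
proof -
  have e: "off_axes = {x. x $ 1 \<noteq> 0} \<inter> {x. x $ 2 \<noteq> 0}" by (auto simp: off_axes_def)
  have o: "open {x :: real^2. x $ i \<noteq> 0}" for i by (intro open_Collect_neq continuous_intros)
  show ?thesis unfolding e by (rule open_Int[OF o o])
qed

lemma AE_off_axes: "AE x in lborel. x \<in> off_axes"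
proof -
  have "AE x in lborel. (x::real^2) $ i \<noteq> 0" for i
  proof -
    have "{x :: real^2. x $ i = 0} = {x. axis i 1 \<bullet> x = 0}" by (simp add: inner_axis' )
    then have "negligible {x :: real^2. x $ i = 0}" using negligible_hyperplane[of "axis i (1::real)" 0] by (simp add: axis_eq_0_iff)
    moreover have "closed {x :: real^2. x $ i = 0}" by (intro closed_Collect_eq continuous_intros)
    ultimately have "{x :: real^2. x $ i = 0} \<in> null_sets lborel"
      by (simp add: negligible_iff_null_sets null_sets_completion_iff borel_closed)
    then show ?thesis by (rule AE_I') auto
  qed
  from this[of 1] this[of 2] show ?thesis by eventually_elim (simp add: off_axes_def)
qed

lemma off_axes_measurable:
  fixes f :: "real^2 \<Rightarrow> real"
  assumes "continuous_on off_axes f" "\<And>x. x \<notin> off_axes \<Longrightarrow> f x = 0"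
  shows "f \<in> borel_measurable borel"
proof -
  have "(\<lambda>x. indicator off_axes x *\<^sub>R f x) \<in> borel_measurable borel"
    using open_off_axes assms(1) by (intro borel_measurable_continuous_on_indicator) auto
  moreover have "(\<lambda>x. indicator off_axes x *\<^sub>R f x) = f" using assms(2) by (auto simp: fun_eq_iff indicator_def)
  ultimately show ?thesis by simp
qed

text \<open>Fubini and the fundamental theorem of calculus on the lines parallel to the \<open>i\<close>-th axis. Such a
  line, unless it is that axis, meets the singular set in a single point, where continuity of \<open>F\<close> is
  enough. A section that is not integrable has integral 0 by convention, like all the others.\<close>

lemma integral_line_derivative_zero:
  fixes F g :: "real^2 \<Rightarrow> real"
  assumes int: "integrable lborel g"
    and cont: "\<And>b. b \<noteq> 0 \<Longrightarrow> continuous_on UNIV (\<lambda>a. F (slice i a b))"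
    and der: "\<And>a b. a \<noteq> 0 \<Longrightarrow> b \<noteq> 0 \<Longrightarrow> ((\<lambda>a. F (slice i a b)) has_real_derivative g (slice i a b)) (at a)"
    and supp: "\<And>x. \<bar>x $ i\<bar> \<ge> M \<Longrightarrow> F x = 0" and M: "M > 0"
  shows "integral\<^sup>L lborel g = 0"
proof -
  have gm: "g \<in> borel_measurable borel" using int by (simp add: borel_measurable_integrable)
  have "(\<integral>a. g (slice i a b) \<partial>lborel) = 0" if b: "b \<noteq> 0" for b
  proof (cases "integrable lborel (\<lambda>a. g (slice i a b))")
    case True
    then have 1: "((\<lambda>a. g (slice i a b)) has_integral (\<integral>a. g (slice i a b) \<partial>lborel)) UNIV"
      by (rule has_integral_integral_lborel)
    have "((\<lambda>a. g (slice i a b)) has_integral (F (slice i M b) - F (slice i (-M) b))) {-M..M}"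
    proof (rule fundamental_theorem_of_calculus_interior_strong[of "{0}"])
      show "continuous_on {-M..M} (\<lambda>a. F (slice i a b))" using cont[OF b] continuous_on_subset by blast
      show "((\<lambda>a. F (slice i a b)) has_vector_derivative g (slice i a b)) (at a)" if "a \<in> {-M<..<M} - {0}" for a
        using der[of a b] that b by (simp add: has_real_derivative_iff_has_vector_derivative)
    qed (use M in auto)
    moreover have "F (slice i M b) = 0" "F (slice i (-M) b) = 0" using supp M by (auto simp: slice_nth)
    ultimately have "((\<lambda>a. g (slice i a b)) has_integral 0) {-M..M}" by simp
    then have "((\<lambda>a. if a \<in> {-M..M} then g (slice i a b) else 0) has_integral 0) UNIV"
      by (simp only: has_integral_restrict_UNIV)
    moreover have "(if a \<in> {-M..M} then g (slice i a b) else 0) = g (slice i a b)" for a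
    proof (cases "a \<in> {-M..M}")
      case False
      then have a: "\<bar>a\<bar> > M" by auto
      have "open {a. \<bar>a\<bar> > M}" by (intro open_Collect_less continuous_intros)
      then have ev: "\<forall>\<^sub>F a' in nhds a. \<bar>a'\<bar> > M" using a by (intro eventually_nhds_in_open[where s="{a. \<bar>a\<bar> > M}", simplified])
      then have ev': "\<forall>\<^sub>F a' in nhds a. F (slice i a' b) = 0" by eventually_elim (auto intro!: supp simp: slice_nth)
      have "((\<lambda>a. F (slice i a b)) has_real_derivative 0) (at a)"
        using DERIV_cong_ev[OF refl ev' refl, of 0] by simp
      moreover have "((\<lambda>a. F (slice i a b)) has_real_derivative g (slice i a b)) (at a)" using der[of a b] a b M by auto
      ultimately have "g (slice i a b) = 0" using DERIV_unique by blast
      then show ?thesis by simp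
    qed simp
    ultimately have "((\<lambda>a. g (slice i a b)) has_integral 0) UNIV" by simp
    then show ?thesis using 1 has_integral_unique by blast
  qed (simp add: not_integrable_integral_eq)
  then have z: "AE b in lborel. (\<integral>a. g (slice i a b) \<partial>lborel) = 0"
    using AE_lborel_singleton[of "0::real"] by (auto elim: eventually_mono)
  have int': "integrable (lborel \<Otimes>\<^sub>M lborel) (\<lambda>(a, b). g (slice i a b))"
    using integrable_slice_iff[OF gm] int by blast
  have "integral\<^sup>L lborel g = (\<integral>b. (\<integral>a. g (slice i a b) \<partial>lborel) \<partial>lborel)"
    unfolding integral_slice[OF gm, of i] using lborel_pair.integral_snd[OF int'] by simp
  also have "\<dots> = (\<integral>b. 0 \<partial>(lborel :: real measure))"
    by (rule Bochner_Integration.integral_cong_AE[OF borel_measurable_integrable[OF lborel_pair.integrable_snd[OF int']] _ z]) simp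
  finally show ?thesis by simp
qed

text \<open>The local majorant of all second derivatives: the profile to be constructed vanishes exactly on
  the axes, and there its vorticity blows up like the power \<open>-\<beta>\<close> of the distance.\<close>

definition sing :: "real \<Rightarrow> real^2 \<Rightarrow> real" where
  "sing \<beta> x = \<bar>x $ 1\<bar> powr (-\<beta>) * \<bar>x $ 2\<bar> powr (-\<beta>)"

text \<open>The exponent exceeds \<open>-1\<close>, and the two half-lines are mirror images.\<close>

lemma integrable_powr_box:
  assumes "\<beta> < 1" "M > 0"
  shows "integrable lborel (\<lambda>a::real. indicator {-M..M} a * \<bar>a\<bar> powr (-\<beta>))"
proof -
  define h where "h a = indicator {0<..M} a * a powr (-\<beta>)" for a :: real
  have hm: "h \<in> borel_measurable borel" unfolding h_def by measurable
  have "(\<lambda>x. x powr (-\<beta>)) integrable_on {0<..M}" using assms by (intro integrable_on_powr_from_0') auto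
  then obtain I where I: "((\<lambda>x. x powr (-\<beta>)) has_integral I) {0<..M}" by blast
  have "(\<integral>\<^sup>+x. ennreal (h x) \<partial>lborel) = I"
    unfolding h_def using nn_integral_has_integral_lebesgue[OF _ I] by simp
  then have hi: "integrable lborel h"
    using hm by (intro integrableI_bounded) (auto simp: h_def abs_mult less_top)
  have "integrable lborel (\<lambda>a. h (0 + (-1) * a))" using lborel_integrable_real_affine[OF hi, of "-1" 0] by simp
  then have "integrable lborel (\<lambda>a. h a + h (- a))" using hi by simp
  moreover have "h a + h (- a) = indicator {-M..M} a * \<bar>a\<bar> powr (-\<beta>)" for a
    by (auto simp: h_def indicator_def)
  ultimately show ?thesis by simp
qed

lemma sing_continuous: "continuous_on off_axes (sing \<beta>)"
  unfolding sing_def by (intro continuous_intros) (auto simp: off_axes_def)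
lemma sing_nonneg: "sing \<beta> x \<ge> 0" by (simp add: sing_def)
lemma sing_on_axes: "x \<notin> off_axes \<Longrightarrow> sing \<beta> x = 0" by (auto simp: sing_def off_axes_def)
lemma sing_measurable: "sing \<beta> \<in> borel_measurable borel"
  by (intro off_axes_measurable sing_continuous sing_on_axes)
lemma sing_slice: "sing \<beta> (slice i a b) = \<bar>a\<bar> powr (-\<beta>) * \<bar>b\<bar> powr (-\<beta>)"
  using exhaust_2[of i] by (auto simp: sing_def slice_nth)

lemma sing_integrable:
  assumes "\<beta> < 1" "M > 0"
  shows "integrable lborel (\<lambda>x. indicator (cball 0 M) x * sing \<beta> x)"
proof (rule Bochner_Integration.integrable_bound)
  let ?h = "\<lambda>a::real. indicator {-M..M} a * \<bar>a\<bar> powr (-\<beta>)"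
  define f where "f x = ?h (x $ 1) * ?h (x $ 2)" for x :: "real^2"
  have fm: "f \<in> borel_measurable borel" unfolding f_def by measurable
  have e: "(\<lambda>(a, b). f (slice 1 a b)) = (\<lambda>p. ?h (fst p) * ?h (snd p))" by (auto simp: f_def slice_nth)
  have "integrable (lborel \<Otimes>\<^sub>M lborel) (\<lambda>p. ?h (fst p) * ?h (snd p))"
  proof (rule lborel_pair.Fubini_integrable)
    show "integrable lborel (\<lambda>x. LBINT y. norm (?h (fst (x, y)) * ?h (snd (x, y))))"
      using integrable_powr_box[OF assms] by (simp add: abs_mult integrable_mult_left)
    show "AE x in lborel. integrable lborel (\<lambda>y. ?h (fst (x, y)) * ?h (snd (x, y)))"
      using integrable_powr_box[OF assms] by (simp add: integrable_mult_right)
  qed measurable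
  then show "integrable lborel f" unfolding integrable_slice_iff[OF fm, of 1] e .
  show "AE x in lborel. norm (indicat_real (cball 0 M) x * sing \<beta> x) \<le> norm (f x)"
  proof (intro AE_I2)
    fix x :: "real^2"
    show "norm (indicat_real (cball 0 M) x * sing \<beta> x) \<le> norm (f x)"
    proof (cases "x \<in> cball 0 M")
      case True
      then have "\<bar>x $ i\<bar> \<le> M" for i using component_le_norm_cart[of x i] by simp
      then have "x $ i \<in> {-M..M}" for i by (simp add: abs_le_iff) (metis minus_le_iff)
      then show ?thesis using True by (simp add: f_def sing_def)
    qed simp
  qed
  show "(\<lambda>x. indicat_real (cball 0 M) x * sing \<beta> x) \<in> borel_measurable lborel"
    using sing_measurable[of \<beta>] by (intro borel_measurable_times borel_measurable_indicator) auto
qed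

lemma integrable_sing_bound:
  fixes f :: "real^2 \<Rightarrow> real"
  assumes \<beta>: "\<beta> < 1" and M: "M > 0" and fm: "f \<in> borel_measurable borel"
    and bound: "\<And>x. x \<in> off_axes \<Longrightarrow> norm x \<le> M \<Longrightarrow> \<bar>f x\<bar> \<le> C * sing \<beta> x"
    and supp: "\<And>x. norm x > M \<Longrightarrow> f x = 0"
  shows "integrable lborel f"
proof (rule Bochner_Integration.integrable_bound)
  show "integrable lborel (\<lambda>x. C * (indicator (cball 0 M) x * sing \<beta> x))"
    using sing_integrable[OF \<beta> M] by simp
  show "AE x in lborel. norm (f x) \<le> norm (C * (indicat_real (cball 0 M) x * sing \<beta> x))"
    using AE_off_axes
  proof eventually_elim
    case (elim x)
    show ?case
    proof (cases "norm x \<le> M")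
      case True
      then have "\<bar>f x\<bar> \<le> C * sing \<beta> x" using bound elim by auto
      then show ?thesis using True by simp
    qed (use supp in auto)
  qed
qed (use fm in simp)

lemma line_derivative:
  assumes "f differentiable (at (slice i a b))"
  shows "((\<lambda>a. f (slice i a b)) has_real_derivative grad f (slice i a b) $ i) (at a)"
proof -
  obtain f' where f': "(f has_derivative f') (at (slice i a b))" using assms by (auto simp: differentiable_def)
  interpret f': bounded_linear f' using f' by (rule has_derivative_bounded_linear)
  have 1: "((\<lambda>h. slice i a b + (h - a) *\<^sub>R axis i 1) has_derivative (\<lambda>h. h *\<^sub>R axis i 1)) (at a)"
    by (auto intro!: derivative_eq_intros)
  have "((\<lambda>h. f (slice i a b + (h - a) *\<^sub>R axis i 1)) has_derivative (\<lambda>h. f' (h *\<^sub>R axis i 1))) (at a)"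
    using has_derivative_compose[OF 1, of f f'] f' by simp
  moreover have "slice i a b + (h - a) *\<^sub>R axis i 1 = slice i h b" for h
    using slice_line[of i a "h - a" b] by simp
  ultimately have "((\<lambda>h. f (slice i h b)) has_derivative (\<lambda>h. f' (h *\<^sub>R axis i 1))) (at a)" by simp
  then show ?thesis by (simp add: has_field_derivative_def f'.scaleR mult_commute_abs grad_eqI[OF f'])
qed

text \<open>What integration by parts in the \<open>i\<close>-th direction asks of a test function. Test functions and their
  first partial derivatives have it.\<close>

definition cutoff :: "real \<Rightarrow> 2 \<Rightarrow> (real^2 \<Rightarrow> real) \<Rightarrow> bool" where
  "cutoff M i \<phi> \<longleftrightarrow> M > 0 \<and> (\<forall>x. \<phi> differentiable (at x)) \<and> continuous_on UNIV (\<lambda>x. grad \<phi> x $ i) \<and>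
     (\<forall>x. norm x \<ge> M \<longrightarrow> \<phi> x = 0 \<and> grad \<phi> x $ i = 0)"

text \<open>The axes are cut out because the pointwise derivative \<open>g\<close> makes sense only off them. They form a null
  set.\<close>

definition weak_partial :: "2 \<Rightarrow> (real^2 \<Rightarrow> real) \<Rightarrow> (real^2 \<Rightarrow> real) \<Rightarrow> (real^2 \<Rightarrow> real) \<Rightarrow> bool" where
  "weak_partial i f g \<phi> \<longleftrightarrow>
     integrable lborel (\<lambda>x. indicator off_axes x * (f x * grad \<phi> x $ i)) \<and>
     integrable lborel (\<lambda>x. indicator off_axes x * (g x * \<phi> x)) \<and>
     (\<integral>x. indicator off_axes x * (f x * grad \<phi> x $ i) \<partial>lborel) = - (\<integral>x. indicator off_axes x * (g x * \<phi> x) \<partial>lborel)"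

lemma weak_partialD:
  assumes "weak_partial i f g \<phi>"
  shows "integrable lborel (\<lambda>x. indicator off_axes x * (f x * grad \<phi> x $ i))"
    and "integrable lborel (\<lambda>x. indicator off_axes x * (g x * \<phi> x))"
    and "(\<integral>x. indicator off_axes x * (f x * grad \<phi> x $ i) \<partial>lborel) = - (\<integral>x. indicator off_axes x * (g x * \<phi> x) \<partial>lborel)"
  using assms by (auto simp: weak_partial_def)

lemma weak_partial_cong:
  assumes "weak_partial i f g \<phi>" "\<And>x. x \<in> off_axes \<Longrightarrow> g x = g' x"
  shows "weak_partial i f g' \<phi>"
proof -
  have "(\<lambda>x. indicator off_axes x * (g x * \<phi> x)) = (\<lambda>x. indicator off_axes x * (g' x * \<phi> x) :: real)"
    using assms(2) by (auto simp: fun_eq_iff indicator_def)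
  then show ?thesis using assms(1) unfolding weak_partial_def by metis
qed

text \<open>The product of \<open>f\<close> and \<open>\<phi>\<close> vanishes at the ends of every line and is continuous along it.\<close>

lemma integration_by_parts:
  fixes f \<phi> :: "real^2 \<Rightarrow> real"
  assumes \<beta>: "\<beta> < 1" and cut: "cutoff M i \<phi>"
    and f: "\<And>x. x \<in> off_axes \<Longrightarrow> f differentiable (at x)" "continuous_on off_axes (\<lambda>x. grad f x $ i)"
      "\<And>b. b \<noteq> 0 \<Longrightarrow> continuous_on UNIV (\<lambda>a. f (slice i a b))"
      "\<And>x. x \<in> off_axes \<Longrightarrow> norm x \<le> M \<Longrightarrow> \<bar>f x\<bar> \<le> C * sing \<beta> x"
      "\<And>x. x \<in> off_axes \<Longrightarrow> norm x \<le> M \<Longrightarrow> \<bar>grad f x $ i\<bar> \<le> C * sing \<beta> x"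
  shows "weak_partial i f (\<lambda>x. grad f x $ i) \<phi>"
proof -
  have M: "M > 0" and \<phi>: "\<And>x. \<phi> differentiable (at x)" "continuous_on UNIV (\<lambda>x. grad \<phi> x $ i)"
    "\<And>x. norm x \<ge> M \<Longrightarrow> \<phi> x = 0" "\<And>x. norm x \<ge> M \<Longrightarrow> grad \<phi> x $ i = 0"
    using cut unfolding cutoff_def by auto
  have fc: "continuous_on off_axes f"
    using f(1) by (intro continuous_at_imp_continuous_on) (auto intro: differentiable_imp_continuous_within)
  have \<phi>c: "continuous_on A \<phi>" for A
    using \<phi>(1) by (intro continuous_at_imp_continuous_on) (auto intro: differentiable_imp_continuous_within)
  have bdd: "\<exists>D\<ge>0. \<forall>x\<in>cball 0 M. \<bar>h x\<bar> \<le> D" if "continuous_on UNIV h" for h :: "real^2 \<Rightarrow> real"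
  proof -
    have "compact (h ` cball 0 M)" using that by (intro compact_continuous_image) (auto intro: continuous_on_subset)
    then obtain D where D: "\<forall>y\<in>h ` cball 0 M. norm y \<le> D" using compact_imp_bounded bounded_iff by blast
    show ?thesis by (intro exI[of _ "max D 0"]) (use D in auto)
  qed
  obtain D1 where D1: "D1 \<ge> 0" "\<And>x. norm x \<le> M \<Longrightarrow> \<bar>\<phi> x\<bar> \<le> D1" using bdd[OF \<phi>c] by auto
  obtain D2 where D2: "D2 \<ge> 0" "\<And>x. norm x \<le> M \<Longrightarrow> \<bar>grad \<phi> x $ i\<bar> \<le> D2" using bdd[OF \<phi>(2)] by auto
  have i1: "integrable lborel (\<lambda>x. indicator off_axes x * (f x * grad \<phi> x $ i))"
  proof (rule integrable_sing_bound[OF \<beta> M, where C="C * D2"])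
    have "continuous_on off_axes (\<lambda>x. f x * grad \<phi> x $ i)"
      by (intro continuous_intros fc continuous_on_subset[OF \<phi>(2)]) auto
    from borel_measurable_continuous_on_indicator[OF borel_open[OF open_off_axes] this]
    show "(\<lambda>x. indicator off_axes x * (f x * grad \<phi> x $ i)) \<in> borel_measurable borel" by simp
    fix x assume x: "x \<in> off_axes" "norm x \<le> M"
    have "\<bar>f x\<bar> * \<bar>grad \<phi> x $ i\<bar> \<le> (C * sing \<beta> x) * D2" using f(4)[OF x] D2(2)[OF x(2)] by (intro mult_mono) auto
    then show "\<bar>indicator off_axes x * (f x * grad \<phi> x $ i)\<bar> \<le> C * D2 * sing \<beta> x" using x by (simp add: abs_mult mult_ac)
  qed (use \<phi>(4) in auto)
  have i2: "integrable lborel (\<lambda>x. indicator off_axes x * (grad f x $ i * \<phi> x))"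
  proof (rule integrable_sing_bound[OF \<beta> M, where C="C * D1"])
    have "continuous_on off_axes (\<lambda>x. grad f x $ i * \<phi> x)" by (intro continuous_intros f(2) \<phi>c)
    from borel_measurable_continuous_on_indicator[OF borel_open[OF open_off_axes] this]
    show "(\<lambda>x. indicator off_axes x * (grad f x $ i * \<phi> x)) \<in> borel_measurable borel" by simp
    fix x assume x: "x \<in> off_axes" "norm x \<le> M"
    have "\<bar>grad f x $ i\<bar> * \<bar>\<phi> x\<bar> \<le> (C * sing \<beta> x) * D1" using f(5)[OF x] D1(2)[OF x(2)] by (intro mult_mono) auto
    then show "\<bar>indicator off_axes x * (grad f x $ i * \<phi> x)\<bar> \<le> C * D1 * sing \<beta> x" using x by (simp add: abs_mult mult_ac)
  qed (use \<phi>(3) in auto)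
  have "(\<integral>x. indicator off_axes x * (f x * grad \<phi> x $ i) + indicator off_axes x * (grad f x $ i * \<phi> x) \<partial>lborel) = 0"
  proof (rule integral_line_derivative_zero[where F="\<lambda>x. f x * \<phi> x" and i=i and M=M])
    fix b :: real assume b: "b \<noteq> 0"
    show "continuous_on UNIV (\<lambda>a. f (slice i a b) * \<phi> (slice i a b))"
      by (intro continuous_intros f(3)[OF b] continuous_on_compose2[OF \<phi>c[of UNIV]] slice_continuous) auto
    fix a :: real assume a: "a \<noteq> 0"
    have o: "slice i a b \<in> off_axes" using a b by (simp add: slice_off_axes)
    show "((\<lambda>a. f (slice i a b) * \<phi> (slice i a b)) has_real_derivative
      indicator off_axes (slice i a b) * (f (slice i a b) * grad \<phi> (slice i a b) $ i) + indicator off_axes (slice i a b) * (grad f (slice i a b) $ i * \<phi> (slice i a b))) (at a)"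
      using DERIV_mult[OF line_derivative[OF f(1)[OF o]] line_derivative[OF \<phi>(1)]] o by (simp add: algebra_simps)
  next
    fix x :: "real^2" assume "M \<le> \<bar>x $ i\<bar>"
    then have "norm x \<ge> M" using component_le_norm_cart[of x i] by linarith
    then show "f x * \<phi> x = 0" using \<phi>(3) by simp
  qed (use i1 i2 M in auto)
  then show ?thesis
    using i1 i2 by (simp add: weak_partial_def Bochner_Integration.integral_add)
qed

section \<open>Test functions\<close>

lemma slice_swap: "i \<noteq> j \<Longrightarrow> slice i a b = slice (j::2) b a"
  using exhaust_2[of i] exhaust_2[of j] by (auto simp: vec_eq_iff slice_nth forall_2)

text \<open>Two applications of the mean value theorem. The left side is symmetric in the coordinates, and
  comparing the two orders of differentiation gives the symmetry of mixed derivatives.\<close>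

lemma second_difference:
  assumes \<phi>: "\<And>x. \<phi> differentiable (at x)" "\<And>x i. (\<lambda>y. grad \<phi> y $ i) differentiable (at x)"
    and ij: "i \<noteq> (j::2)" and h: "h > 0"
  obtains \<xi> \<eta> where "a < \<xi>" "\<xi> < a + h" "b < \<eta>" "\<eta> < b + h"
    "\<phi> (slice i (a + h) (b + h)) - \<phi> (slice i (a + h) b) - \<phi> (slice i a (b + h)) + \<phi> (slice i a b)
       = h * h * grad (\<lambda>y. grad \<phi> y $ i) (slice i \<xi> \<eta>) $ j"
proof -
  define g where "g a = \<phi> (slice i a (b + h)) - \<phi> (slice i a b)" for a
  have gd: "(g has_real_derivative grad \<phi> (slice i a (b + h)) $ i - grad \<phi> (slice i a b) $ i) (at a)" for a
    unfolding g_def by (intro DERIV_diff line_derivative \<phi>)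
  obtain \<xi> where \<xi>: "a < \<xi>" "\<xi> < a + h" "g (a + h) - g a = (a + h - a) * (grad \<phi> (slice i \<xi> (b + h)) $ i - grad \<phi> (slice i \<xi> b) $ i)"
    using MVT2[of a "a + h" g, OF _ gd] h by auto
  have kd: "((\<lambda>b. grad \<phi> (slice i \<xi> b) $ i) has_real_derivative grad (\<lambda>y. grad \<phi> y $ i) (slice i \<xi> b) $ j) (at b)" for b
    using line_derivative[of "\<lambda>y. grad \<phi> y $ i" j b \<xi>, OF \<phi>(2)] slice_swap[OF ij] by simp
  obtain \<eta> where \<eta>: "b < \<eta>" "\<eta> < b + h" "grad \<phi> (slice i \<xi> (b + h)) $ i - grad \<phi> (slice i \<xi> b) $ i = (b + h - b) * grad (\<lambda>y. grad \<phi> y $ i) (slice i \<xi> \<eta>) $ j"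
    using MVT2[of b "b + h" "\<lambda>b. grad \<phi> (slice i \<xi> b) $ i", OF _ kd] h by auto
  show ?thesis using that[OF \<xi>(1,2) \<eta>(1,2)] \<xi>(3) \<eta>(3) by (simp add: g_def)
qed

lemma mixed_partials:
  assumes "test_function \<phi>"
  shows "grad (\<lambda>y. grad \<phi> y $ 1) x $ 2 = grad (\<lambda>y. grad \<phi> y $ 2) x $ 1"
proof (rule ccontr)
  let ?A = "\<lambda>x. grad (\<lambda>y. grad \<phi> y $ 1) x $ 2" and ?B = "\<lambda>x. grad (\<lambda>y. grad \<phi> y $ 2) x $ 1"
  assume ne: "?A x \<noteq> ?B x"
  define e where "e = \<bar>?A x - ?B x\<bar> / 2"
  have e: "e > 0" using ne by (simp add: e_def)
  have \<phi>: "\<And>x. \<phi> differentiable (at x)" "\<And>x i. (\<lambda>y. grad \<phi> y $ i) differentiable (at x)"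
    "\<And>i. continuous_on UNIV (grad (\<lambda>y. grad \<phi> y $ i))" using assms by (auto simp: test_function_def)
  have cont: "\<exists>d>0. \<forall>y. dist y x < d \<longrightarrow> \<bar>grad (\<lambda>y. grad \<phi> y $ i) y $ j - grad (\<lambda>y. grad \<phi> y $ i) x $ j\<bar> < e" for i j
  proof -
    have "continuous_on UNIV (\<lambda>x. grad (\<lambda>y. grad \<phi> y $ i) x $ j)" by (intro continuous_intros \<phi>(3))
    then have "isCont (\<lambda>x. grad (\<lambda>y. grad \<phi> y $ i) x $ j) x" by (simp add: continuous_on_eq_continuous_at)
    then show ?thesis unfolding continuous_at_eps_delta using e by (auto simp: dist_real_def)
  qed
  obtain d1 where d1: "d1 > 0" "\<And>y. dist y x < d1 \<Longrightarrow> \<bar>?A y - ?A x\<bar> < e" using cont[of 1 2] by auto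
  obtain d2 where d2: "d2 > 0" "\<And>y. dist y x < d2 \<Longrightarrow> \<bar>?B y - ?B x\<bar> < e" using cont[of 2 1] by auto
  define h where "h = min d1 d2 / 2"
  have h: "h > 0" using d1(1) d2(1) by (simp add: h_def)
  have near: "dist (slice i \<xi> \<eta>) x < min d1 d2" if "i \<noteq> j" "x $ i < \<xi>" "\<xi> < x $ i + h" "x $ j < \<eta>" "\<eta> < x $ j + h" for i j \<xi> \<eta>
  proof -
    have "norm (slice i \<xi> \<eta> - x) \<le> (\<Sum>k\<in>UNIV. \<bar>(slice i \<xi> \<eta> - x) $ k\<bar>)" by (rule norm_le_l1_cart)
    also have "\<dots> < h + h" using that exhaust_2[of i] exhaust_2[of j] by (auto simp: sum_2 slice_nth abs_if)
    finally show ?thesis by (simp add: dist_norm h_def)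
  qed
  have "1 \<noteq> (2::2)" "2 \<noteq> (1::2)" by auto
  note s12 = second_difference[of \<phi>, OF \<phi>(1,2) this(1) h, of "x$1" "x$2"]
    and s21 = second_difference[of \<phi>, OF \<phi>(1,2) this(2) h, of "x$2" "x$1"]
  obtain \<xi> \<eta> where p: "x$1 < \<xi>" "\<xi> < x$1 + h" "x$2 < \<eta>" "\<eta> < x$2 + h"
    "\<phi> (slice 1 (x$1 + h) (x$2 + h)) - \<phi> (slice 1 (x$1 + h) (x$2)) - \<phi> (slice 1 (x$1) (x$2 + h)) + \<phi> (slice 1 (x$1) (x$2))
       = h * h * ?A (slice 1 \<xi> \<eta>)" using s12 by blast
  obtain \<xi>' \<eta>' where p': "x$2 < \<xi>'" "\<xi>' < x$2 + h" "x$1 < \<eta>'" "\<eta>' < x$1 + h"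
    "\<phi> (slice 2 (x$2 + h) (x$1 + h)) - \<phi> (slice 2 (x$2 + h) (x$1)) - \<phi> (slice 2 (x$2) (x$1 + h)) + \<phi> (slice 2 (x$2) (x$1))
       = h * h * ?B (slice 2 \<xi>' \<eta>')" using s21 by blast
  have sw: "slice 2 b a = slice 1 a b" for a b using slice_swap[of 2 1] by simp
  have "h * h * ?A (slice 1 \<xi> \<eta>) = h * h * ?B (slice 2 \<xi>' \<eta>')"
    unfolding p(5)[symmetric] p'(5)[symmetric] unfolding sw by simp
  then have eq: "?A (slice 1 \<xi> \<eta>) = ?B (slice 2 \<xi>' \<eta>')" using h by simp
  have "\<bar>?A (slice 1 \<xi> \<eta>) - ?A x\<bar> < e" using near[of 1 2, OF _ p(1-4)] by (intro d1(2)) simp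
  moreover have "\<bar>?B (slice 2 \<xi>' \<eta>') - ?B x\<bar> < e" using near[of 2 1, OF _ p'(1-4)] by (intro d2(2)) simp
  ultimately show False unfolding eq e_def by (auto simp: abs_if split: if_splits)
qed

lemma grad_zero_outside:
  assumes "\<And>x. norm x > M \<Longrightarrow> f x = (0::real)" "norm x > M"
  shows "grad f x $ i = 0"
proof -
  have o: "open {x::real^2. norm x > M}" by (intro open_Collect_less continuous_intros)
  have "\<forall>\<^sub>F y in nhds x. y \<in> {x. norm x > M}" by (rule eventually_nhds_in_open[OF o]) (simp add: assms(2))
  then have "\<forall>\<^sub>F y in nhds x. 0 = f y" by eventually_elim (simp add: assms(1))
  then have "\<forall>\<^sub>F y in at x. 0 = f y" unfolding eventually_at_filter by eventually_elim simp
  then have "(f has_derivative (\<lambda>_. 0)) (at x)"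
    by (rule has_derivative_transform_eventually[OF has_derivative_const]) (simp_all add: assms)
  from grad_eqI[OF this] show ?thesis by simp
qed

lemma test_function_grad_continuous:
  assumes "test_function \<phi>"
  shows "continuous_on A (\<lambda>x. grad \<phi> x $ i)" "continuous_on A \<phi>" "continuous_on A (\<lambda>x. grad (\<lambda>y. grad \<phi> y $ i) x $ j)"
proof -
  show "continuous_on A (\<lambda>x. grad \<phi> x $ i)" "continuous_on A \<phi>"
    using assms by (auto simp: test_function_def intro!: continuous_at_imp_continuous_on differentiable_imp_continuous_within)
  have "continuous_on UNIV (grad (\<lambda>y. grad \<phi> y $ i))" using assms by (simp add: test_function_def)
  then show "continuous_on A (\<lambda>x. grad (\<lambda>y. grad \<phi> y $ i) x $ j)"
    by (intro continuous_intros) (rule continuous_on_subset, auto)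
qed

lemma test_function_cutoff:
  assumes "test_function \<phi>"
  obtains M where "\<And>i. cutoff M i \<phi>" "\<And>i j. cutoff M i (\<lambda>y. grad \<phi> y $ j)"
proof -
  obtain M0 where M0: "\<And>x. \<phi> x \<noteq> 0 \<Longrightarrow> norm x \<le> M0" using assms by (auto simp: test_function_def bounded_iff)
  define N where "N = max M0 0"
  have 0: "\<phi> x = 0" if "norm x > N" for x using M0[of x] that by (force simp: N_def)
  have 1: "grad \<phi> x $ i = 0" if "norm x > N" for x i by (rule grad_zero_outside[of N \<phi>, OF 0 that])
  have 2: "grad (\<lambda>y. grad \<phi> y $ i) x $ j = 0" if "norm x > N" for x i j
    by (rule grad_zero_outside[of N, OF 1 that])
  have N: "N + 1 > 0" by (simp add: N_def add_nonneg_pos)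
  have d: "\<phi> differentiable (at x)" "(\<lambda>y. grad \<phi> y $ i) differentiable (at x)" for x i
    using assms by (auto simp: test_function_def)
  show ?thesis
    by (rule that[of "N + 1"])
      (auto simp: cutoff_def d intro: 0 1 2 N test_function_grad_continuous[OF assms])
qed

section \<open>The symmetric profile and its singular integrals\<close>

text \<open>The weak equations and the count of sinks need only these properties of the symmetric angular
  solution. The lower bound locates its zeros on the axes and turns the blow-up of the vorticity there
  into an integrable one.\<close>

locale solution = stream +
  fixes K q \<beta> :: real
  assumes K: "K > 0" and q_def: "q = (1 - \<alpha>) / (2 - \<alpha>)" and \<beta>_def: "\<beta> = \<alpha> / (2 - \<alpha>)"
    and \<psi>_odd: "\<psi> (- t) = - \<psi> t" and \<psi>_shift: "\<psi> (t + pi / 2) = - \<psi> t" and \<psi>'_shift: "\<psi>' (t + pi / 2) = - \<psi>' t"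
    and \<psi>_le_1: "\<bar>\<psi> t\<bar> \<le> 1" and \<psi>_lower: "\<bar>sin t * cos t\<bar> \<le> \<bar>\<psi> t\<bar>"
    and \<psi>'_0: "\<psi>' 0 > 0"
    and \<psi>_deriv2: "\<psi> t > 0 \<Longrightarrow> (\<psi>' has_real_derivative - ((2 - \<alpha>)\<^sup>2) * \<psi> t - K * q * \<psi> t powr (2 * q - 1)) (at t)"
begin

lemma q: "0 < q" "q < 1" and \<beta>: "0 < \<beta>" "\<beta> < 1" and q_\<beta>: "2 * q - 1 = - \<beta>" and \<beta>_l: "(2 - \<alpha>) * \<beta> = \<alpha>"
  and \<beta>_\<alpha>: "2 * \<beta> - \<alpha> > 0"
proof -
  have "2 * \<beta> - \<alpha> = \<alpha> * \<beta>" using \<alpha> by (simp add: \<beta>_def field_simps)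
  moreover show "0 < \<beta>" using \<alpha> by (simp add: \<beta>_def)
  ultimately show "2 * \<beta> - \<alpha> > 0" using \<alpha> by simp
  show "0 < q" "q < 1" "\<beta> < 1" "2 * q - 1 = - \<beta>" "(2 - \<alpha>) * \<beta> = \<alpha>"
    using \<alpha> by (simp_all add: q_def \<beta>_def field_simps)
qed

lemma \<psi>_pi: "periodic pi \<psi>" "periodic pi \<psi>'"
  unfolding periodic_def using \<psi>_shift \<psi>'_shift
  by (metis add.assoc field_sum_of_halves minus_minus)+

lemma \<psi>_multiple: "\<psi> (of_int n * (pi / 2)) = 0"
proof -
  have "periodic (pi / 2) (\<lambda>t. \<bar>\<psi> t\<bar>)" by (simp add: periodic_def \<psi>_shift)
  from periodic_int[OF this, of 0 n] have "\<bar>\<psi> (of_int n * (pi / 2))\<bar> = \<bar>\<psi> 0\<bar>" by (simp add: mult.commute)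
  moreover have "\<psi> 0 = 0" using \<psi>_odd[of 0] by simp
  ultimately show ?thesis by simp
qed

lemma \<psi>_zeroE:
  assumes "\<psi> t = 0" obtains n :: int where "t = of_int n * (pi / 2)"
proof -
  have "sin (2 * t) = 0" using \<psi>_lower[of t] assms by (simp add: sin_double)
  then obtain n :: int where "2 * t = of_int n * pi" using sin_zero_iff_int2 by blast
  then show ?thesis using that[of n] by (simp add: field_simps)
qed

lemma \<psi>_zero_iff: "\<psi> t = 0 \<longleftrightarrow> sin t * cos t = 0"
proof
  assume "sin t * cos t = 0"
  then have "sin (2 * t) = 0" by (simp add: sin_double)
  then obtain n :: int where "2 * t = of_int n * pi" using sin_zero_iff_int2 by blast
  then have "t = of_int n * (pi / 2)" by (simp add: field_simps)
  then show "\<psi> t = 0" by (metis \<psi>_multiple)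
qed (use \<psi>_lower[of t] in auto)

lemma off_axes_dir: "r *\<^sub>R dir t \<in> off_axes \<longleftrightarrow> r \<noteq> 0 \<and> \<psi> t \<noteq> 0"
  by (auto simp: off_axes_def \<psi>_zero_iff)

lemma stream_nonzero_iff: "\<Psi> x \<noteq> 0 \<longleftrightarrow> x \<in> off_axes"
proof -
  obtain r t where x: "r \<ge> 0" "x = r *\<^sub>R dir t" by (rule polarE)
  show ?thesis unfolding x(2) homog_dir[OF per x(1)] off_axes_dir using x(1) by auto
qed

lemma off_axesE:
  assumes "x \<in> off_axes" obtains r t where "r > 0" "x = r *\<^sub>R dir t" "\<psi> t \<noteq> 0" "norm x = r"
proof -
  obtain r t where x: "r \<ge> 0" "x = r *\<^sub>R dir t" by (rule polarE)
  then show ?thesis using that[of r t] assms by (auto simp: off_axes_dir)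
qed

definition "w t = - K * q * sgn (\<psi> t) * \<bar>\<psi> t\<bar> powr (- \<beta>)"
definition "\<psi>2 t = - ((2 - \<alpha>)\<^sup>2) * \<psi> t + w t"
definition "w' t = - \<beta> * \<psi>' t * w t / \<psi> t"
definition "\<Omega> = homog (- \<alpha>) w"

lemma per_w: "periodic (2*pi) w" "periodic (2*pi) w'" "periodic (2*pi) \<psi>2"
  using per per' by (auto simp: periodic_def w_def w'_def \<psi>2_def)

lemma deriv2: assumes "\<psi> t \<noteq> 0" shows "(\<psi>' has_real_derivative \<psi>2 t) (at t)"
proof -
  have pos: "(\<psi>' has_real_derivative \<psi>2 t) (at t)" if "\<psi> t > 0" for t
    using \<psi>_deriv2[OF that] that by (simp add: \<psi>2_def w_def q_\<beta>)
  show ?thesis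
  proof (cases "\<psi> t > 0")
    case False
    then have "\<psi> (t + pi / 2) > 0" using assms by (simp add: \<psi>_shift)
    from pos[OF this] have "(\<psi>' has_real_derivative - \<psi>2 t) (at (t + pi/2))"
      by (simp add: \<psi>2_def w_def \<psi>_shift sgn_minus add.commute)
    then have "((\<lambda>s. \<psi>' (s + pi/2)) has_real_derivative - \<psi>2 t) (at t)" by (simp add: DERIV_shift)
    then have "((\<lambda>s. - \<psi>' s) has_real_derivative - \<psi>2 t) (at t)" by (simp add: \<psi>'_shift)
    from DERIV_minus[OF this] show ?thesis by simp
  qed (use pos in simp)
qed

lemma \<psi>_isCont: "isCont \<psi> t" using deriv DERIV_isCont by blast

lemma sgn_\<psi>_const: assumes "\<psi> t \<noteq> 0" shows "\<forall>\<^sub>F s in nhds t. sgn (\<psi> s) = sgn (\<psi> t)"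
proof (cases "\<psi> t > 0")
  case True
  then have "\<forall>\<^sub>F s in nhds t. \<psi> s > 0"
    using \<psi>_isCont[of t] unfolding isCont_def tendsto_at_iff_tendsto_nhds by (simp add: order_tendstoD)
  then show ?thesis by eventually_elim (use True in simp)
next
  case False
  then have "\<psi> t < 0" using assms by simp
  then have "\<forall>\<^sub>F s in nhds t. \<psi> s < 0"
    using \<psi>_isCont[of t] unfolding isCont_def tendsto_at_iff_tendsto_nhds by (simp add: order_tendstoD)
  then show ?thesis by eventually_elim (use \<open>\<psi> t < 0\<close> in simp)
qed

lemma abs_\<psi>_deriv: assumes "\<psi> t \<noteq> 0" shows "((\<lambda>t. \<bar>\<psi> t\<bar>) has_real_derivative sgn (\<psi> t) * \<psi>' t) (at t)"
proof -
  have ev: "\<forall>\<^sub>F s in nhds t. sgn (\<psi> t) * \<psi> s = \<bar>\<psi> s\<bar>"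
    using sgn_\<psi>_const[OF assms] by eventually_elim (metis abs_sgn mult.commute)
  show ?thesis using iffD1[OF DERIV_cong_ev[OF refl ev refl] DERIV_cmult[OF deriv]] .
qed

lemma abs_powr_deriv:
  assumes "\<psi> t \<noteq> 0"
  shows "((\<lambda>t. \<bar>\<psi> t\<bar> powr p) has_real_derivative p * \<bar>\<psi> t\<bar> powr (p - 1) * (sgn (\<psi> t) * \<psi>' t)) (at t)"
  by (rule DERIV_chain2[where f="\<lambda>x. x powr p", OF has_real_derivative_powr abs_\<psi>_deriv]) (use assms in auto)

lemma w_deriv: assumes t: "\<psi> t \<noteq> 0" shows "(w has_real_derivative w' t) (at t)"
proof -
  have A: "((\<lambda>s. - K * q * sgn (\<psi> t) * \<bar>\<psi> s\<bar> powr (- \<beta>)) has_real_derivative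
     - K * q * sgn (\<psi> t) * (- \<beta> * \<bar>\<psi> t\<bar> powr (- \<beta> - 1) * (sgn (\<psi> t) * \<psi>' t))) (at t)"
    by (intro DERIV_cmult abs_powr_deriv t)
  have e: "- K * q * sgn (\<psi> t) * (- \<beta> * \<bar>\<psi> t\<bar> powr (- \<beta> - 1) * (sgn (\<psi> t) * \<psi>' t)) = w' t"
  proof -
    have "\<bar>\<psi> t\<bar> powr (- \<beta> - 1) = \<bar>\<psi> t\<bar> powr (- \<beta>) / (sgn (\<psi> t) * \<psi> t)"
      using t by (simp add: powr_diff sgn_if abs_if)
    then show ?thesis using t by (simp add: w'_def w_def sgn_if field_simps)
  qed
  have ev: "\<forall>\<^sub>F s in nhds t. - K * q * sgn (\<psi> t) * \<bar>\<psi> s\<bar> powr (- \<beta>) = w s"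
    using sgn_\<psi>_const[OF t] by eventually_elim (simp add: w_def)
  show ?thesis using iffD1[OF DERIV_cong_ev[OF refl ev refl] A] unfolding e .
qed

lemma w_isCont: "\<psi> t \<noteq> 0 \<Longrightarrow> isCont w t" using w_deriv DERIV_isCont by blast
lemma w'_isCont: "\<psi> t \<noteq> 0 \<Longrightarrow> isCont w' t"
  unfolding w'_def[abs_def] by (intro continuous_intros isCont' w_isCont \<psi>_isCont)
lemma \<psi>2_isCont: "\<psi> t \<noteq> 0 \<Longrightarrow> isCont \<psi>2 t"
  unfolding \<psi>2_def[abs_def] by (intro continuous_intros w_isCont \<psi>_isCont)

lemma abs_\<psi>_powr_ge_1: "\<psi> t \<noteq> 0 \<Longrightarrow> \<bar>\<psi> t\<bar> powr (- \<beta>) \<ge> 1"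
  using powr_mono2'[of "- \<beta>" "\<bar>\<psi> t\<bar>" 1] \<psi>_le_1[of t] \<beta> by simp

text \<open>The gain of a positive power of \<open>r\<close> comes from \<open>2 \<beta> > \<alpha>\<close>: near the origin the vorticity is less
  singular than the product majorant.\<close>

lemma majorant:
  assumes r: "0 < r" "r \<le> M" and t: "\<psi> t \<noteq> 0"
  shows "r powr (- \<alpha>) * \<bar>\<psi> t\<bar> powr (- \<beta>) \<le> M powr (2 * \<beta> - \<alpha>) * sing \<beta> (r *\<^sub>R dir t)"
proof -
  have sc: "sin t * cos t \<noteq> 0" using t by (simp add: \<psi>_zero_iff)
  have "\<bar>\<psi> t\<bar> powr (- \<beta>) \<le> \<bar>sin t * cos t\<bar> powr (- \<beta>)"
    using \<psi>_lower[of t] sc \<beta> by (intro powr_mono2') auto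
  then have 1: "r powr (- \<alpha>) * \<bar>\<psi> t\<bar> powr (- \<beta>) \<le> r powr (- \<alpha>) * \<bar>sin t * cos t\<bar> powr (- \<beta>)"
    by (intro mult_left_mono) auto
  have 2: "sing \<beta> (r *\<^sub>R dir t) = r powr (- 2 * \<beta>) * \<bar>sin t * cos t\<bar> powr (- \<beta>)"
    using r by (simp add: sing_def abs_mult powr_mult mult_ac flip: powr_add)
  have 3: "r powr (- \<alpha>) = r powr (2 * \<beta> - \<alpha>) * r powr (- 2 * \<beta>)" using r by (simp flip: powr_add)
  have "r powr (2 * \<beta> - \<alpha>) \<le> M powr (2 * \<beta> - \<alpha>)" using r \<beta>_\<alpha> by (intro powr_mono2) auto
  then have "r powr (2 * \<beta> - \<alpha>) * sing \<beta> (r *\<^sub>R dir t) \<le> M powr (2 * \<beta> - \<alpha>) * sing \<beta> (r *\<^sub>R dir t)"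
    by (intro mult_right_mono sing_nonneg)
  then show ?thesis using 1 unfolding 3 unfolding 2 by (simp add: mult_ac)
qed

text \<open>The angular factor of the \<open>i\<close>-th partial derivative of \<open>r\<^sup>\<mu> g(\<theta>)\<close> in terms of \<open>g\<close> and its derivative.\<close>

definition partial :: "real \<Rightarrow> (real \<Rightarrow> real) \<Rightarrow> (real \<Rightarrow> real) \<Rightarrow> 2 \<Rightarrow> real \<Rightarrow> real" where
  "partial \<mu> g g' i t = (if i = 1 then \<mu> * cos t * g t - sin t * g' t else \<mu> * sin t * g t + cos t * g' t)"

lemma homog_off_axes:
  assumes g: "periodic (2*pi) g" "periodic (2*pi) g'"
    and d: "\<And>t. \<psi> t \<noteq> 0 \<Longrightarrow> (g has_real_derivative g' t) (at t)"
    and c: "\<And>t. \<psi> t \<noteq> 0 \<Longrightarrow> isCont g' t"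
    and x: "x \<in> off_axes"
  shows "homog \<mu> g differentiable (at x)" "grad (homog \<mu> g) x $ i = homog (\<mu> - 1) (partial \<mu> g g' i) x"
    "isCont (homog (\<mu> - 1) (partial \<mu> g g' i)) x"
proof -
  obtain r t where r: "r > 0" "x = r *\<^sub>R dir t" "\<psi> t \<noteq> 0" using off_axesE[OF x] by metis
  have p: "periodic (2*pi) (partial \<mu> g g' i)" using g by (auto simp: periodic_def partial_def)
  show "homog \<mu> g differentiable (at x)"
    unfolding r(2) using homog_has_derivative[OF g(1) d[OF r(3)] r(1)] by (auto intro: differentiableI)
  show "grad (homog \<mu> g) x $ i = homog (\<mu> - 1) (partial \<mu> g g' i) x"
    unfolding r(2) grad_homog[OF g(1) d[OF r(3)] r(1)] homog_dir[OF p less_imp_le[OF r(1)]]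
    using exhaust_2[of i] by (auto simp: partial_def algebra_simps)
  have "isCont (partial \<mu> g g' i) t"
    using exhaust_2[of i] d[OF r(3), THEN DERIV_isCont] c[OF r(3)] unfolding partial_def
    by (auto intro!: continuous_intros)
  then show "isCont (homog (\<mu> - 1) (partial \<mu> g g' i)) x" unfolding r(2) by (intro homog_isCont p r)
qed

lemma homog_by_parts:
  assumes g: "periodic (2*pi) g" "periodic (2*pi) g'"
    and d: "\<And>t. \<psi> t \<noteq> 0 \<Longrightarrow> (g has_real_derivative g' t) (at t)"
    and c: "\<And>t. \<psi> t \<noteq> 0 \<Longrightarrow> isCont g' t"
    and \<mu>: "\<mu> \<ge> 1 - \<alpha>"
    and b: "\<And>t. \<psi> t \<noteq> 0 \<Longrightarrow> \<bar>g t\<bar> \<le> C * \<bar>\<psi> t\<bar> powr (- \<beta>)"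
      "\<And>t. \<psi> t \<noteq> 0 \<Longrightarrow> \<bar>partial \<mu> g g' i t\<bar> \<le> C * \<bar>\<psi> t\<bar> powr (- \<beta>)"
    and line: "\<And>b. b \<noteq> 0 \<Longrightarrow> continuous_on UNIV (\<lambda>a. homog \<mu> g (slice i a b))"
    and \<phi>: "cutoff M i \<phi>"
  shows "weak_partial i (homog \<mu> g) (homog (\<mu> - 1) (partial \<mu> g g' i)) \<phi>"
proof -
  have off: "homog \<mu> g differentiable (at x)" "grad (homog \<mu> g) x $ i = homog (\<mu> - 1) (partial \<mu> g g' i) x"
    "isCont (homog (\<mu> - 1) (partial \<mu> g g' i)) x" if "x \<in> off_axes" for x
    using homog_off_axes[OF g _ _ that] d c by blast+
  define N where "N = max (M powr (\<mu> + \<alpha>)) (M powr (\<mu> - 1 + \<alpha>))"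
  have N: "N \<ge> 0" unfolding N_def by (simp add: le_max_iff_disj)
  have Cpos: "C \<ge> 0"
  proof -
    have "\<psi> (pi / 4) \<noteq> 0" unfolding \<psi>_zero_iff by (simp add: sin_45 cos_45)
    then have "0 \<le> C * \<bar>\<psi> (pi / 4)\<bar> powr (- \<beta>)" "\<bar>\<psi> (pi / 4)\<bar> powr (- \<beta>) > 0" using b(1)[of "pi / 4"] by auto
    then show ?thesis by (simp add: zero_le_mult_iff)
  qed
  have bound: "\<bar>homog \<nu> k x\<bar> \<le> C * N * M powr (2 * \<beta> - \<alpha>) * sing \<beta> x"
    if k: "periodic (2*pi) k" "\<And>t. \<psi> t \<noteq> 0 \<Longrightarrow> \<bar>k t\<bar> \<le> C * \<bar>\<psi> t\<bar> powr (- \<beta>)" and \<nu>: "\<nu> = \<mu> \<or> \<nu> = \<mu> - 1"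
      and x: "x \<in> off_axes" "norm x \<le> M" for k x \<nu>
  proof -
    obtain r t where r: "r > 0" "x = r *\<^sub>R dir t" "\<psi> t \<noteq> 0" "norm x = r" using off_axesE[OF x(1)] by metis
    have rM: "r \<le> M" using r x by simp
    have "r powr (\<nu> + \<alpha>) \<le> M powr (\<nu> + \<alpha>)" using r rM \<nu> \<mu> \<alpha> by (intro powr_mono2) auto
    also have "\<dots> \<le> N" using \<nu> by (auto simp: N_def)
    finally have rN: "r powr (\<nu> + \<alpha>) \<le> N" .
    have "\<bar>homog \<nu> k x\<bar> = r powr (\<nu> + \<alpha>) * (r powr (- \<alpha>) * \<bar>k t\<bar>)"
      unfolding r(2) homog_dir[OF k(1) less_imp_le[OF r(1)]] using r(1) by (simp add: abs_mult flip: powr_add mult.assoc)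
    also have "\<dots> \<le> N * (r powr (- \<alpha>) * (C * \<bar>\<psi> t\<bar> powr (- \<beta>)))"
      using k(2)[OF r(3)] N by (intro mult_mono rN) auto
    also have "\<dots> = (C * N) * (r powr (- \<alpha>) * \<bar>\<psi> t\<bar> powr (- \<beta>))" by (simp add: mult_ac)
    also have "\<dots> \<le> (C * N) * (M powr (2 * \<beta> - \<alpha>) * sing \<beta> x)"
      unfolding r(2) using Cpos N by (intro mult_left_mono majorant r rM) auto
    finally show ?thesis by (simp add: mult_ac)
  qed
  have p: "periodic (2*pi) (partial \<mu> g g' i)" using g by (auto simp: periodic_def partial_def)
  have gc: "continuous_on off_axes (\<lambda>x. grad (homog \<mu> g) x $ i)"
  proof -
    have "continuous_on off_axes (homog (\<mu> - 1) (partial \<mu> g g' i))" using off(3) by (intro continuous_at_imp_continuous_on) auto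
    then show ?thesis by (rule continuous_on_eq) (simp add: off)
  qed
  have b1: "\<bar>homog \<mu> g x\<bar> \<le> C * N * M powr (2 * \<beta> - \<alpha>) * sing \<beta> x" if "x \<in> off_axes" "norm x \<le> M" for x
    by (rule bound[OF g(1) b(1) _ that]) auto
  have b2: "\<bar>grad (homog \<mu> g) x $ i\<bar> \<le> C * N * M powr (2 * \<beta> - \<alpha>) * sing \<beta> x" if "x \<in> off_axes" "norm x \<le> M" for x
    unfolding off(2)[OF that(1)] by (rule bound[OF p b(2) _ that]) auto
  show ?thesis
    by (rule weak_partial_cong[OF integration_by_parts[OF \<beta>(2) \<phi> off(1) gc line b1 b2]]) (simp_all add: off)
qed

end

lemma integral_off_axes:
  fixes f :: "real^2 \<Rightarrow> real"
  assumes "f \<in> borel_measurable borel"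
  shows "integral\<^sup>L lborel f = (\<integral>x. indicator off_axes x * f x \<partial>lborel)"
proof (rule Bochner_Integration.integral_cong_AE)
  show "AE x in lborel. f x = indicator off_axes x * f x" using AE_off_axes by eventually_elim simp
  have "off_axes \<in> sets borel" using open_off_axes by simp
  then show "(\<lambda>x. indicator off_axes x * f x) \<in> borel_measurable lborel"
    using assms by (intro borel_measurable_times borel_measurable_indicator) auto
qed (use assms in simp)

context solution begin

text \<open>Bounds on angular factors are assembled from the closure properties of these two classes rather
  than from explicit constants.\<close>

definition "bdd f \<longleftrightarrow> (\<exists>C\<ge>0. \<forall>t. \<bar>f t\<bar> \<le> (C::real))"
definition "maj f \<longleftrightarrow> (\<exists>C\<ge>0. \<forall>t. \<psi> t \<noteq> 0 \<longrightarrow> \<bar>f t\<bar> \<le> C * \<bar>\<psi> t\<bar> powr (- \<beta>))"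

lemma bdd_basic: "bdd (\<lambda>_. c)" "bdd (\<lambda>t. sin t)" "bdd (\<lambda>t. cos t)" "bdd \<psi>" "bdd \<psi>'"
proof -
  show "bdd (\<lambda>_. c)" unfolding bdd_def by (intro exI[of _ "\<bar>c\<bar>"]) auto
  show "bdd (\<lambda>t. sin t)" "bdd (\<lambda>t. cos t)" "bdd \<psi>" unfolding bdd_def using \<psi>_le_1 by (auto intro!: exI[of _ 1])
  obtain C where "\<And>t. \<bar>\<psi>' t\<bar> \<le> C" using periodic_bounded[OF per' _ cont'] by auto
  then show "bdd \<psi>'" unfolding bdd_def by (intro exI[of _ C]) (use abs_ge_zero order_trans in blast)
qed

lemma bdd_mult: "bdd f \<Longrightarrow> bdd g \<Longrightarrow> bdd (\<lambda>t. f t * g t)"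
  unfolding bdd_def
proof (elim exE conjE)
  fix C D :: real assume "0 \<le> C" "0 \<le> D" "\<forall>t. \<bar>f t\<bar> \<le> C" "\<forall>t. \<bar>g t\<bar> \<le> D"
  then show "\<exists>E\<ge>0. \<forall>t. \<bar>f t * g t\<bar> \<le> E" by (intro exI[of _ "C * D"]) (auto simp: abs_mult intro!: mult_mono)
qed

lemma maj_bdd: "bdd f \<Longrightarrow> maj f"
  unfolding bdd_def maj_def
proof (elim exE conjE)
  fix C :: real assume C: "0 \<le> C" "\<forall>t. \<bar>f t\<bar> \<le> C"
  have "\<bar>f t\<bar> \<le> C * \<bar>\<psi> t\<bar> powr (- \<beta>)" if "\<psi> t \<noteq> 0" for t
    using C mult_left_mono[OF abs_\<psi>_powr_ge_1[OF that] C(1)] by (auto intro: order_trans)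
  then show "\<exists>C\<ge>0. \<forall>t. \<psi> t \<noteq> 0 \<longrightarrow> \<bar>f t\<bar> \<le> C * \<bar>\<psi> t\<bar> powr (- \<beta>)" using C by blast
qed

lemma maj_mult: "bdd f \<Longrightarrow> maj g \<Longrightarrow> maj (\<lambda>t. f t * g t)"
  unfolding bdd_def maj_def
proof (elim exE conjE)
  fix C D :: real assume *: "0 \<le> C" "0 \<le> D" "\<forall>t. \<bar>f t\<bar> \<le> C" "\<forall>t. \<psi> t \<noteq> 0 \<longrightarrow> \<bar>g t\<bar> \<le> D * \<bar>\<psi> t\<bar> powr (- \<beta>)"
  have "\<bar>f t * g t\<bar> \<le> C * D * \<bar>\<psi> t\<bar> powr (- \<beta>)" if "\<psi> t \<noteq> 0" for t
    unfolding abs_mult mult.assoc using * that by (intro mult_mono) auto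
  then show "\<exists>C\<ge>0. \<forall>t. \<psi> t \<noteq> 0 \<longrightarrow> \<bar>f t * g t\<bar> \<le> C * \<bar>\<psi> t\<bar> powr (- \<beta>)" using * by (intro exI[of _ "C * D"]) auto
qed

lemma maj_add: "maj f \<Longrightarrow> maj g \<Longrightarrow> maj (\<lambda>t. f t + g t)"
  unfolding maj_def
proof (elim exE conjE)
  fix C D :: real assume *: "0 \<le> C" "0 \<le> D" "\<forall>t. \<psi> t \<noteq> 0 \<longrightarrow> \<bar>f t\<bar> \<le> C * \<bar>\<psi> t\<bar> powr (- \<beta>)" "\<forall>t. \<psi> t \<noteq> 0 \<longrightarrow> \<bar>g t\<bar> \<le> D * \<bar>\<psi> t\<bar> powr (- \<beta>)"
  then have "\<bar>f t + g t\<bar> \<le> (C + D) * \<bar>\<psi> t\<bar> powr (- \<beta>)" if "\<psi> t \<noteq> 0" for t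
    unfolding distrib_right using that by (intro order_trans[OF abs_triangle_ineq] add_mono) auto
  then show "\<exists>C\<ge>0. \<forall>t. \<psi> t \<noteq> 0 \<longrightarrow> \<bar>f t + g t\<bar> \<le> C * \<bar>\<psi> t\<bar> powr (- \<beta>)" using * by (intro exI[of _ "C + D"]) auto
qed

lemma maj_minus: "maj f \<Longrightarrow> maj (\<lambda>t. - f t)" unfolding maj_def by simp
lemma maj_diff: "maj f \<Longrightarrow> maj g \<Longrightarrow> maj (\<lambda>t. f t - g t)"
  using maj_add[OF _ maj_minus, of f g] by simp

lemma maj_w: "maj w"
  unfolding maj_def w_def using K q by (intro exI[of _ "K * q"]) (auto simp: abs_mult sgn_if)

lemma maj_\<psi>2: "maj \<psi>2" unfolding \<psi>2_def by (intro maj_add maj_w maj_bdd bdd_mult bdd_basic)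

text \<open>The derivative of \<open>w\<close> has one more power of \<open>\<psi>\<close> in the denominator, which \<open>sin t cos t\<close> cancels.\<close>

lemma maj_w': "maj (\<lambda>t. sin t * cos t * w' t)"
proof -
  have "maj (\<lambda>t. \<beta> * \<psi>' t * w t)" by (intro maj_mult maj_w bdd_mult bdd_basic)
  then obtain C where C: "C \<ge> 0" "\<And>t. \<psi> t \<noteq> 0 \<Longrightarrow> \<bar>\<beta> * \<psi>' t * w t\<bar> \<le> C * \<bar>\<psi> t\<bar> powr (- \<beta>)" unfolding maj_def by blast
  have "\<bar>sin t * cos t * w' t\<bar> \<le> C * \<bar>\<psi> t\<bar> powr (- \<beta>)" if t: "\<psi> t \<noteq> 0" for t
  proof -
    have "\<bar>sin t * cos t * w' t\<bar> = (\<bar>sin t * cos t\<bar> / \<bar>\<psi> t\<bar>) * \<bar>\<beta> * \<psi>' t * w t\<bar>"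
      by (simp add: w'_def abs_mult)
    also have "\<dots> \<le> 1 * \<bar>\<beta> * \<psi>' t * w t\<bar>" using \<psi>_lower[of t] t by (intro mult_right_mono) auto
    finally show ?thesis using C(2)[OF t] by simp
  qed
  then show ?thesis unfolding maj_def using C(1) by blast
qed

lemmas maj_intros = maj_add maj_diff maj_minus maj_w maj_\<psi>2

definition "d1' t = (1 - \<alpha>) * cos t * \<psi>' t - (2-\<alpha>) * sin t * \<psi> t - sin t * \<psi>2 t"
definition "d2' t = (1 - \<alpha>) * sin t * \<psi>' t + (2-\<alpha>) * cos t * \<psi> t + cos t * \<psi>2 t"

lemma d_deriv:
  assumes "\<psi> t \<noteq> 0"
  shows "(d1 has_real_derivative d1' t) (at t)" "(d2 has_real_derivative d2' t) (at t)"
  unfolding d1_def[abs_def] d2_def[abs_def] d1'_def d2'_def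
  by (auto intro!: derivative_eq_intros deriv deriv2 assms simp: algebra_simps)

lemma per_d': "periodic (2*pi) d1'" "periodic (2*pi) d2'"
  using per per' per_w by (simp_all add: periodic_def d1'_def d2'_def)
lemma d'_isCont: "\<psi> t \<noteq> 0 \<Longrightarrow> isCont d1' t" "\<psi> t \<noteq> 0 \<Longrightarrow> isCont d2' t"
  unfolding d1'_def[abs_def] d2'_def[abs_def] by (intro continuous_intros isCont' \<psi>2_isCont \<psi>_isCont; simp)+

lemma laplacian_angular: "partial (1 - \<alpha>) d1 d1' 1 t + partial (1 - \<alpha>) d2 d2' 2 t = w t"
proof -
  define c s where "c = cos t" and "s = sin t"
  have cs: "c * c + s * s = 1" unfolding c_def s_def by (simp flip: power2_eq_square)
  have "partial (1 - \<alpha>) d1 d1' 1 t + partial (1 - \<alpha>) d2 d2' 2 t = (c * c + s * s) * (\<psi>2 t + (2 - \<alpha>)\<^sup>2 * \<psi> t)"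
    unfolding partial_def d1_def d2_def d1'_def d2'_def c_def[symmetric] s_def[symmetric]
    by (simp add: algebra_simps power2_eq_square)
  then show ?thesis unfolding cs by (simp add: \<psi>2_def)
qed

lemma maj_by_parts:
  assumes g: "periodic (2*pi) g" "periodic (2*pi) g'"
    and d: "\<And>t. \<psi> t \<noteq> 0 \<Longrightarrow> (g has_real_derivative g' t) (at t)"
    and c: "\<And>t. \<psi> t \<noteq> 0 \<Longrightarrow> isCont g' t"
    and \<mu>: "\<mu> \<ge> 1 - \<alpha>" and b: "maj g" "maj (partial \<mu> g g' i)"
    and line: "\<And>b. b \<noteq> 0 \<Longrightarrow> continuous_on UNIV (\<lambda>a. homog \<mu> g (slice i a b))" and \<phi>: "cutoff M i \<phi>"
  shows "weak_partial i (homog \<mu> g) (homog (\<mu> - 1) (partial \<mu> g g' i)) \<phi>"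
proof -
  obtain C1 where C1: "\<And>t. \<psi> t \<noteq> 0 \<Longrightarrow> \<bar>g t\<bar> \<le> C1 * \<bar>\<psi> t\<bar> powr (- \<beta>)" using b(1) unfolding maj_def by blast
  obtain C2 where C2: "\<And>t. \<psi> t \<noteq> 0 \<Longrightarrow> \<bar>partial \<mu> g g' i t\<bar> \<le> C2 * \<bar>\<psi> t\<bar> powr (- \<beta>)" using b(2) unfolding maj_def by blast
  have b1: "\<bar>g t\<bar> \<le> max C1 C2 * \<bar>\<psi> t\<bar> powr (- \<beta>)" if "\<psi> t \<noteq> 0" for t
    by (rule order_trans[OF C1[OF that]]) (auto intro!: mult_right_mono)
  have b2: "\<bar>partial \<mu> g g' i t\<bar> \<le> max C1 C2 * \<bar>\<psi> t\<bar> powr (- \<beta>)" if "\<psi> t \<noteq> 0" for t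
    by (rule order_trans[OF C2[OF that]]) (auto intro!: mult_right_mono)
  show ?thesis by (rule homog_by_parts[OF g d c \<mu> b1 b2 line \<phi>])
qed

lemma continuous_line:
  assumes "periodic (2*pi) g" "continuous_on UNIV g" "\<mu> > 0"
  shows "continuous_on UNIV (\<lambda>a. homog \<mu> g (slice i a b))"
  by (rule continuous_on_compose2[OF homog_periodic_continuous[OF assms]]) (auto intro!: slice_continuous continuous_intros)

text \<open>This is \<open>\<bar>\<Psi>\<bar>\<close>-to-the-\<open>2q\<close>. Its gradient is a multiple of \<open>\<Omega> \<nabla>\<Psi>\<close>, i.e. \<open>\<Omega> U\<close> is the perpendicular
  gradient of a continuous function.\<close>

definition "F = homog (2 - 2 * \<alpha>) (\<lambda>t. \<bar>\<psi> t\<bar> powr (2 * q))"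
definition "F' t = 2 * q * \<bar>\<psi> t\<bar> powr (- \<beta>) * (sgn (\<psi> t) * \<psi>' t)"

lemma vorticity_off: "x \<notin> off_axes \<Longrightarrow> \<Omega> x = 0"
proof -
  assume x: "x \<notin> off_axes"
  obtain r t where r: "r \<ge> 0" "x = r *\<^sub>R dir t" by (rule polarE)
  show ?thesis unfolding \<Omega>_def r(2) homog_dir[OF per_w(1) r(1)] using x unfolding r(2) off_axes_dir by (auto simp: w_def)
qed

lemma vorticity_isCont: "x \<in> off_axes \<Longrightarrow> isCont \<Omega> x"
  using homog_off_axes(1)[OF per_w(1,2) w_deriv w'_isCont, of x "- \<alpha>"] unfolding \<Omega>_def
  by (simp add: differentiable_imp_continuous_within)

lemma vorticity_measurable: "\<Omega> \<in> borel_measurable borel"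
  by (rule off_axes_measurable) (auto intro!: continuous_at_imp_continuous_on vorticity_isCont vorticity_off)

lemma vorticity_bound:
  assumes "x \<in> off_axes" "norm x \<le> M"
  shows "\<bar>\<Omega> x\<bar> \<le> K * q * M powr (2 * \<beta> - \<alpha>) * sing \<beta> x"
proof -
  obtain r t where r: "r > 0" "x = r *\<^sub>R dir t" "\<psi> t \<noteq> 0" "norm x = r" using off_axesE[OF assms(1)] by metis
  have "\<bar>\<Omega> x\<bar> = K * q * (r powr (- \<alpha>) * \<bar>\<psi> t\<bar> powr (- \<beta>))"
    unfolding \<Omega>_def r(2) homog_dir[OF per_w(1) less_imp_le[OF r(1)]] using r(3) K q by (simp add: w_def abs_mult sgn_if)
  also have "\<dots> \<le> K * q * (M powr (2 * \<beta> - \<alpha>) * sing \<beta> x)"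
    unfolding r(2) using K q r assms by (intro mult_left_mono majorant) auto
  finally show ?thesis by simp
qed

lemma vorticity_locally_integrable: "locally_integrable \<Omega>"
  unfolding locally_integrable_def set_integrable_def
proof (intro allI impI)
  fix A :: "(real^2) set" assume A: "compact A"
  obtain M where M: "M > 0" "\<And>x. x \<in> A \<Longrightarrow> norm x \<le> M" using compact_imp_bounded[OF A] by (auto simp: bounded_pos)
  show "integrable lborel (\<lambda>x. indicat_real A x *\<^sub>R \<Omega> x)"
  proof (rule integrable_sing_bound[OF \<beta>(2) M(1), where C="K * q * M powr (2 * \<beta> - \<alpha>)"])
    have "A \<in> sets borel" by (rule borel_closed[OF compact_imp_closed[OF A]])
    then show "(\<lambda>x. indicat_real A x *\<^sub>R \<Omega> x) \<in> borel_measurable borel"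
      using vorticity_measurable by (intro borel_measurable_scaleR borel_measurable_indicator)
    show "\<bar>indicat_real A x *\<^sub>R \<Omega> x\<bar> \<le> K * q * M powr (2 * \<beta> - \<alpha>) * sing \<beta> x" if "x \<in> off_axes" "norm x \<le> M" for x
      using vorticity_bound[OF that] by (auto simp: indicator_def intro: order_trans)
    show "indicat_real A x *\<^sub>R \<Omega> x = 0" if "norm x > M" for x using M(2)[of x] that by (auto simp: indicator_def)
  qed
qed

text \<open>\<open>\<Omega>\<close> blows up at the axes, but the factor \<open>x\<^sub>i\<close> beats the power \<open>-\<beta>\<close> of the distance to the
  axis that the line crosses.\<close>

lemma vorticity_line:
  assumes b: "b \<noteq> 0"
  shows "continuous_on UNIV (\<lambda>a. a * \<Omega> (slice i a b))"
  unfolding continuous_on_eq_continuous_at[OF open_UNIV]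
proof
  fix a :: real
  show "isCont (\<lambda>a. a * \<Omega> (slice i a b)) a"
  proof (cases "a = 0")
    case False
    then have "isCont \<Omega> (slice i a b)" using b by (intro vorticity_isCont) (simp add: slice_off_axes)
    moreover have "isCont (\<lambda>a. slice i a b) a"
      using slice_continuous[of UNIV "\<lambda>a. a" "\<lambda>_. b" i] by (simp add: continuous_on_eq_continuous_at continuous_on_id)
    ultimately have "isCont (\<lambda>a. \<Omega> (slice i a b)) a" by (intro isCont_o2[of a "\<lambda>a. slice i a b" \<Omega>])
    then show ?thesis by (intro continuous_intros)
  next
    case True
    define C where "C = K * q * (1 + \<bar>b\<bar>) powr (2 * \<beta> - \<alpha>) * \<bar>b\<bar> powr (- \<beta>)"
    have "((\<lambda>a. a * \<Omega> (slice i a b)) \<longlongrightarrow> 0) (at 0)"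
    proof (rule Lim_null_comparison)
      have "((\<lambda>a::real. C * \<bar>a\<bar> powr (1 - \<beta>)) \<longlongrightarrow> C * 0 powr (1 - \<beta>)) (at 0)"
        using \<beta> by (intro tendsto_intros tendsto_powr' tendsto_rabs_zero) auto
      then show "((\<lambda>a::real. C * \<bar>a\<bar> powr (1 - \<beta>)) \<longlongrightarrow> 0) (at 0)" by simp
      have ev: "\<forall>\<^sub>F a in at 0. a \<in> {-1<..<1} - {0::real}" by (intro eventually_at_in_open) auto
      show "\<forall>\<^sub>F a in at 0. norm (a * \<Omega> (slice i a b)) \<le> C * \<bar>a\<bar> powr (1 - \<beta>)"
        using ev
      proof eventually_elim
        case (elim a)
        then have a: "a \<noteq> 0" "\<bar>a\<bar> \<le> 1" by auto
        have "norm (slice i a b) \<le> (\<Sum>k\<in>UNIV. \<bar>slice i a b $ k\<bar>)" by (rule norm_le_l1_cart)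
        also have "\<dots> \<le> 1 + \<bar>b\<bar>" using a exhaust_2[of i] by (auto simp: sum_2 slice_nth)
        finally have "\<bar>\<Omega> (slice i a b)\<bar> \<le> K * q * (1 + \<bar>b\<bar>) powr (2 * \<beta> - \<alpha>) * sing \<beta> (slice i a b)"
          using a b by (intro vorticity_bound) (auto simp: slice_off_axes)
        then have "\<bar>a\<bar> * \<bar>\<Omega> (slice i a b)\<bar> \<le> \<bar>a\<bar> * (C * \<bar>a\<bar> powr (- \<beta>))"
          unfolding sing_slice C_def by (intro mult_left_mono) (auto simp: mult_ac)
        also have "\<dots> = C * \<bar>a\<bar> powr (1 - \<beta>)" using a by (simp add: powr_diff powr_minus field_simps)
        finally show ?case by (simp add: abs_mult)
      qed
    qed
    then show ?thesis using True by (simp add: isCont_def)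
  qed
qed

text \<open>The angular factors of \<open>x\<^sub>i \<Omega>\<close> and of its angular derivative.\<close>

definition "xw i t = dir t $ i * w t"
definition "xw' i t = tang t $ i * w t + dir t $ i * w' t"

lemma homog_xw: "homog (1 - \<alpha>) (xw i) x = x $ i * \<Omega> x"
proof -
  obtain r t where r: "r \<ge> 0" "x = r *\<^sub>R dir t" by (rule polarE)
  have p: "periodic (2*pi) (xw i)" using per_w exhaust_2[of i] by (auto simp: periodic_def xw_def)
  have "r powr (1 - \<alpha>) = r * r powr (- \<alpha>)" using r(1) by (cases "r = 0") (simp_all add: powr_diff powr_minus field_simps)
  then show ?thesis unfolding r(2) homog_dir[OF p r(1)] \<Omega>_def homog_dir[OF per_w(1) r(1)] by (simp add: xw_def)
qed

text \<open>Only the derivative of \<open>x\<^sub>i \<Omega>\<close> in the \<open>i\<close>-th direction is majorised; the other one is too singular.\<close>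

lemma xw_by_parts:
  assumes \<phi>: "cutoff M i \<phi>"
  shows "weak_partial i (\<lambda>x. x $ i * \<Omega> x) (homog (- \<alpha>) (partial (1 - \<alpha>) (xw i) (xw' i) i)) \<phi>"
proof -
  have p: "periodic (2*pi) (xw i)" "periodic (2*pi) (xw' i)"
    using per_w exhaust_2[of i] by (auto simp: periodic_def xw_def xw'_def)
  have d: "(xw i has_real_derivative xw' i t) (at t)" if "\<psi> t \<noteq> 0" for t
    using exhaust_2[of i] unfolding xw_def[abs_def] xw'_def
    by (auto intro!: derivative_eq_intros w_deriv that)
  have c: "isCont (xw' i) t" if "\<psi> t \<noteq> 0" for t
    unfolding xw'_def[abs_def]
    by (intro continuous_intros w_isCont[OF that] w'_isCont[OF that] has_vector_derivative_continuous[OF dir_has_vector_derivative]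
        has_vector_derivative_continuous[OF tang_has_vector_derivative])
  have m1: "maj (xw i)"
    using exhaust_2[of i] unfolding xw_def[abs_def] by (auto intro!: maj_mult maj_w bdd_basic)
  have m2: "maj (partial (1 - \<alpha>) (xw i) (xw' i) i)"
  proof -
    have a: "maj (\<lambda>t. (1 - \<alpha>) * cos t * cos t * w t + sin t * sin t * w t - sin t * cos t * w' t)"
      by (intro maj_intros maj_mult bdd_mult bdd_basic maj_w')
    have b: "maj (\<lambda>t. (1 - \<alpha>) * sin t * sin t * w t + cos t * cos t * w t + sin t * cos t * w' t)"
      by (intro maj_intros maj_mult bdd_mult bdd_basic maj_w')
    have "partial (1 - \<alpha>) (xw 1) (xw' 1) 1 = (\<lambda>t. (1 - \<alpha>) * cos t * cos t * w t + sin t * sin t * w t - sin t * cos t * w' t)"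
      "partial (1 - \<alpha>) (xw 2) (xw' 2) 2 = (\<lambda>t. (1 - \<alpha>) * sin t * sin t * w t + cos t * cos t * w t + sin t * cos t * w' t)"
      by (auto simp: fun_eq_iff partial_def xw_def xw'_def algebra_simps)
    then show ?thesis using a b exhaust_2[of i] by auto
  qed
  have l: "continuous_on UNIV (\<lambda>a. homog (1 - \<alpha>) (xw i) (slice i a b))" if "b \<noteq> 0" for b
    unfolding homog_xw using vorticity_line[OF that, of i] by (simp add: slice_nth)
  have "homog (1 - \<alpha>) (xw i) = (\<lambda>x. x $ i * \<Omega> x)" by (rule ext) (rule homog_xw)
  then show ?thesis using maj_by_parts[OF p d c order_refl m1 m2 l \<phi>] by simp
qed

lemma euler_angular: "partial (1 - \<alpha>) (xw 1) (xw' 1) 1 t + partial (1 - \<alpha>) (xw 2) (xw' 2) 2 t = (2 - \<alpha>) * w t"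
proof -
  define c s where "c = cos t" and "s = sin t"
  have cs: "c * c + s * s = 1" unfolding c_def s_def by (simp flip: power2_eq_square)
  have "partial (1 - \<alpha>) (xw 1) (xw' 1) 1 t + partial (1 - \<alpha>) (xw 2) (xw' 2) 2 t = (c * c + s * s) * ((2 - \<alpha>) * w t)"
    unfolding partial_def xw_def xw'_def dir_nth tang_nth c_def[symmetric] s_def[symmetric]
    by (simp add: algebra_simps)
  then show ?thesis unfolding cs by simp
qed

lemma F_by_parts:
  assumes \<phi>: "cutoff M i \<phi>"
  shows "weak_partial i F (\<lambda>x. - (2 / K) * (\<Omega> x * grad \<Psi> x $ i)) \<phi>"
proof -
  let ?g = "\<lambda>t. \<bar>\<psi> t\<bar> powr (2 * q)"
  have p: "periodic (2*pi) ?g" "periodic (2*pi) F'" using per per' by (auto simp: periodic_def F'_def)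
  have d: "(?g has_real_derivative F' t) (at t)" if "\<psi> t \<noteq> 0" for t
    using abs_powr_deriv[OF that, of "2 * q"] unfolding F'_def q_\<beta> .
  have Fw: "F' = (\<lambda>t. - (2 / K) * (\<psi>' t * w t))"
  proof
    fix t
    have "- (2 / K) * (\<psi>' t * w t) = (2 * q) * (sgn (\<psi> t) * \<psi>' t) * \<bar>\<psi> t\<bar> powr (- \<beta>) * (K / K)"
      by (simp add: w_def)
    then show "F' t = - (2 / K) * (\<psi>' t * w t)" using K by (simp add: F'_def)
  qed
  have c: "isCont F' t" if t: "\<psi> t \<noteq> 0" for t
  proof -
    note Fw
    moreover have "isCont (\<lambda>t. - (2 / K) * (\<psi>' t * w t)) t" by (intro continuous_intros isCont' w_isCont t)
    ultimately show ?thesis by simp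
  qed
  have gc: "continuous_on UNIV ?g" using q by (intro continuous_on_powr' continuous_intros cont) auto
  have m1: "maj ?g"
  proof (rule maj_bdd)
    have "\<bar>?g t\<bar> \<le> 1" for t using powr_mono2[of "2 * q" "\<bar>\<psi> t\<bar>" 1] \<psi>_le_1[of t] q by simp
    then show "bdd ?g" unfolding bdd_def by (intro exI[of _ 1]) auto
  qed
  have m': "maj F'"
  proof -
    have "maj (\<lambda>t. - (2 / K) * (\<psi>' t * w t))" by (intro maj_mult maj_w bdd_mult bdd_basic)
    then show ?thesis unfolding Fw .
  qed
  have m2: "maj (partial (2 - 2 * \<alpha>) ?g F' i)"
  proof -
    have "maj (\<lambda>t. (2 - 2 * \<alpha>) * cos t * ?g t - sin t * F' t)" "maj (\<lambda>t. (2 - 2 * \<alpha>) * sin t * ?g t + cos t * F' t)"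
      by (intro maj_diff maj_add maj_mult bdd_mult bdd_basic m' m1)+
    then show ?thesis using exhaust_2[of i] by (auto simp: partial_def[abs_def])
  qed
  have \<mu>: "2 - 2 * \<alpha> \<ge> 1 - \<alpha>" "2 - 2 * \<alpha> > 0" using \<alpha> by auto
  note l = continuous_line[OF p(1) gc \<mu>(2), of i]
  have e: "homog (2 - 2 * \<alpha> - 1) (partial (2 - 2 * \<alpha>) ?g F' i) x = - (2 / K) * (\<Omega> x * grad \<Psi> x $ i)" if True: "x \<in> off_axes" for x
  proof -
    obtain r t where r: "r > 0" "x = r *\<^sub>R dir t" "\<psi> t \<noteq> 0" "norm x = r" using off_axesE[OF True] by metis
    have r0: "r \<ge> 0" using r by simp
    have pp: "periodic (2*pi) (partial (2 - 2 * \<alpha>) ?g F' i)" using p exhaust_2[of i] by (auto simp: periodic_def partial_def)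
    have a: "?g t = sgn (\<psi> t) * \<psi> t * \<bar>\<psi> t\<bar> powr (- \<beta>)"
    proof -
      have "\<bar>\<psi> t\<bar> powr (2 * q) = \<bar>\<psi> t\<bar> powr (2 * q - 1) * \<bar>\<psi> t\<bar>" using r(3) by (simp add: powr_diff)
      then show ?thesis unfolding q_\<beta> by (simp add: mult_ac flip: abs_sgn)
    qed
    have b: "2 - 2 * \<alpha> = 2 * q * (2 - \<alpha>)" using \<alpha> by (simp add: q_def field_simps)
    have pr: "partial (2 - 2 * \<alpha>) ?g F' i t = - (2 / K) * (w t * (if i = 1 then d1 t else d2 t))"
    proof -
      define P where "P = 2 * q * \<bar>\<psi> t\<bar> powr (- \<beta>) * sgn (\<psi> t)"
      have A: "(2 - 2 * \<alpha>) * ?g t = P * ((2 - \<alpha>) * \<psi> t)" unfolding a b P_def by (simp add: mult_ac)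
      have B: "F' t = P * \<psi>' t" unfolding F'_def P_def by (simp add: mult_ac)
      have C: "- (2 / K) * w t = P" using K by (simp add: w_def P_def)
      have "(2 - 2 * \<alpha>) * cos t * ?g t - sin t * F' t = cos t * ((2 - 2 * \<alpha>) * ?g t) - sin t * F' t"
        "(2 - 2 * \<alpha>) * sin t * ?g t + cos t * F' t = sin t * ((2 - 2 * \<alpha>) * ?g t) + cos t * F' t"
        by (simp_all only: mult_ac)
      then have "(2 - 2 * \<alpha>) * cos t * ?g t - sin t * F' t = - (2 / K) * w t * d1 t"
        "(2 - 2 * \<alpha>) * sin t * ?g t + cos t * F' t = - (2 / K) * w t * d2 t"
        unfolding A B C d1_def d2_def by (simp_all only: right_diff_distrib distrib_left mult_ac)
      then show ?thesis by (simp add: partial_def mult.assoc)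
    qed
    have rr: "r powr (2 - 2 * \<alpha> - 1) = r powr (- \<alpha>) * r powr (1 - \<alpha>)" using r by (simp flip: powr_add)
    have D: "grad \<Psi> x $ i = r powr (1 - \<alpha>) * (if i = 1 then d1 t else d2 t)"
      using exhaust_2[of i] unfolding r(2) by (auto simp: stream_grad homog_dir[OF per_d(1) r0] homog_dir[OF per_d(2) r0])
    show ?thesis unfolding D unfolding r(2) homog_dir[OF pp r0] \<Omega>_def homog_dir[OF per_w(1) r0] pr rr by simp
  qed
  show ?thesis unfolding F_def
    by (rule weak_partial_cong[OF maj_by_parts[OF p d c \<mu>(1) m1 m2 l \<phi>] e])
qed

end

section \<open>The weak equations and the count of sinks\<close>

context solution begin

text \<open>Two integrations by parts, first from the continuously differentiable \<open>\<Psi>\<close> and then from its continuous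
  gradient.\<close>

lemma weak_poisson:
  assumes t: "test_function \<phi>"
  shows "(\<integral>x. \<Psi> x * laplacian \<phi> x \<partial>lborel) = (\<integral>x. \<Omega> x * \<phi> x \<partial>lborel)"
proof -
  obtain M where M: "\<And>i. cutoff M i \<phi>" "\<And>i j. cutoff M i (\<lambda>y. grad \<phi> y $ j)" using test_function_cutoff[OF t] by blast
  note tc = test_function_grad_continuous[OF t]
  define D where "D i = (if i = 1 then d1 else d2)" for i :: 2
  define D' where "D' i = (if i = 1 then d1' else d2')" for i :: 2
  have perD: "periodic (2*pi) (D i)" "periodic (2*pi) (D' i)" for i using per_d per_d' by (auto simp: D_def D'_def)
  have contD: "continuous_on UNIV (D i)" for i using cont_d by (simp add: D_def)
  have derD: "(D i has_real_derivative D' i t) (at t)" if "\<psi> t \<noteq> 0" for i t using d_deriv[OF that] by (simp add: D_def D'_def)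
  have cD': "isCont (D' i) t" if "\<psi> t \<noteq> 0" for i t using d'_isCont[OF that] by (simp add: D'_def)
  have part1: "partial (2 - \<alpha>) \<psi> \<psi>' i = D i" for i
    using exhaust_2[of i] by (auto simp: fun_eq_iff partial_def D_def d1_def d2_def)
  have majD: "maj (D i)" for i
  proof -
    have "maj d1" "maj d2" unfolding d1_def[abs_def] d2_def[abs_def]
      by (intro maj_add maj_diff maj_bdd bdd_mult bdd_basic)+
    then show ?thesis by (simp add: D_def)
  qed
  have majD': "maj (D' i)" for i
  proof -
    have "maj d1'" "maj d2'" unfolding d1'_def[abs_def] d2'_def[abs_def]
      by (intro maj_add maj_diff maj_mult maj_\<psi>2 bdd_mult bdd_basic maj_bdd)+
    then show ?thesis by (simp add: D'_def)
  qed
  have majP: "maj (partial (1 - \<alpha>) (D i) (D' i) i)" for i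
  proof -
    have "maj (\<lambda>t. (1 - \<alpha>) * cos t * D i t - sin t * D' i t)" "maj (\<lambda>t. (1 - \<alpha>) * sin t * D i t + cos t * D' i t)"
      by (intro maj_diff maj_add maj_mult bdd_mult bdd_basic majD majD')+
    then show ?thesis using exhaust_2[of i] by (auto simp: partial_def[abs_def])
  qed
  have \<alpha>': "2 - \<alpha> > 0" "1 - \<alpha> > 0" "2 - \<alpha> \<ge> 1 - \<alpha>" using \<alpha> by auto
  note l1 = continuous_line[OF per cont \<alpha>'(1)] and l2 = continuous_line[OF perD(1) contD \<alpha>'(2)]
  have m\<psi>: "maj \<psi>" by (intro maj_bdd bdd_basic)
  have mP: "maj (partial (2 - \<alpha>) \<psi> \<psi>' i)" for i unfolding part1 by (rule majD)
  have "weak_partial i \<Psi> (homog (1 - \<alpha>) (D i)) (\<lambda>y. grad \<phi> y $ i)" for i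
    using maj_by_parts[OF per per' deriv isCont' \<alpha>'(3) m\<psi> mP l1 M(2)] unfolding part1 by simp
  note A = weak_partialD[OF this]
  have "weak_partial i (homog (1 - \<alpha>) (D i)) (homog (- \<alpha>) (partial (1 - \<alpha>) (D i) (D' i) i)) \<phi>" for i
    using maj_by_parts[OF perD derD cD' order_refl majD majP l2 M(1)] by simp
  note B = weak_partialD[OF this]
  have sumH: "homog (- \<alpha>) (partial (1 - \<alpha>) (D 1) (D' 1) 1) x + homog (- \<alpha>) (partial (1 - \<alpha>) (D 2) (D' 2) 2) x = \<Omega> x" for x
    unfolding \<Omega>_def homog_def D_def D'_def by (simp flip: distrib_left add: laplacian_angular)
  have lapc: "continuous_on UNIV (laplacian \<phi>)" unfolding laplacian_def[abs_def] sum_2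
    by (intro continuous_intros tc(3))
  have "(\<integral>x. \<Psi> x * laplacian \<phi> x \<partial>lborel) = (\<integral>x. indicator off_axes x * (\<Psi> x * laplacian \<phi> x) \<partial>lborel)"
  proof (rule integral_off_axes)
    have "continuous_on UNIV (\<lambda>x. \<Psi> x * laplacian \<phi> x)"
      by (intro continuous_intros lapc homog_periodic_continuous per cont \<alpha>'(1))
    then show "(\<lambda>x. \<Psi> x * laplacian \<phi> x) \<in> borel_measurable borel" by (rule borel_measurable_continuous_onI)
  qed
  also have "\<dots> = (\<integral>x. indicator off_axes x * (\<Psi> x * grad (\<lambda>y. grad \<phi> y $ 1) x $ 1) + indicator off_axes x * (\<Psi> x * grad (\<lambda>y. grad \<phi> y $ 2) x $ 2) \<partial>lborel)"
    by (simp add: laplacian_def sum_2 distrib_left)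
  also have "\<dots> = (\<integral>x. indicator off_axes x * (homog (- \<alpha>) (partial (1 - \<alpha>) (D 1) (D' 1) 1) x * \<phi> x) \<partial>lborel)
      + (\<integral>x. indicator off_axes x * (homog (- \<alpha>) (partial (1 - \<alpha>) (D 2) (D' 2) 2) x * \<phi> x) \<partial>lborel)"
    by (subst Bochner_Integration.integral_add[OF A(1) A(1)]) (simp add: A(3) B(3))
  also have "\<dots> = (\<integral>x. indicator off_axes x * (homog (- \<alpha>) (partial (1 - \<alpha>) (D 1) (D' 1) 1) x * \<phi> x)
      + indicator off_axes x * (homog (- \<alpha>) (partial (1 - \<alpha>) (D 2) (D' 2) 2) x * \<phi> x) \<partial>lborel)"
    by (subst Bochner_Integration.integral_add[OF B(2) B(2)]) simp
  also have "\<dots> = (\<integral>x. indicator off_axes x * (\<Omega> x * \<phi> x) \<partial>lborel)"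
    unfolding sumH[symmetric] by (simp add: algebra_simps)
  also have "\<dots> = (\<integral>x. \<Omega> x * \<phi> x \<partial>lborel)"
    by (rule integral_off_axes[symmetric]) (use vorticity_measurable borel_measurable_continuous_onI[OF tc(2)] in simp)
  finally show ?thesis .
qed

text \<open>The flux splits into \<open>\<Omega> U\<close>, a perpendicular gradient, whose contribution vanishes because mixed
  derivatives of the test function commute, and \<open>\<Omega> \<xi>/\<alpha>\<close>, which contributes by Euler's relation for
  homogeneous functions.\<close>

lemma weak_transport:
  assumes t: "test_function \<phi>"
  shows "(\<integral>x. \<Omega> x * (V x \<bullet> grad \<phi> x) \<partial>lborel) = (2 / \<alpha> - 1) * (\<integral>x. \<Omega> x * \<phi> x \<partial>lborel)"
proof -
  obtain M where M: "\<And>i. cutoff M i \<phi>" "\<And>i j. cutoff M i (\<lambda>y. grad \<phi> y $ j)" using test_function_cutoff[OF t] by blast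
  note tc = test_function_grad_continuous[OF t]
  let ?I = "indicator off_axes :: real^2 \<Rightarrow> real"
  define U where "U i j = (\<lambda>x. ?I x * (\<Omega> x * grad \<Psi> x $ i * grad \<phi> x $ j))" for i j
  define X where "X i = (\<lambda>x. ?I x * (x $ i * \<Omega> x * grad \<phi> x $ i))" for i
  have Ui: "integrable lborel (U i j)" "(\<integral>x. ?I x * (F x * grad (\<lambda>y. grad \<phi> y $ j) x $ i) \<partial>lborel) = 2 / K * integral\<^sup>L lborel (U i j)" for i j
  proof -
    have e: "(\<lambda>x. ?I x * (- (2 / K) * (\<Omega> x * grad \<Psi> x $ i) * grad \<phi> x $ j)) = (\<lambda>x. - (2 / K) * U i j x)"
      by (simp add: U_def fun_eq_iff)
    note w = weak_partialD[OF F_by_parts[OF M(2)[of i j]], unfolded e]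
    show "integrable lborel (U i j)" using w(2) K by (subst (asm) integrable_mult_left_iff) auto
    show "(\<integral>x. ?I x * (F x * grad (\<lambda>y. grad \<phi> y $ j) x $ i) \<partial>lborel) = 2 / K * integral\<^sup>L lborel (U i j)"
      using w(3) by simp
  qed
  have "2 / K * integral\<^sup>L lborel (U 1 2) = 2 / K * integral\<^sup>L lborel (U 2 1)"
    unfolding Ui(2)[symmetric] mixed_partials[OF t] ..
  then have Ueq: "integral\<^sup>L lborel (U 1 2) = integral\<^sup>L lborel (U 2 1)" using K by simp
  define P where "P i = (\<lambda>x. ?I x * (homog (- \<alpha>) (partial (1 - \<alpha>) (xw i) (xw' i) i) x * \<phi> x))" for i
  have Xi: "integrable lborel (X i)" "integrable lborel (P i)" "integral\<^sup>L lborel (X i) = - integral\<^sup>L lborel (P i)" for i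
    using weak_partialD[OF xw_by_parts[OF M(1)[of i]]] unfolding X_def P_def by simp_all
  have sumP: "P 1 x + P 2 x = (2 - \<alpha>) * (?I x * (\<Omega> x * \<phi> x))" for x
  proof -
    have "P 1 x + P 2 x = ?I x * \<phi> x * (norm x powr (- \<alpha>) * (partial (1 - \<alpha>) (xw 1) (xw' 1) 1 (angle x) + partial (1 - \<alpha>) (xw 2) (xw' 2) 2 (angle x)))"
      by (simp add: P_def homog_def algebra_simps)
    then show ?thesis unfolding euler_angular by (simp add: \<Omega>_def homog_def)
  qed
  have "integral\<^sup>L lborel (P 1) + integral\<^sup>L lborel (P 2) = (\<integral>x. P 1 x + P 2 x \<partial>lborel)"
    by (rule Bochner_Integration.integral_add[symmetric, OF Xi(2) Xi(2)])
  then have PP: "integral\<^sup>L lborel (P 1) + integral\<^sup>L lborel (P 2) = (2 - \<alpha>) * (\<integral>x. ?I x * (\<Omega> x * \<phi> x) \<partial>lborel)"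
    unfolding sumP by simp
  have Vc: "continuous_on UNIV (\<lambda>x. V x \<bullet> grad \<phi> x)"
  proof -
    have "continuous_on UNIV (homog (1 - \<alpha>) d1)" "continuous_on UNIV (homog (1 - \<alpha>) d2)"
      using \<alpha> by (auto intro!: homog_periodic_continuous per_d cont_d)
    then show ?thesis unfolding inner_2 V_nth using \<alpha> by (intro continuous_intros tc(1)) auto
  qed
  have "(\<integral>x. \<Omega> x * (V x \<bullet> grad \<phi> x) \<partial>lborel) = (\<integral>x. ?I x * (\<Omega> x * (V x \<bullet> grad \<phi> x)) \<partial>lborel)"
    by (rule integral_off_axes) (use vorticity_measurable borel_measurable_continuous_onI[OF Vc] in simp)
  also have "\<dots> = (\<integral>x. (U 1 2 x - U 2 1 x) - (1 / \<alpha>) * (X 1 x + X 2 x) \<partial>lborel)"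
  proof (rule Bochner_Integration.integral_cong[OF refl])
    fix x
    show "?I x * (\<Omega> x * (V x \<bullet> grad \<phi> x)) = (U 1 2 x - U 2 1 x) - (1 / \<alpha>) * (X 1 x + X 2 x)"
      unfolding U_def X_def inner_2 V_nth stream_grad using \<alpha> by (simp add: field_simps)
  qed
  also have "\<dots> = (integral\<^sup>L lborel (U 1 2) - integral\<^sup>L lborel (U 2 1)) - (1 / \<alpha>) * (integral\<^sup>L lborel (X 1) + integral\<^sup>L lborel (X 2))"
    using Ui(1) Xi(1) by simp
  also have "\<dots> = (1 / \<alpha>) * (integral\<^sup>L lborel (P 1) + integral\<^sup>L lborel (P 2))"
    unfolding Ueq Xi(3) by (simp add: algebra_simps)
  also have "\<dots> = (2 / \<alpha> - 1) * (\<integral>x. ?I x * (\<Omega> x * \<phi> x) \<partial>lborel)"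
    unfolding PP using \<alpha> by (simp add: field_simps)
  also have "(\<integral>x. ?I x * (\<Omega> x * \<phi> x) \<partial>lborel) = (\<integral>x. \<Omega> x * \<phi> x \<partial>lborel)"
    by (rule integral_off_axes[symmetric]) (use vorticity_measurable borel_measurable_continuous_onI[OF tc(2)] in simp)
  finally show ?thesis .
qed

lemma self_similar: "self_similar_profile \<alpha> \<Omega> \<Psi>"
  unfolding self_similar_profile_def weak_profile_def
proof (intro conjI allI impI stream_differentiable stream_grad_cont vorticity_locally_integrable weak_transport weak_poisson)
  fix x assume "\<Psi> x \<noteq> 0"
  then have x: "x \<in> off_axes" by (simp add: stream_nonzero_iff)
  obtain r t where r: "r > 0" "x = r *\<^sub>R dir t" "\<psi> t \<noteq> 0" "norm x = r" using off_axesE[OF x] by metis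
  show "grad \<Psi> differentiable (at x)" unfolding r(2) by (rule stream_laplacian(1)[OF deriv2[OF r(3)] r(1)])
  show "laplacian \<Psi> x = \<Omega> x"
    unfolding r(2) stream_laplacian(4)[OF deriv2[OF r(3)] r(1)] \<Omega>_def homog_dir[OF per_w(1) less_imp_le[OF r(1)]]
    by (simp add: \<psi>2_def)
  show "\<Omega> differentiable (at x)"
    unfolding r(2) \<Omega>_def using homog_has_derivative[OF per_w(1) w_deriv[OF r(3)] r(1)] by (rule differentiableI)
  have "\<alpha> * \<psi>' t * w t + (2 - \<alpha>) * \<psi> t * w' t = \<psi>' t * w t * (\<alpha> - (2 - \<alpha>) * \<beta>)"
    using r(3) by (simp add: w'_def field_simps)
  then have "\<alpha> * \<psi>' t * w t + (2 - \<alpha>) * \<psi> t * w' t = 0" by (simp add: \<beta>_l)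
  then show "V x \<bullet> grad \<Omega> x = \<Omega> x"
    unfolding r(2) \<Omega>_def transport[OF per_w(1) w_deriv[OF r(3)] r(1)] by simp
next
  fix x assume "\<Psi> x = 0"
  then show "\<Omega> x = 0" using vorticity_off stream_nonzero_iff by blast
qed

lemma homogeneous: "homogeneous_profile \<alpha> \<Omega> \<Psi>"
  unfolding homogeneous_profile_def
proof (intro conjI allI impI self_similar exI[of _ \<psi>])
  fix r :: real and x assume "r > 0"
  then show "\<Omega> (r *\<^sub>R x) = r powr (- \<alpha>) * \<Omega> x" unfolding \<Omega>_def by (rule homog_scale)
next
  fix t show "\<psi> (t + 2 * pi) = \<psi> t" using per by (simp add: periodic_def)
next
  fix r t :: real assume r: "0 \<le> r"
  have "vector [r * cos t, r * sin t] = r *\<^sub>R dir t" by (simp add: vec2_eq_iff)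
  then show "\<Psi> (vector [r * cos t, r * sin t]) = r powr (2 - \<alpha>) * \<psi> t" using homog_dir[OF per r] by simp
qed

lemma odd_about_zero:
  assumes "\<psi> t = 0" shows "\<psi> (t + s) = - \<psi> (t - s)"
proof -
  obtain n :: int where n: "t = of_int n * (pi / 2)" using \<psi>_zeroE[OF assms] .
  show ?thesis
  proof (cases "even n")
    case True
    then obtain m where "n = 2 * m" by blast
    then have t: "t = pi * of_int m" using n by simp
    have "\<psi> (t + s) = \<psi> s" "\<psi> (t - s) = \<psi> (- s)"
      using periodic_int[OF \<psi>_pi(1), of s m] periodic_int[OF \<psi>_pi(1), of "- s" m] by (simp_all add: t add.commute)
    then show ?thesis by (simp add: \<psi>_odd)
  next
    case False
    then obtain m where "n = 2 * m + 1" by (rule oddE)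
    then have t: "t = pi * of_int m + pi / 2" using n by (simp add: algebra_simps)
    have "\<psi> (t + s) = \<psi> (s + pi/2)" "\<psi> (t - s) = \<psi> (- s + pi/2)"
      using periodic_int[OF \<psi>_pi(1), of "s + pi/2" m] periodic_int[OF \<psi>_pi(1), of "- s + pi/2" m]
      by (simp_all add: t algebra_simps)
    moreover have "\<psi> (- s + pi/2) = \<psi> s" "\<psi> (s + pi/2) = - \<psi> s" unfolding \<psi>_shift by (simp_all add: \<psi>_odd)
    ultimately show ?thesis by metis
  qed
qed

lemma gradient_exists: "gradient_at_stagnation_points V"
  unfolding gradient_at_stagnation_points_def
proof (intro allI impI)
  fix p assume p: "p \<noteq> 0 \<and> V p = 0"
  then obtain t where t: "\<psi> t = 0" "\<psi>' t < 0" "p = stagnation_radius t *\<^sub>R dir t" using stagnation_pointE[of p] by metis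
  have "\<exists>A. has_symmetric_gradient V A (stagnation_radius t *\<^sub>R dir t)"
  proof (rule symmetric_gradient_exists[where \<delta>="pi/2" and \<psi>''=\<psi>2])
    show "stagnation_radius t > 0" "V (stagnation_radius t *\<^sub>R dir t) = 0" using stagnation_radius t by auto
    show "\<psi> (t + s) = - \<psi> (t - s)" for s by (rule odd_about_zero[OF t(1)])
    show "(\<psi>' has_real_derivative \<psi>2 s) (at s)" if s: "s \<noteq> t" "\<bar>s - t\<bar> < pi / 2" for s
    proof (rule deriv2)
      obtain n :: int where n: "t = of_int n * (pi / 2)" using \<psi>_zeroE[OF t(1)] .
      show "\<psi> s \<noteq> 0"
      proof
        assume "\<psi> s = 0"
        then obtain m :: int where m: "s = of_int m * (pi / 2)" using \<psi>_zeroE by metis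
        have "s - t = of_int (m - n) * (pi / 2)" unfolding n m of_int_diff left_diff_distrib ..
        then have "\<bar>s - t\<bar> = \<bar>of_int (m - n)\<bar> * (pi / 2)" by (simp only: abs_mult) simp
        then have "\<bar>of_int (m - n)\<bar> * (pi / 2) < 1 * (pi / 2)" using s(2) by simp
        then have "\<bar>real_of_int (m - n)\<bar> < 1" by (simp add: field_simps)
        then have "m = n" by linarith
        then show False using s(1) n m by simp
      qed
    qed
    show "((\<lambda>s. (s - t) * \<psi>2 s) \<longlongrightarrow> 0) (at t)"
    proof -
      have "((\<lambda>s. (\<psi> s - \<psi> t) / (s - t)) \<longlongrightarrow> \<psi>' t) (at t)" using deriv[of t] by (simp add: has_field_derivative_iff)
      then have "((\<lambda>s. inverse (\<psi> s / (s - t))) \<longlongrightarrow> inverse (\<psi>' t)) (at t)" using t by (intro tendsto_inverse) auto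
      moreover have psit: "(\<psi> \<longlongrightarrow> 0) (at t)" using \<psi>_isCont[of t] t(1) by (simp add: isCont_def)
      have "((\<lambda>s. \<bar>\<psi> s\<bar> powr (1 - \<beta>)) \<longlongrightarrow> 0 powr (1 - \<beta>)) (at t)"
        using \<beta> by (intro tendsto_powr' tendsto_rabs_zero psit tendsto_intros) auto
      then have "((\<lambda>s. - K * q * \<bar>\<psi> s\<bar> powr (1 - \<beta>)) \<longlongrightarrow> - K * q * 0 powr (1 - \<beta>)) (at t)" by (rule tendsto_mult_left)
      ultimately have "((\<lambda>s. inverse (\<psi> s / (s - t)) * (- K * q * \<bar>\<psi> s\<bar> powr (1 - \<beta>))) \<longlongrightarrow> inverse (\<psi>' t) * (- K * q * 0 powr (1 - \<beta>))) (at t)"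
        by (rule tendsto_mult)
      then have "((\<lambda>s. inverse (\<psi> s / (s - t)) * (- K * q * \<bar>\<psi> s\<bar> powr (1 - \<beta>))) \<longlongrightarrow> 0) (at t)" by simp
      moreover have "inverse (\<psi> s / (s - t)) * (- K * q * \<bar>\<psi> s\<bar> powr (1 - \<beta>)) = (s - t) * w s" for s
      proof (cases "\<psi> s = 0")
        case False
        then have "\<bar>\<psi> s\<bar> powr (1 - \<beta>) = sgn (\<psi> s) * \<psi> s * \<bar>\<psi> s\<bar> powr (- \<beta>)" by (simp add: powr_diff powr_minus divide_inverse flip: abs_sgn) (simp add: abs_sgn mult_ac)
        then show ?thesis using False by (simp add: w_def field_simps)
      qed (simp add: w_def)
      ultimately have wl: "((\<lambda>s. (s - t) * w s) \<longlongrightarrow> 0) (at t)" by simp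
      have "((\<lambda>s. (s - t) * (- ((2 - \<alpha>)\<^sup>2) * \<psi> s) + (s - t) * w s) \<longlongrightarrow> (t - t) * (- ((2 - \<alpha>)\<^sup>2) * 0) + 0) (at t)"
        by (intro tendsto_intros psit wl)
      then show ?thesis by (simp add: \<psi>2_def distrib_left right_diff_distrib)
    qed
  qed simp
  then show "\<exists>A. has_symmetric_gradient V A p" using t(3) by simp
qed

lemma zero_facts: "\<psi> 0 = 0" "\<psi> (pi/2) = 0" "\<psi>' (pi/2) < 0" "\<psi> (pi/2 + pi) = 0" "\<psi>' (pi/2 + pi) = \<psi>' (pi/2)"
proof -
  show z: "\<psi> 0 = 0" "\<psi> (pi/2) = 0" "\<psi>' (pi/2) < 0"
    using \<psi>_odd[of 0] \<psi>_shift[of 0] \<psi>'_shift[of 0] \<psi>'_0 by auto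
  show "\<psi> (pi/2 + pi) = 0" "\<psi>' (pi/2 + pi) = \<psi>' (pi/2)"
    using \<psi>_pi z(2) unfolding periodic_def by metis+
qed

lemma sinks: "{p. is_sink V p} = {stagnation_radius (pi/2) *\<^sub>R dir (pi/2), - (stagnation_radius (pi/2) *\<^sub>R dir (pi/2))}"
proof -
  let ?p = "stagnation_radius (pi/2) *\<^sub>R dir (pi/2)"
  have r: "stagnation_radius (pi/2) > 0" "V ?p = 0" using stagnation_radius zero_facts by auto
  have r': "V (- ?p) = 0"
    using stagnation_radius(2)[OF zero_facts(4), unfolded stagnation_radius_def zero_facts(5) dir_add_pi, OF zero_facts(3)]
    by (simp add: stagnation_radius_def)
  have "p = ?p \<or> p = - ?p" if p: "p \<noteq> 0" "V p = 0" for p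
  proof -
    obtain t where t: "\<psi> t = 0" "\<psi>' t < 0" "p = stagnation_radius t *\<^sub>R dir t" using stagnation_pointE[OF p] by metis
    obtain n :: int where n: "t = of_int n * (pi / 2)" using \<psi>_zeroE[OF t(1)] .
    show ?thesis
    proof (cases "even n")
      case True
      then obtain m where "n = 2 * m" by blast
      then have "t = 0 + pi * of_int m" using n by simp
      then have "\<psi>' t = \<psi>' 0" using periodic_int[OF \<psi>_pi(2), of 0 m] by simp
      then show ?thesis using \<psi>'_0 t by simp
    next
      case False
      then obtain m where m: "n = 2 * m + 1" by (rule oddE)
      then have tm: "t = pi / 2 + pi * of_int m" using n by (simp add: algebra_simps)
      have e: "\<psi>' t = \<psi>' (pi/2)" using periodic_int[OF \<psi>_pi(2), of "pi/2" m] tm by simp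
      then have R: "stagnation_radius t = stagnation_radius (pi/2)" by (simp add: stagnation_radius_def)
      have "dir t = dir (pi/2) \<or> dir t = - dir (pi/2)"
      proof (cases "even m")
        case True
        then obtain k where "m = 2 * k" by blast
        then have "t = pi/2 + 2 * pi * of_int k" using tm by simp
        then show ?thesis by (simp add: vec2_eq_iff cos_add sin_add)
      next
        case False
        then obtain k where "m = 2 * k + 1" by (rule oddE)
        then have "t = (pi/2 + 2 * pi * of_int k) + pi" using tm by (simp add: algebra_simps)
        then have "dir t = - dir (pi/2 + 2 * pi * of_int k)" by (simp only: dir_add_pi)
        also have "dir (pi/2 + 2 * pi * of_int k) = dir (pi/2)" by (simp add: vec2_eq_iff cos_add sin_add)
        finally show ?thesis by simp
      qed
      then show ?thesis using t(3) R by auto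
    qed
  qed
  moreover have "?p \<noteq> 0" using r by simp
  ultimately show ?thesis using r r' is_sink_iff[OF gradient_exists] by auto
qed

theorem two_sinks: "two_sink_profile \<alpha> \<Omega> \<Psi>"
proof -
  let ?p = "stagnation_radius (pi/2) *\<^sub>R dir (pi/2)"
  have "stagnation_radius (pi/2) > 0" using stagnation_radius zero_facts by auto
  then have ne: "?p \<noteq> - ?p" by (simp add: vec2_eq_iff)
  have sk: "is_sink V ?p" "is_sink V (- ?p)" using sinks by blast+
  have "saddle_at_origin V" by (rule saddle[of 0 "pi/2"]) (use zero_facts \<psi>'_0 in auto)
  then have "sink_saddle_profile \<alpha> \<Omega> \<Psi>"
    unfolding sink_saddle_profile_def using homogeneous gradient_exists ne sk by blast
  moreover have "card {p. is_sink V p} = 2" unfolding sinks using ne by simp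
  moreover have "two_fold_symmetric \<Omega>" unfolding two_fold_symmetric_def
  proof
    fix x
    obtain r t where r: "r \<ge> 0" "x = r *\<^sub>R dir t" by (rule polarE)
    have "- x = r *\<^sub>R dir (t + pi)" using r by simp
    moreover have "w (t + pi) = w t" using \<psi>_pi by (simp add: w_def periodic_def)
    ultimately show "\<Omega> (- x) = \<Omega> x" unfolding r(2) \<Omega>_def
      by (metis homog_dir[OF per_w(1) r(1)] r(2))
  qed
  ultimately show ?thesis unfolding two_sink_profile_def by blast
qed

end

section \<open>The zeros of an arbitrary profile\<close>

text \<open>At a transversal zero the function is one-signed up to its next zero, which exists by periodicity in
  the application.\<close>

lemma next_zero:
  fixes f :: "real \<Rightarrow> real"
  assumes f: "\<And>x. isCont f x" and t: "f t = 0" and d: "(f has_real_derivative D) (at t)"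
    and \<epsilon>: "\<epsilon> = 1 \<or> \<epsilon> = -1" "\<epsilon> * D > 0" and u: "t < u" "f u = 0"
  obtains t' where "t < t'" "t' \<le> u" "f t' = 0" "\<And>x. t < x \<Longrightarrow> x < t' \<Longrightarrow> \<epsilon> * f x > 0"
proof -
  define g where "g x = \<epsilon> * f x" for x
  have gc: "isCont g x" for x unfolding g_def by (intro continuous_intros f)
  have gz: "g x = 0 \<longleftrightarrow> f x = 0" for x using \<epsilon>(1) by (auto simp: g_def)
  have "(g has_real_derivative \<epsilon> * D) (at t)" unfolding g_def by (rule DERIV_cmult[OF d])
  from DERIV_pos_inc_right[OF this \<epsilon>(2)] obtain e where e: "e > 0" "\<And>h. 0 < h \<Longrightarrow> h < e \<Longrightarrow> g t < g (t + h)" by blast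
  have pos: "g x > 0" if "t < x" "x < t + e" for x using e(2)[of "x - t"] that gz[of t] t by simp
  have ue: "u \<ge> t + e" using pos[of u] u gz[of u] by force
  define Z where "Z = {t + e..u} \<inter> g -` {0}"
  have "compact Z" unfolding Z_def
    by (intro compact_Int_closed compact_Icc closed_vimage) (auto intro!: continuous_at_imp_continuous_on gc)
  moreover have "u \<in> Z" using ue u gz[of u] by (simp add: Z_def)
  ultimately obtain t' where t': "t' \<in> Z" "\<And>x. x \<in> Z \<Longrightarrow> t' \<le> x" using compact_attains_inf[of Z] by blast
  have nz: "g x \<noteq> 0" if "t < x" "x < t'" for x
  proof (cases "x < t + e")
    case True then show ?thesis using pos[of x] that by simp
  next
    case False
    then show ?thesis using t'(1) t'(2)[of x] that by (force simp: Z_def)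
  qed
  show ?thesis
  proof (rule that[of t'])
    show "t < t'" "t' \<le> u" "f t' = 0" using t'(1) e(1) gz by (auto simp: Z_def)
    fix x assume x: "t < x" "x < t'"
    show "\<epsilon> * f x > 0"
    proof (rule ccontr)
      assume "\<not> \<epsilon> * f x > 0"
      then have neg: "g x < 0" using nz[OF x] unfolding g_def by linarith
      then have xe: "x \<ge> t + e" using pos[of x] x by force
      define y where "y = t + e / 2"
      have y: "t < y" "y < x" "g y > 0" using pos[of y] e(1) xe by (auto simp: y_def)
      obtain z where "y \<le> z" "z \<le> x" "g z = 0"
        using IVT2[of g x 0 y] neg y gc by auto
      then show False using nz[of z] x y by simp
    qed
  qed
qed

text \<open>What an arbitrary homogeneous profile provides: a second order equation and a transport equation off the
  zeros of \<open>\<psi>\<close>. The zeros may a priori accumulate or be degenerate.\<close>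

locale sectorial = stream +
  fixes w :: "real \<Rightarrow> real" and q \<beta> :: real
  assumes q_def: "q = (1 - \<alpha>) / (2 - \<alpha>)" and \<beta>_def: "\<beta> = \<alpha> / (2 - \<alpha>)"
    and ode1: "\<psi> t \<noteq> 0 \<Longrightarrow> (\<psi>' has_real_derivative w t - (2 - \<alpha>)\<^sup>2 * \<psi> t) (at t)"
    and ode2: "\<psi> t \<noteq> 0 \<Longrightarrow> \<exists>w'. (w has_real_derivative w') (at t) \<and> \<alpha> * \<psi>' t * w t + (2 - \<alpha>) * \<psi> t * w' = 0"
begin

lemma q: "0 < q" "q < 1" and \<beta>: "0 < \<beta>" "\<beta> < 1" and q_\<beta>: "2 * q - 1 = - \<beta>" and \<beta>_l: "(2 - \<alpha>) * \<beta> = \<alpha>"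
  using \<alpha> by (simp_all add: q_def \<beta>_def field_simps)

lemma \<psi>_isCont: "isCont \<psi> t" using deriv DERIV_isCont by blast

text \<open>The reduced transport equation says that \<open>w \<bar>\<psi>\<bar>\<close>-to-the-\<open>\<beta>\<close> has derivative 0. The constant may differ from
  sector to sector.\<close>

lemma sector_constant:
  assumes \<epsilon>: "\<epsilon> = 1 \<or> \<epsilon> = -1" and pos: "\<And>x. a < x \<Longrightarrow> x < b \<Longrightarrow> \<epsilon> * \<psi> x > 0"
  obtains k where "\<And>x. a < x \<Longrightarrow> x < b \<Longrightarrow> \<epsilon> * w x = k * (\<epsilon> * \<psi> x) powr (2 * q - 1)"
proof -
  define f where "f x = \<epsilon> * w x * (\<epsilon> * \<psi> x) powr \<beta>" for x
  have fd: "(f has_real_derivative 0) (at x)" if x: "a < x" "x < b" for x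
  proof -
    have p: "\<epsilon> * \<psi> x > 0" by (rule pos[OF x])
    then have nz: "\<psi> x \<noteq> 0" by auto
    obtain w' where w': "(w has_real_derivative w') (at x)" "\<alpha> * \<psi>' x * w x + (2 - \<alpha>) * \<psi> x * w' = 0" using ode2[OF nz] by blast
    have 1: "((\<lambda>x. (\<epsilon> * \<psi> x) powr \<beta>) has_real_derivative \<beta> * (\<epsilon> * \<psi> x) powr (\<beta> - 1) * (\<epsilon> * \<psi>' x)) (at x)"
      by (rule DERIV_chain2[where f="\<lambda>x. x powr \<beta>", OF has_real_derivative_powr[OF p] DERIV_cmult[OF deriv]])
    have 2: "(\<epsilon> * \<psi> x) powr \<beta> = (\<epsilon> * \<psi> x) powr (\<beta> - 1) * (\<epsilon> * \<psi> x)" using p by (simp add: powr_diff)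
    have 3: "w' * \<psi> x + w x * \<beta> * \<psi>' x = 0"
    proof -
      have "(2 - \<alpha>) * (w' * \<psi> x + w x * \<beta> * \<psi>' x) = (2 - \<alpha>) * \<psi> x * w' + ((2 - \<alpha>) * \<beta>) * \<psi>' x * w x" by (simp add: algebra_simps)
      also have "\<dots> = 0" unfolding \<beta>_l using w'(2) by simp
      finally show ?thesis using \<alpha> by simp
    qed
    have "(f has_real_derivative \<epsilon> * w' * (\<epsilon> * \<psi> x) powr \<beta> + \<beta> * (\<epsilon> * \<psi> x) powr (\<beta> - 1) * (\<epsilon> * \<psi>' x) * (\<epsilon> * w x)) (at x)"
      unfolding f_def by (rule DERIV_mult[OF DERIV_cmult[OF w'(1)] 1])
    also have "\<epsilon> * w' * (\<epsilon> * \<psi> x) powr \<beta> + \<beta> * (\<epsilon> * \<psi> x) powr (\<beta> - 1) * (\<epsilon> * \<psi>' x) * (\<epsilon> * w x)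
       = \<epsilon> * \<epsilon> * (\<epsilon> * \<psi> x) powr (\<beta> - 1) * (w' * \<psi> x + w x * \<beta> * \<psi>' x)" unfolding 2 by (simp add: algebra_simps)
    finally show ?thesis unfolding 3 by simp
  qed
  define c where "c = (a + b) / 2"
  have fc: "f x = f c" if x: "a < x" "x < b" for x
  proof -
    have "a < c" "c < b" using x by (auto simp: c_def)
    then show ?thesis using x fd by (intro DERIV_isconst3[of a b]) auto
  qed
  have "\<epsilon> * w x = f c * (\<epsilon> * \<psi> x) powr (2 * q - 1)" if x: "a < x" "x < b" for x
  proof -
    have "(\<epsilon> * \<psi> x) powr \<beta> * (\<epsilon> * \<psi> x) powr (- \<beta>) = 1"
      using pos[OF x] by (metis add.right_inverse less_irrefl powr_add powr_zero_eq_one)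
    then show ?thesis unfolding fc[OF x, symmetric] unfolding q_\<beta> f_def by (simp add: mult.assoc)
  qed
  then show ?thesis by (rule that)
qed

lemma sector_arc:
  assumes \<epsilon>: "\<epsilon> = 1 \<or> \<epsilon> = -1" and ab: "a < b" and z: "\<psi> a = 0" "\<psi> b = 0"
    and pos: "\<And>x. a < x \<Longrightarrow> x < b \<Longrightarrow> \<epsilon> * \<psi> x > 0" and \<sigma>: "\<sigma> > 0" "\<epsilon> * \<psi>' a = \<sigma>"
  obtains m K k where "m > 0" "(2 - \<alpha>)\<^sup>2 + K > 0" "\<sigma>\<^sup>2 = m\<^sup>2 * ((2 - \<alpha>)\<^sup>2 + K)" "k = - q * K * m powr (2 - 2 * q)"
    "b - a = travel (2 - \<alpha>) q K pi" "\<And>x. x \<in> {a..b} \<Longrightarrow> \<epsilon> * \<psi> x = m * pruefer.S (2 - \<alpha>) q K (x - a)"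
    "\<epsilon> * \<psi>' b = - \<sigma>"
    "\<And>x. x \<in> {a..b} \<Longrightarrow> (\<psi>' x)\<^sup>2 = \<sigma>\<^sup>2 - (2 - \<alpha>)\<^sup>2 * (\<psi> x)\<^sup>2 + k / q * \<bar>\<psi> x\<bar> powr (2 * q)"
proof -
  obtain k where k: "\<And>x. a < x \<Longrightarrow> x < b \<Longrightarrow> \<epsilon> * w x = k * (\<epsilon> * \<psi> x) powr (2 * q - 1)"
    using sector_constant[OF \<epsilon> pos] by blast
  have l: "2 - \<alpha> > 0" using \<alpha> by simp
  have cd: "continuous_on UNIV (\<lambda>x. \<epsilon> * \<psi>' x)" by (intro continuous_intros cont')
  have ode: "((\<lambda>x. \<epsilon> * \<psi>' x) has_real_derivative - ((2 - \<alpha>)\<^sup>2) * (\<epsilon> * \<psi> x) + k * (\<epsilon> * \<psi> x) powr (2 * q - 1)) (at x)"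
    if x: "a < x" "x < b" for x
  proof -
    have "\<psi> x \<noteq> 0" using pos[OF x] by auto
    from DERIV_cmult[OF ode1[OF this], of \<epsilon>]
    show ?thesis unfolding k[OF x, symmetric] by (simp add: algebra_simps)
  qed
  have z': "\<epsilon> * \<psi> a = 0" "\<epsilon> * \<psi> b = 0" using z by auto
  have sq: "(\<epsilon> * y)\<^sup>2 = y\<^sup>2" for y using \<epsilon> by auto
  obtain m K where mK: "m > 0" "(2 - \<alpha>)\<^sup>2 + K > 0" "\<sigma>\<^sup>2 = m\<^sup>2 * ((2 - \<alpha>)\<^sup>2 + K)" "k = - q * K * m powr (2 - 2 * q)"
    "b - a = travel (2 - \<alpha>) q K pi" "\<And>x. x \<in> {a..b} \<Longrightarrow> \<epsilon> * \<psi> x = m * pruefer.S (2 - \<alpha>) q K (x - a)"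
    "\<epsilon> * \<psi>' b = - \<sigma>"
    "\<And>x. x \<in> {a..b} \<Longrightarrow> (\<epsilon> * \<psi>' x)\<^sup>2 = \<sigma>\<^sup>2 - (2 - \<alpha>)\<^sup>2 * (\<epsilon> * \<psi> x)\<^sup>2 + k / q * (\<epsilon> * \<psi> x) powr (2 * q)"
    using arc[OF q l \<sigma>(1) ab DERIV_cmult[OF deriv] cd z' pos \<sigma>(2) ode] by blast
  have "(\<psi>' x)\<^sup>2 = \<sigma>\<^sup>2 - (2 - \<alpha>)\<^sup>2 * (\<psi> x)\<^sup>2 + k / q * \<bar>\<psi> x\<bar> powr (2 * q)" if x: "x \<in> {a..b}" for x
  proof -
    have "\<epsilon> * \<psi> x \<ge> 0" using pos[of x] x z by (cases "x = a \<or> x = b") (auto intro: less_imp_le)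
    then have "\<epsilon> * \<psi> x = \<bar>\<psi> x\<bar>" using \<epsilon> by auto
    then show ?thesis using mK(8)[OF x] unfolding sq by simp
  qed
  then show ?thesis using that[OF mK(1-7)] by blast
qed

text \<open>The end slopes of an arc agree in absolute value, and continuity of \<open>\<psi>'\<close> passes the slope on to
  the next arc. Taking the last zero with the given slope excludes that the arcs accumulate.\<close>

lemma all_zeros_transversal:
  assumes t0: "\<psi> t0 = 0" "\<psi>' t0 \<noteq> 0" and z: "\<psi> z = 0"
  shows "\<bar>\<psi>' z\<bar> = \<bar>\<psi>' t0\<bar>"
proof -
  define \<sigma> where "\<sigma> = \<bar>\<psi>' t0\<bar>"
  have \<sigma>: "\<sigma> > 0" using t0 by (simp add: \<sigma>_def)
  obtain n :: nat where n: "of_nat n * (2 * pi) > t0 - z" using reals_Archimedean3[of "2*pi"] by auto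
  define y where "y = z + 2 * pi * of_int (int n)"
  have y: "t0 < y" "\<psi> y = 0" "\<psi>' y = \<psi>' z"
    using n z periodic_int[OF per, of z "int n"] periodic_int[OF per', of z "int n"] by (auto simp: y_def algebra_simps)
  define Z where "Z = {t0..y} \<inter> ((\<lambda>x. (\<psi> x, \<bar>\<psi>' x\<bar>)) -` {(0, \<sigma>)})"
  have "compact Z" unfolding Z_def
    by (intro compact_Int_closed compact_Icc closed_vimage)
      (auto intro!: continuous_intros cont cont' )
  moreover have "t0 \<in> Z" using y t0 by (simp add: Z_def \<sigma>_def)
  ultimately obtain x where x: "x \<in> Z" "\<And>s. s \<in> Z \<Longrightarrow> s \<le> x" using compact_attains_sup[of Z] by blast
  have "x = y"
  proof (rule ccontr)
    assume "x \<noteq> y"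
    then have xy: "x < y" "\<psi> x = 0" "\<bar>\<psi>' x\<bar> = \<sigma>" using x(1) by (auto simp: Z_def)
    define \<epsilon> where "\<epsilon> = sgn (\<psi>' x)"
    have \<epsilon>: "\<epsilon> = 1 \<or> \<epsilon> = -1" "\<epsilon> * \<psi>' x = \<sigma>" using xy(3) \<sigma> by (auto simp: \<epsilon>_def sgn_if)
    obtain t' where t': "x < t'" "t' \<le> y" "\<psi> t' = 0" "\<And>s. x < s \<Longrightarrow> s < t' \<Longrightarrow> \<epsilon> * \<psi> s > 0"
      using next_zero[OF \<psi>_isCont xy(2) deriv \<epsilon>(1) _ xy(1) y(2)] \<epsilon>(2) \<sigma> by metis
    have "\<epsilon> * \<psi>' t' = - \<sigma>" using sector_arc[OF \<epsilon>(1) t'(1) xy(2) t'(3) t'(4) \<sigma> \<epsilon>(2)] by metis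
    then have "\<bar>\<psi>' t'\<bar> = \<sigma>" using \<epsilon>(1) \<sigma> by auto
    then have "t' \<in> Z" using t' x(1) by (auto simp: Z_def)
    then show False using x(2)[of t'] t'(1) by simp
  qed
  then show ?thesis using x(1) y by (simp add: Z_def \<sigma>_def)
qed

lemma finite_zeros:
  assumes t0: "\<psi> t0 = 0" "\<psi>' t0 \<noteq> 0"
  shows "finite {x \<in> {a..b}. \<psi> x = 0}"
proof (rule ccontr)
  let ?T = "{x \<in> {a..b}. \<psi> x = 0}"
  assume "infinite ?T"
  moreover have "?T \<subseteq> {a..b}" by auto
  ultimately obtain z where z: "z islimpt ?T"
    using compact_Icc[of a b] unfolding compact_eq_Bolzano_Weierstrass by blast
  have "closed (\<psi> -` {0})" by (intro closed_vimage cont) auto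
  moreover have "z islimpt (\<psi> -` {0})" by (rule islimpt_subset[OF z]) auto
  ultimately have \<psi>z: "\<psi> z = 0" unfolding closed_limpt by auto
  then have nz: "\<psi>' z \<noteq> 0" using all_zeros_transversal[OF t0 \<psi>z] t0 by auto
  have "((\<lambda>x. (\<psi> x - \<psi> z) / (x - z)) \<longlongrightarrow> \<psi>' z) (at z)" using deriv[of z] by (simp add: has_field_derivative_iff)
  then have "\<forall>\<^sub>F x in at z. (\<psi> x - \<psi> z) / (x - z) \<noteq> 0" using nz by (rule tendsto_imp_eventually_ne)
  then have "\<forall>\<^sub>F x in at z. \<psi> x \<noteq> 0" by eventually_elim (use \<psi>z in auto)
  then obtain d where d: "d > 0" "\<And>x. x \<noteq> z \<Longrightarrow> dist x z < d \<Longrightarrow> \<psi> x \<noteq> 0" unfolding eventually_at by auto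
  obtain x where "x \<in> ?T" "x \<noteq> z" "dist x z < d" using z d(1) unfolding islimpt_approachable by blast
  then show False using d(2)[of x] by simp
qed

text \<open>The symmetry concerns the vorticity only. The difference \<open>d\<close> of \<open>\<psi>\<close> and its shift by \<open>\<pi>\<close> solves
  \<open>d'' = -l\<^sup>2 d\<close> off finitely many points, hence is a trigonometric function of frequency \<open>l\<close>, and it
  changes sign under the shift. Since \<open>1 < l < 2\<close>, no such function exists except 0.\<close>

lemma pi_periodic:
  assumes t0: "\<psi> t0 = 0" "\<psi>' t0 \<noteq> 0" and w: "\<And>t. w (t + pi) = w t"
  shows "periodic pi \<psi>" "periodic pi \<psi>'"
proof -
  define l where "l = 2 - \<alpha>"
  have l: "1 < l" "l < 2" using \<alpha> by (auto simp: l_def)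
  define d d' where "d t = \<psi> (t + pi) - \<psi> t" and "d' t = \<psi>' (t + pi) - \<psi>' t" for t
  have dd: "(d has_real_derivative d' t) (at t)" for t
  proof -
    have "((\<lambda>t. \<psi> (t + pi)) has_real_derivative \<psi>' (t + pi)) (at t)" using deriv[of "t + pi"] by (simp add: DERIV_shift)
    then show ?thesis unfolding d_def d'_def by (intro DERIV_diff deriv)
  qed
  have dc: "continuous_on A d'" for A unfolding d'_def
    by (intro continuous_intros continuous_on_compose2[OF cont'] continuous_on_subset[OF cont']) auto
  have dcc: "continuous_on A d" for A using dd by (intro DERIV_continuous_on) (auto intro: has_field_derivative_at_within)
  have anti: "d (t + pi) = - d t" "d' (t + pi) = - d' t" for t
    using per per' by (simp_all add: d_def d'_def periodic_def add.assoc flip: mult_2)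
  define Z where "Z = {x \<in> {0..pi}. \<psi> x = 0 \<or> \<psi> (x + pi) = 0}"
  have finZ: "finite Z"
  proof -
    have "Z \<subseteq> {x \<in> {0..pi}. \<psi> x = 0} \<union> (\<lambda>x. x - pi) ` {x \<in> {pi..2*pi}. \<psi> x = 0}"
      by (force simp: Z_def image_iff)
    then show ?thesis by (rule finite_subset) (intro finite_UnI finite_imageI finite_zeros[OF t0])
  qed
  have d2: "(d' has_real_derivative - (l\<^sup>2) * d t) (at t)" if t: "t \<in> {0..pi} - Z" for t
  proof -
    have nz: "\<psi> t \<noteq> 0" "\<psi> (t + pi) \<noteq> 0" using t by (auto simp: Z_def)
    have "((\<lambda>t. \<psi>' (t + pi)) has_real_derivative w (t + pi) - (2 - \<alpha>)\<^sup>2 * \<psi> (t + pi)) (at t)"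
      using ode1[OF nz(2)] by (simp add: DERIV_shift)
    from DERIV_diff[OF this ode1[OF nz(1)]] show ?thesis unfolding d'_def d_def w l_def by (simp add: algebra_simps)
  qed
  \<comment> \<open>Variation of constants: these are the coefficients of \<open>d\<close> with respect to cosine and sine.\<close>
  define A B where "A t = d t * cos (l * t) - d' t * (sin (l * t) / l)" and "B t = d t * sin (l * t) + d' t * (cos (l * t) / l)" for t
  have AB: "A t = A 0 \<and> B t = B 0" if t: "t \<in> {0..pi}" for t
  proof
    have AD: "(A has_real_derivative 0) (at t)" and BD: "(B has_real_derivative 0) (at t)" if t: "t \<in> {0..pi} - Z" for t
    proof -
      have "(A has_real_derivative (d' t * cos (l * t) + - sin (l * t) * l * d t) - (- (l\<^sup>2) * d t * (sin (l * t) / l) + cos (l * t) * l / l * d' t)) (at t)"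
        unfolding A_def using l by (intro DERIV_diff DERIV_mult dd d2[OF t]) (auto intro!: derivative_eq_intros)
      moreover have "(d' t * cos (l * t) + - sin (l * t) * l * d t) - (- (l\<^sup>2) * d t * (sin (l * t) / l) + cos (l * t) * l / l * d' t) = 0"
        using l by (simp add: power2_eq_square)
      ultimately show "(A has_real_derivative 0) (at t)" by simp
      have "(B has_real_derivative (d' t * sin (l * t) + cos (l * t) * l * d t) + (- (l\<^sup>2) * d t * (cos (l * t) / l) + - sin (l * t) * l / l * d' t)) (at t)"
        unfolding B_def using l by (intro DERIV_add DERIV_mult dd d2[OF t]) (auto intro!: derivative_eq_intros)
      moreover have "(d' t * sin (l * t) + cos (l * t) * l * d t) + (- (l\<^sup>2) * d t * (cos (l * t) / l) + - sin (l * t) * l / l * d' t) = 0"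
        using l by (simp add: power2_eq_square)
      ultimately show "(B has_real_derivative 0) (at t)" by simp
    qed
    have cA: "continuous_on {0..pi} A" "continuous_on {0..pi} B" unfolding A_def B_def using l
      by (intro continuous_intros dc dcc; simp)+
    show "A t = A 0"
      by (rule has_derivative_zero_unique_strong_interval[OF finZ cA(1) refl _ t])
        (use AD in \<open>auto simp: has_field_derivative_def lambda_zero intro: has_derivative_at_withinI\<close>)
    show "B t = B 0"
      by (rule has_derivative_zero_unique_strong_interval[OF finZ cA(2) refl _ t])
        (use BD in \<open>auto simp: has_field_derivative_def lambda_zero intro: has_derivative_at_withinI\<close>)
  qed
  define a e c s where "a = d 0" and "e = d' 0 / l" and "c = cos (l * pi)" and "s = sin (l * pi)"
  have cs: "c\<^sup>2 + s\<^sup>2 = 1" by (simp add: c_def s_def)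
  have dpi: "d pi = - a" "d' pi = - (l * e)" using anti[of 0] l by (simp_all add: a_def e_def)
  have E: "- a * c + e * s = a" "- a * s - e * c = e"
    using AB[of pi] l by (simp_all add: A_def B_def dpi a_def e_def c_def s_def)
  have "cos ((l - 1) * pi) < cos 0" using l by (intro cos_monotone_0_pi) auto
  moreover have "c = - cos ((l - 1) * pi)" unfolding c_def using cos_add[of "(l - 1) * pi" pi] by (simp add: algebra_simps)
  ultimately have c1: "1 + c > 0" by simp
  have "(2 * (1 + c)) * a = 0"
  proof -
    have "(1 + c) * ((1 + c) * a) = (1 + c) * (s * e)" using E(1) by (simp add: algebra_simps)
    also have "\<dots> = s * ((1 + c) * e)" by simp
    also have "(1 + c) * e = - s * a" using E(2) by (simp add: algebra_simps)
    finally have "((1 + c)\<^sup>2 + s\<^sup>2) * a = 0" by (simp add: algebra_simps power2_eq_square)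
    moreover have "(1 + c)\<^sup>2 + s\<^sup>2 = 2 * (1 + c)" using cs by (simp add: power2_eq_square algebra_simps)
    ultimately show ?thesis by simp
  qed
  then have a0: "a = 0" using c1 by simp
  then have "(1 + c) * e = 0" using E(2) by (simp add: algebra_simps)
  then have e0: "e = 0" using c1 by simp
  have d0: "d t = 0 \<and> d' t = 0" if "t \<in> {0..pi}" for t
  proof -
    have A0: "d t * cos (l * t) - d' t * (sin (l * t) / l) = 0" and B0: "d t * sin (l * t) + d' t * (cos (l * t) / l) = 0"
      using AB[OF that] a0 e0 l by (simp_all add: A_def B_def a_def e_def)
    define C S where "C = cos (l * t)" and "S = sin (l * t)"
    have CS: "C * C + S * S = 1" unfolding C_def S_def by (simp flip: power2_eq_square)
    have "(C * C + S * S) * d t = C * (d t * C - d' t * (S / l)) + S * (d t * S + d' t * (C / l))" by (simp add: algebra_simps)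
    then have "d t = 0" unfolding CS using A0 B0 by (simp add: C_def S_def)
    moreover have "(C * C + S * S) * (d' t / l) = C * (d t * S + d' t * (C / l)) - S * (d t * C - d' t * (S / l))" by (simp add: algebra_simps)
    then have "d' t / l = 0" unfolding CS using A0 B0 by (simp add: C_def S_def)
    ultimately show ?thesis using l by simp
  qed
  have "d t = 0 \<and> d' t = 0" for t
  proof -
    define n where "n = \<lfloor>t / pi\<rfloor>"
    have "of_int n \<le> t / pi" "t / pi < of_int n + 1" unfolding n_def by linarith+
    then have "of_int n * pi \<le> t" "t < (of_int n + 1) * pi" using pi_gt_zero by (simp_all only: pos_le_divide_eq pos_divide_less_eq)
    then have i: "t + pi * of_int (- n) \<in> {0..pi}" by (auto simp: algebra_simps)
    have p: "periodic pi (\<lambda>t. \<bar>d t\<bar>)" "periodic pi (\<lambda>t. \<bar>d' t\<bar>)" by (simp_all add: periodic_def anti)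
    show ?thesis using d0[OF i] periodic_int[OF p(1), of t "- n"] periodic_int[OF p(2), of t "- n"] by simp
  qed
  then show "periodic pi \<psi>" "periodic pi \<psi>'" by (simp_all add: periodic_def d_def d'_def)
qed

end

section \<open>Matching at the sinks\<close>

context stream begin

text \<open>At the points \<open>p \<plusminus> h e\<close> with \<open>h = r tan s\<close> the radius is the same and the angles are \<open>t \<plusminus> s\<close>. Apart from
  \<open>\<psi>'\<close> all terms of the central difference quotient converge.\<close>

lemma symmetric_gradient_difference:
  assumes r: "r > 0" and st: "V (r *\<^sub>R dir t) = 0" and A: "has_symmetric_gradient V A (r *\<^sub>R dir t)"
  obtains L where "((\<lambda>s. (\<psi>' (t + s) - \<psi>' (t - s)) / s) \<longlongrightarrow> L) (at 0)"
proof -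
  define c where "c s = (2 - \<alpha>) * sin (s - t) * \<psi> s + cos (s - t) * \<psi>' s" for s
  have cper: "periodic (2*pi) c" using per per' by (auto simp: periodic_def c_def sin_diff cos_diff)
  define L where "L = (A *v tang t) \<bullet> dir t"
  have lim: "((\<lambda>h. (V (r *\<^sub>R dir t + h *\<^sub>R tang t) \<bullet> dir t - V (r *\<^sub>R dir t - h *\<^sub>R tang t) \<bullet> dir t) / (2 * h)) \<longlongrightarrow> L) (at 0)"
    unfolding L_def
    using tendsto_inner[OF A[unfolded has_symmetric_gradient_def, rule_format, of "tang t"] tendsto_const[of "dir t"]]
    by (simp add: inner_diff_left)
  have near: "\<forall>\<^sub>F s in at 0. s \<in> {-(pi/2)<..<pi/2} - {0::real}" by (intro eventually_at_in_open) auto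
  have tanlim: "filterlim (\<lambda>s. r * tan s) (at 0) (at (0::real))"
    unfolding filterlim_at
  proof
    have "((\<lambda>s. r * tan s) \<longlongrightarrow> r * tan 0) (at (0::real))" by (intro tendsto_intros) auto
    then show "((\<lambda>s. r * tan s) \<longlongrightarrow> 0) (at (0::real))" by simp
    show "\<forall>\<^sub>F s in at 0. r * tan s \<in> UNIV \<and> r * tan s \<noteq> 0"
      using near
    proof eventually_elim
      case (elim s)
      then have "sin s \<noteq> 0" using sin_gt_zero[of s] sin_gt_zero[of "- s"] pi_gt_zero by (cases "s > 0") auto
      moreover have "cos s \<noteq> 0" using cos_gt_zero_pi[of s] elim by auto
      ultimately show ?case using r by (simp add: tan_def)
    qed
  qed
  have c0: "((\<lambda>s::real. cos s) \<longlongrightarrow> cos 0) (at 0)" by (intro tendsto_intros)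
  have s0: "((\<lambda>s::real. sin s / s) \<longlongrightarrow> 1) (at 0)"
    using DERIV_sin[of "0::real"] by (simp add: has_field_derivative_iff)
  have psi0: "((\<lambda>s. \<psi> (t + s) + \<psi> (t - s)) \<longlongrightarrow> \<psi> (t + 0) + \<psi> (t - 0)) (at 0)"
    by (intro tendsto_add isCont_tendsto_compose[OF DERIV_isCont[OF deriv]] tendsto_diff tendsto_const tendsto_ident_at)
  note lim2 = filterlim_compose[OF lim tanlim]
  have "((\<lambda>s. - ((V (r *\<^sub>R dir t + (r * tan s) *\<^sub>R tang t) \<bullet> dir t - V (r *\<^sub>R dir t - (r * tan s) *\<^sub>R tang t) \<bullet> dir t) / (2 * (r * tan s))
       * (2 * r * (sin s / s)) / cos s * (r / cos s) powr (\<alpha> - 1)) / cos s - (2 - \<alpha>) * (sin s / s) * (\<psi> (t + s) + \<psi> (t - s)) / cos s)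
     \<longlongrightarrow> - (L * (2 * r * 1) / cos 0 * (r / cos 0) powr (\<alpha> - 1)) / cos 0 - (2 - \<alpha>) * 1 * (\<psi> (t + 0) + \<psi> (t - 0)) / cos 0) (at 0)"
    using r by (intro tendsto_intros lim2 c0 s0 psi0) auto
  then obtain L' where "((\<lambda>s. - ((V (r *\<^sub>R dir t + (r * tan s) *\<^sub>R tang t) \<bullet> dir t - V (r *\<^sub>R dir t - (r * tan s) *\<^sub>R tang t) \<bullet> dir t) / (2 * (r * tan s))
       * (2 * r * (sin s / s)) / cos s * (r / cos s) powr (\<alpha> - 1)) / cos s - (2 - \<alpha>) * (sin s / s) * (\<psi> (t + s) + \<psi> (t - s)) / cos s)
     \<longlongrightarrow> L') (at 0)" by blast
  moreover have "\<forall>\<^sub>F s in at 0. - ((V (r *\<^sub>R dir t + (r * tan s) *\<^sub>R tang t) \<bullet> dir t - V (r *\<^sub>R dir t - (r * tan s) *\<^sub>R tang t) \<bullet> dir t) / (2 * (r * tan s))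
       * (2 * r * (sin s / s)) / cos s * (r / cos s) powr (\<alpha> - 1)) / cos s - (2 - \<alpha>) * (sin s / s) * (\<psi> (t + s) + \<psi> (t - s)) / cos s
     = (\<psi>' (t + s) - \<psi>' (t - s)) / s"
    using near
  proof eventually_elim
    case (elim s)
    then have s: "s \<noteq> 0" by simp
    have sin0: "sin s \<noteq> 0" using elim sin_gt_zero[of s] sin_gt_zero[of "- s"] pi_gt_zero by (cases "s > 0") auto
    have cos0: "cos s > 0" using cos_gt_zero_pi[of s] elim by auto
    define R where "R = r / cos s"
    have R: "R > 0" using r cos0 by (simp add: R_def)
    have t1: "r * tan s = R * sin s" and t2: "r = R * cos s" using cos0 by (simp_all add: R_def tan_def)
    have p1: "r *\<^sub>R dir t + (r * tan s) *\<^sub>R tang t = R *\<^sub>R dir (t + s)"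
      unfolding t1 by (subst t2) (simp add: vec2_eq_iff cos_add sin_add algebra_simps)
    have p2: "r *\<^sub>R dir t - (r * tan s) *\<^sub>R tang t = R *\<^sub>R dir (t - s)"
      unfolding t1 by (subst t2) (simp add: vec2_eq_iff cos_diff sin_diff algebra_simps)
    have in1: "dir (t + s) \<bullet> dir t = cos s" "dir (t - s) \<bullet> dir t = cos s"
      using cos_diff[of "t + s" t] cos_diff[of t "t - s"] by (simp_all add: inner_2 mult.commute)
    have v1: "V (R *\<^sub>R dir (t + s)) \<bullet> dir t - V (R *\<^sub>R dir (t - s)) \<bullet> dir t = - (R powr (1 - \<alpha>) * (c (t + s) - c (t - s)))"
      unfolding V_inner_dir c_def[symmetric] homog_dir[OF cper less_imp_le[OF R]] inner_scaleR_left in1 by (simp add: algebra_simps)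
    have cd: "c (t + s) - c (t - s) = (2 - \<alpha>) * sin s * (\<psi> (t + s) + \<psi> (t - s)) + cos s * (\<psi>' (t + s) - \<psi>' (t - s))"
      by (simp add: c_def algebra_simps)
    have RR: "R powr (1 - \<alpha>) * R powr (\<alpha> - 1) = 1" using R by (simp flip: powr_add)
    have e1: "- (R powr (1 - \<alpha>) * X) / (2 * (R * sin s)) * (2 * r * (sin s / s)) / cos s * R powr (\<alpha> - 1) = - (X / s)" for X
    proof -
      have "- (R powr (1 - \<alpha>) * X) / (2 * (R * sin s)) * (2 * r * (sin s / s)) / cos s * R powr (\<alpha> - 1)
         = - (R powr (1 - \<alpha>) * R powr (\<alpha> - 1)) * X * (r / (R * cos s)) / s"
        using sin0 R s cos0 by (simp add: field_simps)
      also have "r / (R * cos s) = 1" using t2 R cos0 by simp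
      finally show ?thesis unfolding RR by simp
    qed
    show ?case unfolding p1 p2 unfolding v1 t1 R_def[symmetric] unfolding e1 cd
      using s cos0 by (simp add: field_simps)
  qed
  ultimately have "((\<lambda>s. (\<psi>' (t + s) - \<psi>' (t - s)) / s) \<longlongrightarrow> L') (at 0)" by (rule Lim_transform_eventually)
  then show ?thesis by (rule that)
qed

end

context sectorial begin

text \<open>By the first integral on both sides, \<open>\<psi>'(t+s)\<^sup>2 - \<psi>'(t-s)\<^sup>2\<close> is of order \<open>(k\<^sub>1 - k\<^sub>2) s\<close>-to-the-\<open>2q\<close>, while the
  symmetric gradient forces it to be \<open>O(s)\<close>. As \<open>2q < 1\<close>, the two constants agree.\<close>

lemma matching:
  assumes grad: "gradient_at_stagnation_points V"
    and t: "\<psi> t = 0" "\<psi>' t < 0" and \<delta>: "\<delta> > 0"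
    and e1: "\<And>s. 0 < s \<Longrightarrow> s < \<delta> \<Longrightarrow> (\<psi>' (t + s))\<^sup>2 = \<sigma>2 - l2 * (\<psi> (t + s))\<^sup>2 + k1 / q * \<bar>\<psi> (t + s)\<bar> powr (2 * q)"
    and e2: "\<And>s. 0 < s \<Longrightarrow> s < \<delta> \<Longrightarrow> (\<psi>' (t - s))\<^sup>2 = \<sigma>2 - l2 * (\<psi> (t - s))\<^sup>2 + k2 / q * \<bar>\<psi> (t - s)\<bar> powr (2 * q)"
  shows "k1 = k2"
proof -
  have r: "stagnation_radius t > 0" "V (stagnation_radius t *\<^sub>R dir t) = 0" using stagnation_radius[OF t] by auto
  obtain A where A: "has_symmetric_gradient V A (stagnation_radius t *\<^sub>R dir t)"
    using grad r unfolding gradient_at_stagnation_points_def by (metis dir_nonzero less_irrefl scaleR_eq_0_iff)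
  obtain L where "((\<lambda>s. (\<psi>' (t + s) - \<psi>' (t - s)) / s) \<longlongrightarrow> L) (at 0)"
    using symmetric_gradient_difference[OF r A] .
  then have D: "((\<lambda>s. (\<psi>' (t + s) - \<psi>' (t - s)) / s) \<longlongrightarrow> L) (at_right 0)" by (rule tendsto_within_subset) auto
  have P: "((\<lambda>s. \<psi> (t + s) / s) \<longlongrightarrow> \<psi>' t) (at_right 0)"
  proof -
    have "((\<lambda>h. (\<psi> (t + h) - \<psi> t) / h) \<longlongrightarrow> \<psi>' t) (at 0)" using deriv[of t] by (simp add: DERIV_def)
    then have "((\<lambda>h. \<psi> (t + h) / h) \<longlongrightarrow> \<psi>' t) (at 0)" using t by simp
    then show ?thesis by (rule tendsto_within_subset) auto
  qed
  have N: "((\<lambda>s. \<psi> (t - s) / s) \<longlongrightarrow> - \<psi>' t) (at_right 0)"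
  proof -
    have "((\<lambda>s. \<psi> (t - s)) has_real_derivative \<psi>' (t - 0) * -1) (at 0)"
      by (rule DERIV_chain2[where f=\<psi> and g="\<lambda>s. t - s", OF deriv]) (auto intro!: derivative_eq_intros)
    then have "((\<lambda>h. (\<psi> (t - h) - \<psi> t) / h) \<longlongrightarrow> - \<psi>' t) (at 0)" by (simp add: has_field_derivative_iff)
    then have "((\<lambda>h. \<psi> (t - h) / h) \<longlongrightarrow> - \<psi>' t) (at 0)" using t by simp
    then show ?thesis by (rule tendsto_within_subset) auto
  qed
  have id0: "((\<lambda>s::real. s) \<longlongrightarrow> 0) (at_right 0)" by (rule tendsto_ident_at)
  have ev: "\<forall>\<^sub>F s in at_right 0. 0 < s \<and> s < \<delta>" using \<delta> by (intro eventually_at_rightI[of 0 \<delta>]) auto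
  have pw: "((\<lambda>s::real. s powr p) \<longlongrightarrow> 0) (at_right 0)" if "p > 0" for p
  proof -
    have "((\<lambda>s::real. s powr p) \<longlongrightarrow> 0 powr p) (at_right 0)"
      using that by (intro tendsto_powr' id0 tendsto_const) (auto intro: eventually_mono[OF ev])
    then show ?thesis by simp
  qed
  have sum: "((\<lambda>s. \<psi>' (t + s) + \<psi>' (t - s)) \<longlongrightarrow> \<psi>' t + \<psi>' t) (at_right 0)"
  proof -
    have "((\<lambda>s. \<psi>' (t + s) + \<psi>' (t - s)) \<longlongrightarrow> \<psi>' (t + 0) + \<psi>' (t - 0)) (at 0)"
      by (intro tendsto_add isCont_tendsto_compose[OF isCont'] tendsto_diff tendsto_const tendsto_ident_at)
    then have "((\<lambda>s. \<psi>' (t + s) + \<psi>' (t - s)) \<longlongrightarrow> \<psi>' t + \<psi>' t) (at 0)" by simp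
    then show ?thesis by (rule tendsto_within_subset) auto
  qed
  have \<sigma>: "- \<psi>' t > 0" using t by simp
  have l1: "((\<lambda>s. (\<psi>' (t + s) + \<psi>' (t - s)) * ((\<psi>' (t + s) - \<psi>' (t - s)) / s) * s powr (1 - 2 * q)
      + l2 * (((\<psi> (t + s) / s)\<^sup>2 - (\<psi> (t - s) / s)\<^sup>2) * s powr (2 - 2 * q)))
     \<longlongrightarrow> (\<psi>' t + \<psi>' t) * L * 0 + l2 * (((\<psi>' t)\<^sup>2 - (- \<psi>' t)\<^sup>2) * 0)) (at_right 0)"
    using q \<beta> q_\<beta> by (intro tendsto_intros sum D P N pw) auto
  have l2: "((\<lambda>s. k1 / q * \<bar>\<psi> (t + s) / s\<bar> powr (2 * q) - k2 / q * \<bar>\<psi> (t - s) / s\<bar> powr (2 * q))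
     \<longlongrightarrow> k1 / q * \<bar>\<psi>' t\<bar> powr (2 * q) - k2 / q * \<bar>- \<psi>' t\<bar> powr (2 * q)) (at_right 0)"
    using t by (intro tendsto_intros P N tendsto_powr) auto
  have eq: "\<forall>\<^sub>F s in at_right 0. (\<psi>' (t + s) + \<psi>' (t - s)) * ((\<psi>' (t + s) - \<psi>' (t - s)) / s) * s powr (1 - 2 * q)
      + l2 * (((\<psi> (t + s) / s)\<^sup>2 - (\<psi> (t - s) / s)\<^sup>2) * s powr (2 - 2 * q))
     = k1 / q * \<bar>\<psi> (t + s) / s\<bar> powr (2 * q) - k2 / q * \<bar>\<psi> (t - s) / s\<bar> powr (2 * q)"
    using ev
  proof eventually_elim
    case (elim s)
    then have s: "s > 0" "s < \<delta>" by auto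
    define z where "z = s powr (- (2 * q))"
    have z1: "s powr (1 - 2 * q) = s * z" "s powr (2 - 2 * q) = s\<^sup>2 * z"
      using s by (simp_all add: z_def powr_diff powr_minus field_simps flip: powr_numeral)
    have z2: "\<bar>y / s\<bar> powr (2 * q) = \<bar>y\<bar> powr (2 * q) * z" for y
      using s by (simp add: z_def abs_divide powr_divide powr_minus_divide)
    have "(\<psi>' (t + s) + \<psi>' (t - s)) * ((\<psi>' (t + s) - \<psi>' (t - s)) / s) * (s * z) = ((\<psi>' (t + s))\<^sup>2 - (\<psi>' (t - s))\<^sup>2) * z"
    proof -
      have "(\<psi>' (t + s) + \<psi>' (t - s)) * ((\<psi>' (t + s) - \<psi>' (t - s)) / s) * (s * z) = (\<psi>' (t + s) + \<psi>' (t - s)) * (\<psi>' (t + s) - \<psi>' (t - s)) * z"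
        using s by simp
      then show ?thesis by (simp add: power2_eq_square algebra_simps)
    qed
    moreover have "l2 * (((\<psi> (t + s) / s)\<^sup>2 - (\<psi> (t - s) / s)\<^sup>2) * (s\<^sup>2 * z)) = l2 * ((\<psi> (t + s))\<^sup>2 - (\<psi> (t - s))\<^sup>2) * z"
      using s by (simp add: power_divide field_simps)
    ultimately show ?case unfolding z1 z2 e1[OF s] e2[OF s] by (simp add: algebra_simps)
  qed
  have "(\<psi>' t + \<psi>' t) * L * 0 + l2 * (((\<psi>' t)\<^sup>2 - (- \<psi>' t)\<^sup>2) * 0) = k1 / q * \<bar>\<psi>' t\<bar> powr (2 * q) - k2 / q * \<bar>- \<psi>' t\<bar> powr (2 * q)"
    by (rule tendsto_unique[OF trivial_limit_at_right_real Lim_transform_eventually[OF l1 eq] l2])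
  then have "(k1 - k2) * (\<bar>\<psi>' t\<bar> powr (2 * q) / q) = 0" by (auto simp: algebra_simps diff_divide_distrib)
  moreover have "\<bar>\<psi>' t\<bar> powr (2 * q) / q \<noteq> 0" using t q by simp
  ultimately show ?thesis by simp
qed

text \<open>Symmetry pairs the two sinks, so a half turn from one sink to the other consists of two arcs. They
  have the same end slope, and by matching at the sink the same constant, hence the same opening angle,
  which is therefore \<open>\<pi>/2\<close>.\<close>

theorem two_sink_structure:
  assumes grad: "gradient_at_stagnation_points V" and card: "card {p. is_sink V p} = 2"
    and w: "\<And>t. w (t + pi) = w t"
  obtains t0 m K where "m > 0" "(2 - \<alpha>)\<^sup>2 + K > 0" "travel (2 - \<alpha>) q K pi = pi / 2"
    "\<And>t. \<psi> t = - m * pruefer.S (2 - \<alpha>) q K (t - t0)"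
proof -
  let ?l = "2 - \<alpha>"
  have fin: "finite {p. is_sink V p}" using card card.infinite by fastforce
  have "{p. is_sink V p} \<noteq> {}" using card by (metis card.empty zero_neq_numeral)
  then obtain p where "p \<noteq> 0" "V p = 0" using is_sink_iff[OF grad] by blast
  then obtain t0 where t0: "\<psi> t0 = 0" "\<psi>' t0 < 0" using stagnation_pointE[of p] by metis
  define \<sigma> where "\<sigma> = - \<psi>' t0"
  have \<sigma>: "\<sigma> > 0" using t0 by (simp add: \<sigma>_def)
  have t0': "\<psi>' t0 \<noteq> 0" using t0 by simp
  note pp = pi_periodic[OF t0(1) t0' w]
  have t0pi: "\<psi> (t0 + pi) = 0" "\<psi>' (t0 + pi) = - \<sigma>" using pp t0 by (simp_all add: periodic_def \<sigma>_def)
  have m1: "(-1::real) = 1 \<or> (-1::real) = -1" and one: "(1::real) = 1 \<or> (1::real) = -1" by auto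
  obtain t1 where t1: "t0 < t1" "t1 \<le> t0 + pi" "\<psi> t1 = 0" "\<And>x. t0 < x \<Longrightarrow> x < t1 \<Longrightarrow> -1 * \<psi> x > 0"
    using next_zero[OF \<psi>_isCont t0(1) deriv m1 _ _ t0pi(1)] t0 by auto
  have s1: "-1 * \<psi>' t0 = \<sigma>" by (simp add: \<sigma>_def)
  obtain ma Ka ka where a: "ma > 0" "?l\<^sup>2 + Ka > 0" "\<sigma>\<^sup>2 = ma\<^sup>2 * (?l\<^sup>2 + Ka)" "ka = - q * Ka * ma powr (2 - 2 * q)"
    "t1 - t0 = travel ?l q Ka pi" "\<And>x. x \<in> {t0..t1} \<Longrightarrow> -1 * \<psi> x = ma * pruefer.S ?l q Ka (x - t0)"
    "-1 * \<psi>' t1 = - \<sigma>"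
    "\<And>x. x \<in> {t0..t1} \<Longrightarrow> (\<psi>' x)\<^sup>2 = \<sigma>\<^sup>2 - ?l\<^sup>2 * (\<psi> x)\<^sup>2 + ka / q * \<bar>\<psi> x\<bar> powr (2 * q)"
    using sector_arc[OF m1 t1(1) t0(1) t1(3) t1(4) \<sigma> s1] by blast
  have d1: "1 * \<psi>' t1 = \<sigma>" using a(7) by simp
  have "t1 \<noteq> t0 + pi" using t0pi(2) d1 \<sigma> by auto
  then have t1pi: "t1 < t0 + pi" using t1(2) by simp
  obtain t2 where t2: "t1 < t2" "t2 \<le> t0 + pi" "\<psi> t2 = 0" "\<And>x. t1 < x \<Longrightarrow> x < t2 \<Longrightarrow> 1 * \<psi> x > 0"
    using next_zero[OF \<psi>_isCont t1(3) deriv one _ t1pi t0pi(1)] d1 \<sigma> by auto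
  obtain mb Kb kb where b: "mb > 0" "?l\<^sup>2 + Kb > 0" "\<sigma>\<^sup>2 = mb\<^sup>2 * (?l\<^sup>2 + Kb)" "kb = - q * Kb * mb powr (2 - 2 * q)"
    "t2 - t1 = travel ?l q Kb pi" "\<And>x. x \<in> {t1..t2} \<Longrightarrow> 1 * \<psi> x = mb * pruefer.S ?l q Kb (x - t1)"
    "1 * \<psi>' t2 = - \<sigma>"
    "\<And>x. x \<in> {t1..t2} \<Longrightarrow> (\<psi>' x)\<^sup>2 = \<sigma>\<^sup>2 - ?l\<^sup>2 * (\<psi> x)\<^sup>2 + kb / q * \<bar>\<psi> x\<bar> powr (2 * q)"
    using sector_arc[OF one t2(1) t1(3) t2(3) t2(4) \<sigma> d1] by blast
  \<comment> \<open>A decreasing zero before the end of the half turn would give a third sink.\<close>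
  have t2pi: "t2 = t0 + pi"
  proof (rule ccontr)
    assume "t2 \<noteq> t0 + pi"
    then have lt: "t0 < t2" "t2 < t0 + pi" using t2 t1 by auto
    define R where "R = stagnation_radius t0"
    have Rs: "stagnation_radius t2 = R" "stagnation_radius (t0 + pi) = R"
      using b(7) t0pi(2) by (simp_all add: R_def stagnation_radius_def \<sigma>_def)
    have R: "R > 0" using stagnation_radius[OF t0] by (simp add: R_def)
    have sk: "is_sink V (R *\<^sub>R dir t0)" "is_sink V (R *\<^sub>R dir (t0 + pi))" "is_sink V (R *\<^sub>R dir t2)"
      using stagnation_radius(2)[OF t0] stagnation_radius(2)[of "t0 + pi"] stagnation_radius(2)[of t2] t0pi t2(3) b(7) \<sigma> R
      unfolding is_sink_iff[OF grad] Rs R_def[symmetric] by auto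
    have "dir t2 \<bullet> tang t0 = sin (t2 - t0)" by (simp add: inner_2 sin_diff algebra_simps)
    moreover have "sin (t2 - t0) > 0" using lt by (intro sin_gt_zero) auto
    ultimately have n1: "dir t2 \<noteq> dir t0" "dir t2 \<noteq> dir (t0 + pi)" by auto
    have n2: "dir t0 \<noteq> dir (t0 + pi)"
    proof
      assume e: "dir t0 = dir (t0 + pi)"
      have "dir (t0 + pi) \<bullet> dir t0 = -1" by simp
      moreover have "dir (t0 + pi) \<bullet> dir t0 = 1" unfolding e[symmetric] by simp
      ultimately show False by simp
    qed
    have "R \<noteq> 0" using R by simp
    then have "R *\<^sub>R dir t2 \<noteq> R *\<^sub>R dir t0" "R *\<^sub>R dir t2 \<noteq> R *\<^sub>R dir (t0 + pi)" "R *\<^sub>R dir t0 \<noteq> R *\<^sub>R dir (t0 + pi)"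
      using n1 n2 by (simp_all only: scaleR_cancel_left) auto
    then have "card {R *\<^sub>R dir t0, R *\<^sub>R dir (t0 + pi), R *\<^sub>R dir t2} = 3"
      unfolding card_3_iff by blast
    moreover have "card {R *\<^sub>R dir t0, R *\<^sub>R dir (t0 + pi), R *\<^sub>R dir t2} \<le> card {p. is_sink V p}"
      by (rule card_mono[OF fin]) (use sk in auto)
    ultimately show False using card by simp
  qed
  define \<delta> where "\<delta> = min (t1 - t0) (t2 - t1)"
  have \<delta>: "\<delta> > 0" using t1 t2 by (simp add: \<delta>_def)
  have "ka = kb"
  proof (rule matching[OF grad t0 \<delta>])
    fix s assume s: "0 < s" "s < \<delta>"
    then show "(\<psi>' (t0 + s))\<^sup>2 = \<sigma>\<^sup>2 - ?l\<^sup>2 * (\<psi> (t0 + s))\<^sup>2 + ka / q * \<bar>\<psi> (t0 + s)\<bar> powr (2 * q)"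
      by (intro a(8)) (auto simp: \<delta>_def)
    have "(\<psi>' (t2 - s))\<^sup>2 = \<sigma>\<^sup>2 - ?l\<^sup>2 * (\<psi> (t2 - s))\<^sup>2 + kb / q * \<bar>\<psi> (t2 - s)\<bar> powr (2 * q)"
      using s by (intro b(8)) (auto simp: \<delta>_def)
    moreover have "\<psi> (t2 - s) = \<psi> (t0 - s)" "\<psi>' (t2 - s) = \<psi>' (t0 - s)"
      using pp unfolding periodic_def t2pi by (metis add_diff_eq diff_add_eq)+
    ultimately show "(\<psi>' (t0 - s))\<^sup>2 = \<sigma>\<^sup>2 - ?l\<^sup>2 * (\<psi> (t0 - s))\<^sup>2 + kb / q * \<bar>\<psi> (t0 - s)\<bar> powr (2 * q)" by simp
  qed
  have l: "?l > 0" using \<alpha> by simp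
  have mK: "mb = ma" "Kb = Ka"
    using arc_parameters_unique[OF q l \<sigma> b(1) b(3) b(4) a(1) a(3)] a(4) \<open>ka = kb\<close> by auto
  have T: "travel ?l q Ka pi = pi / 2" and t1e: "t1 = t0 + pi / 2"
    using a(5) b(5) t2pi unfolding mK by (simp_all add: field_simps)
  interpret P: pruefer ?l q Ka using q l a(2) by unfold_locales
  have on: "\<psi> t = - ma * P.S (t - t0)" if t: "t \<in> {t0..t0 + pi}" for t
  proof (cases "t \<le> t1")
    case True
    then show ?thesis using a(6)[of t] t by simp
  next
    case False
    then have "\<psi> t = ma * P.S (t - t1)" using b(6)[of t] t t2pi unfolding mK by simp
    moreover have "P.S ((t - t1) + pi / 2) = - P.S (t - t1)" using P.S_add[of "t - t1"] unfolding T .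
    moreover have "(t - t1) + pi / 2 = t - t0" using t1e by simp
    ultimately show ?thesis by simp
  qed
  have "\<psi> t = - ma * P.S (t - t0)" for t
  proof -
    define n where "n = \<lfloor>(t - t0) / pi\<rfloor>"
    have "of_int n \<le> (t - t0) / pi" "(t - t0) / pi < of_int n + 1" unfolding n_def by linarith+
    then have "of_int n * pi \<le> t - t0" "t - t0 < (of_int n + 1) * pi" using pi_gt_zero by (simp_all only: pos_le_divide_eq pos_divide_less_eq)
    then have i: "t + pi * of_int (- n) \<in> {t0..t0 + pi}" by (auto simp: algebra_simps)
    have "P.S (y + pi) = P.S y" for y
      using P.S_add[of y] P.S_add[of "y + pi / 2"] unfolding T by (simp add: add.assoc)
    then have pS: "periodic pi P.S" by (simp add: periodic_def)
    have "\<psi> t = \<psi> (t + pi * of_int (- n))" using periodic_int[OF pp(1), of t "- n"] by simp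
    also have "\<dots> = - ma * P.S ((t - t0) + pi * of_int (- n))" using on[OF i] by (simp add: algebra_simps)
    also have "\<dots> = - ma * P.S (t - t0)" using periodic_int[OF pS, of "t - t0" "- n"] by simp
    finally show ?thesis .
  qed
  then show ?thesis using that[OF a(1) a(2) T, of t0] by blast
qed

end

section \<open>Existence and uniqueness\<close>

context pruefer begin

text \<open>On the first eighth of a turn \<open>\<Phi> t \<ge> l t \<ge> t\<close> because the speed is at least \<open>l\<close>; the rest follows from the
  symmetries.\<close>

lemma S_lower:
  assumes K0: "K \<ge> 0" and l1: "l \<ge> 1" and T: "\<Theta> pi = pi / 2"
  shows "\<bar>sin t * cos t\<bar> \<le> \<bar>S t\<bar>"
proof -
  have Gl: "G s \<ge> l" for s
  proof -
    have "diffquot q ((sin s)\<^sup>2) \<ge> 0" using diffquot_bounds[OF q, of "(sin s)\<^sup>2"] sin_sq_01[of s] q by auto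
    then have "l\<^sup>2 \<le> l\<^sup>2 + K * diffquot q ((sin s)\<^sup>2)" using K0 by simp
    then show ?thesis unfolding speed_def by (rule real_le_rsqrt)
  qed
  have \<Phi>l: "\<Phi> t \<ge> l * t" if "t \<ge> 0" for t
  proof -
    have "\<Phi> 0 - l * 0 \<le> \<Phi> t - l * t"
    proof (rule DERIV_nonneg_imp_nondecreasing[OF that, of "\<lambda>t. \<Phi> t - l * t"])
      fix x :: real
      have "((\<lambda>t. \<Phi> t - l * t) has_real_derivative G (\<Phi> x) - l * 1) (at x)"
        by (intro DERIV_diff inv_deriv DERIV_cmult DERIV_ident)
      then show "\<exists>y. ((\<lambda>t. \<Phi> t - l * t) has_real_derivative y) (at x) \<and> y \<ge> 0" using Gl[of "\<Phi> x"] by auto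
    qed
    then show ?thesis by simp
  qed
  have T2: "\<Theta> (pi / 2) = pi / 4" using travel_pi_half T by simp
  have first: "\<bar>sin t * cos t\<bar> \<le> \<bar>S t\<bar>" if t: "0 \<le> t" "t \<le> pi / 4" for t
  proof -
    have "\<not> \<Phi> (\<Theta> (pi / 2)) < \<Phi> t" unfolding inv_less_iff using t T2 by simp
    then have up: "\<Phi> t \<le> pi / 2" by simp
    have "t \<le> l * t" using l1 t by (simp add: mult_le_cancel_right1)
    then have "t \<le> \<Phi> t" using \<Phi>l[OF t(1)] by linarith
    then have s: "sin t \<le> S t" unfolding S_def using up t by (intro sin_monotone_2pi_le) auto
    have "0 \<le> sin t" "0 \<le> cos t" using t by (auto intro!: sin_ge_zero cos_ge_zero)
    then have "\<bar>sin t * cos t\<bar> \<le> sin t" by (simp add: abs_mult mult_left_le)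
    then show ?thesis using s by simp
  qed
  have half: "\<bar>sin t * cos t\<bar> \<le> \<bar>S t\<bar>" if t: "0 \<le> t" "t \<le> pi / 2" for t
  proof (cases "t \<le> pi / 4")
    case False
    then have "\<bar>sin (pi / 2 - t) * cos (pi / 2 - t)\<bar> \<le> \<bar>S (pi / 2 - t)\<bar>" using t by (intro first) auto
    moreover have "S (pi / 2 - t) = S t" using S_diff[of t] unfolding T .
    moreover have "sin (pi / 2 - t) = cos t" "cos (pi / 2 - t) = sin t" by (simp_all add: sin_diff cos_diff)
    ultimately show ?thesis by (simp add: mult.commute)
  qed (use t first in simp)
  define n where "n = \<lfloor>t / (pi / 2)\<rfloor>"
  have "of_int n \<le> t / (pi / 2)" "t / (pi / 2) < of_int n + 1" unfolding n_def by linarith+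
  then have "of_int n * (pi / 2) \<le> t" "t < (of_int n + 1) * (pi / 2)"
    using pi_half_gt_zero by (simp_all only: pos_le_divide_eq pos_divide_less_eq)
  then have i: "0 \<le> t + (pi / 2) * of_int (- n)" "t + (pi / 2) * of_int (- n) \<le> pi / 2" by (auto simp: algebra_simps)
  have p1: "periodic (pi / 2) (\<lambda>t. \<bar>S t\<bar>)" unfolding periodic_def using S_add T by simp
  have p2: "periodic (pi / 2) (\<lambda>t. \<bar>sin t * cos t\<bar>)" by (simp add: periodic_def sin_add cos_add abs_mult mult.commute)
  show ?thesis using half[OF i] periodic_int[OF p1, of t "- n"] periodic_int[OF p2, of t "- n"] by simp
qed

end

lemma solution_pruefer:
  assumes \<alpha>: "0 < \<alpha>" "\<alpha> < 1" and K: "K > 0" and q: "q = (1 - \<alpha>) / (2 - \<alpha>)"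
    and T: "travel (2 - \<alpha>) q K pi = pi / 2"
  shows "solution \<alpha> (pruefer.S (2 - \<alpha>) q K) (pruefer.S' (2 - \<alpha>) q K) K q (\<alpha> / (2 - \<alpha>))"
proof -
  have q01: "0 < q" "q < 1" using \<alpha> by (auto simp: q field_simps)
  interpret P: pruefer "2 - \<alpha>" q K using q01 \<alpha> K by unfold_locales (auto simp: add_pos_pos)
  have S4: "P.S (t + pi / 2) = - P.S t" for t using P.S_add[of t] unfolding T .
  have S'4: "P.S' (t + pi / 2) = - P.S' t" for t using P.S'_add[of t] unfolding T .
  have per: "P.S (t + 2 * pi) = P.S t" for t
    using S4[of t] S4[of "t + pi/2"] S4[of "t + pi/2 + pi/2"] S4[of "t + pi/2 + pi/2 + pi/2"] by (simp add: algebra_simps)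
  show ?thesis
  proof -
    have l: "2 - \<alpha> \<ge> 1" using \<alpha> by simp
    have low: "\<bar>sin t * cos t\<bar> \<le> \<bar>P.S t\<bar>" for t by (rule P.S_lower[OF less_imp_le[OF K] l T])
    have S'0: "P.S' 0 > 0" using K \<alpha> by (simp add: P.S'_0 add_pos_pos)
    show ?thesis
      by unfold_locales
        (use \<alpha> K q per S4 S'4 low S'0 P.S_deriv P.S'_continuous P.S_minus P.S_le_1 P.S_deriv2 in \<open>auto simp: periodic_def\<close>)
  qed
qed

text \<open>Restriction to the unit circle turns the pointwise equations into the angular ones, by the chain
  rule; at the zeros of \<open>\<psi>\<close> the convention \<open>\<Omega> = 0\<close> fixes \<open>w\<close>.\<close>

lemma profile_sectorial:
  assumes \<alpha>: "0 < \<alpha>" "\<alpha> < 1" and H: "homogeneous_profile \<alpha> \<Omega> \<Psi>"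
  obtains \<psi> \<psi>' w where "sectorial \<alpha> \<psi> \<psi>' w ((1 - \<alpha>) / (2 - \<alpha>)) (\<alpha> / (2 - \<alpha>))"
    "\<Psi> = homog (2 - \<alpha>) \<psi>" "\<And>t. w t = \<Omega> (dir t)" "\<And>r t. r > 0 \<Longrightarrow> \<Omega> (r *\<^sub>R dir t) = r powr (- \<alpha>) * w t"
    "\<Omega> 0 = 0" "\<And>t. \<psi> t = 0 \<Longrightarrow> w t = 0"
proof -
  have ss: "self_similar_profile \<alpha> \<Omega> \<Psi>" and sc: "\<And>r x. r > 0 \<Longrightarrow> \<Omega> (r *\<^sub>R x) = r powr (- \<alpha>) * \<Omega> x"
    using H unfolding homogeneous_profile_def by auto
  obtain \<psi> where \<psi>: "\<forall>t. \<psi> (t + 2 * pi) = \<psi> t"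
    "\<forall>r t. r \<ge> 0 \<longrightarrow> \<Psi> (vector [r * cos t, r * sin t]) = r powr (2 - \<alpha>) * \<psi> t"
    using H unfolding homogeneous_profile_def by blast
  have per: "\<psi> (t + 2 * pi) = \<psi> t" for t using \<psi>(1) by blast
  have pol: "\<Psi> (vector [r * cos t, r * sin t]) = r powr (2 - \<alpha>) * \<psi> t" if "r \<ge> 0" for r t using \<psi>(2) that by blast
  have vd: "vector [r * cos t, r * sin t] = r *\<^sub>R dir t" for r t by (simp add: vec2_eq_iff)
  have pol': "\<Psi> (r *\<^sub>R dir t) = r powr (2 - \<alpha>) * \<psi> t" if "r \<ge> 0" for r t using pol[OF that, of t] unfolding vd .
  have per': "periodic (2*pi) \<psi>" using per by (simp add: periodic_def)
  have \<Psi>: "\<Psi> = homog (2 - \<alpha>) \<psi>"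
  proof
    fix x obtain r t where r: "r \<ge> 0" "x = r *\<^sub>R dir t" by (rule polarE)
    show "\<Psi> x = homog (2 - \<alpha>) \<psi> x" unfolding r(2) pol'[OF r(1)] homog_dir[OF per' r(1)] ..
  qed
  have \<psi>e: "\<psi> t = \<Psi> (dir t)" for t using pol'[of 1 t] by simp
  define \<psi>' where "\<psi>' t = grad \<Psi> (dir t) \<bullet> tang t" for t
  have diff: "\<Psi> differentiable (at x)" for x using ss unfolding self_similar_profile_def by auto
  have gc: "continuous_on UNIV (grad \<Psi>)" using ss unfolding self_similar_profile_def by auto
  have dcont: "continuous_on UNIV dir" "continuous_on UNIV tang"
    using dir_differentiable
    by (auto intro!: continuous_at_imp_continuous_on differentiable_imp_continuous_within)
  have dpsi: "(\<psi> has_real_derivative \<psi>' t) (at t)" for t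
  proof -
    obtain f' where f': "(\<Psi> has_derivative f') (at (dir t))" using diff by (auto simp: differentiable_def)
    interpret f': bounded_linear f' using f' by (rule has_derivative_bounded_linear)
    have "(dir has_derivative (\<lambda>h. h *\<^sub>R tang t)) (at t)" using dir_has_vector_derivative by (simp add: has_vector_derivative_def)
    from has_derivative_compose[OF this f'] have "(\<psi> has_derivative (\<lambda>h. f' (h *\<^sub>R tang t))) (at t)" unfolding \<psi>e[abs_def] .
    then have "(\<psi> has_real_derivative f' (tang t)) (at t)" by (simp add: has_field_derivative_def f'.scaleR mult_commute_abs)
    moreover have "f' (tang t) = \<psi>' t"
    proof -
      have "tang t = tang t $ 1 *\<^sub>R axis 1 1 + tang t $ 2 *\<^sub>R axis 2 1" by (simp add: vec2_eq_iff)
      then have "f' (tang t) = tang t $ 1 * f' (axis 1 1) + tang t $ 2 * f' (axis 2 1)" by (metis f'.add f'.scaleR real_scaleR_def)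
      then show ?thesis by (simp add: \<psi>'_def inner_2 grad_eqI[OF f'] mult.commute)
    qed
    ultimately show ?thesis by simp
  qed
  interpret stream \<alpha> \<psi> \<psi>'
    using \<alpha> per' dpsi
    by unfold_locales (auto simp: \<psi>'_def[abs_def] intro!: continuous_intros continuous_on_compose2[OF gc] dcont)
  define w where "w t = \<Omega> (dir t)" for t
  have perw: "periodic (2*pi) w" by (simp add: periodic_def w_def)
  have z: "\<Psi> x = 0 \<Longrightarrow> \<Omega> x = 0" for x using ss unfolding self_similar_profile_def by auto
  have \<Omega>0: "\<Omega> 0 = 0" by (rule z) (simp add: \<Psi>)
  have w0: "w t = 0" if "\<psi> t = 0" for t unfolding w_def by (rule z) (simp add: \<psi>e[symmetric] that)
  have \<Omega>: "\<Omega> = homog (- \<alpha>) w"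
  proof
    fix x obtain r t where r: "r \<ge> 0" "x = r *\<^sub>R dir t" by (rule polarE)
    show "\<Omega> x = homog (- \<alpha>) w x"
    proof (cases "r = 0")
      case False
      then show ?thesis unfolding r(2) homog_dir[OF perw r(1)] using sc[of r "dir t"] r(1) by (simp add: w_def)
    qed (simp add: r \<Omega>0)
  qed
  have nz: "grad \<Psi> differentiable (at (dir t))" "laplacian \<Psi> (dir t) = w t" "\<Omega> differentiable (at (dir t))"
      "pseudo_velocity \<alpha> \<Psi> (dir t) \<bullet> grad \<Omega> (dir t) = w t" if "\<psi> t \<noteq> 0" for t
    using ss that unfolding self_similar_profile_def \<psi>e w_def by auto
  have "sectorial \<alpha> \<psi> \<psi>' w ((1 - \<alpha>) / (2 - \<alpha>)) (\<alpha> / (2 - \<alpha>))"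
  proof (unfold_locales, goal_cases)
    case (3 t)
    obtain c where c: "(\<psi>' has_real_derivative c) (at t)" using grad_differentiable_imp nz(1)[OF 3] unfolding \<Psi> by blast
    have "w t = c + (2 - \<alpha>)\<^sup>2 * \<psi> t" using stream_laplacian(4)[OF c, of 1] nz(2)[OF 3] unfolding \<Psi> by simp
    then show ?case using c by simp
  next
    case (4 t)
    have "(\<lambda>s. \<Omega> (dir s)) differentiable (at t)"
      using differentiable_chain_at[OF dir_differentiable(1) nz(3)[OF 4]] by (simp add: o_def)
    then obtain w' where w': "(w has_real_derivative w') (at t)" unfolding w_def[abs_def] by (auto simp: real_differentiable_def)
    have "\<alpha> * \<psi>' t * w t + (2 - \<alpha>) * \<psi> t * w' = 0"
      using transport[OF perw w', of 1] nz(4)[OF 4] homog_dir[OF perw, of 1 "- \<alpha>" t] unfolding \<Psi> \<Omega> by simp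
    then show ?case using w' by blast
  qed auto
  then show ?thesis
  proof (rule that[OF _ \<Psi>])
    show "w t = \<Omega> (dir t)" for t by (simp add: w_def)
    show "\<Omega> (r *\<^sub>R dir t) = r powr (- \<alpha>) * w t" if "r > 0" for r t using sc[OF that, of "dir t"] by (simp add: w_def)
  qed (use \<Omega>0 w0 in auto)
qed

definition rot :: "real \<Rightarrow> real^2 \<Rightarrow> real^2" where
  "rot a x = vector [cos a * x $ 1 - sin a * x $ 2, sin a * x $ 1 + cos a * x $ 2]"

lemma rot_nth [simp]: "rot a x $ 1 = cos a * x $ 1 - sin a * x $ 2" "rot a x $ 2 = sin a * x $ 1 + cos a * x $ 2"
  by (simp_all add: rot_def)

lemma rot_dir: "rot a (r *\<^sub>R dir t) = r *\<^sub>R dir (a + t)"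
  by (simp add: vec2_eq_iff cos_add sin_add algebra_simps)

lemma rot_orthogonal: "orthogonal_transformation (rot a)"
proof -
  have lin: "linear (rot a)" by (rule linearI) (simp_all add: vec2_eq_iff algebra_simps)
  have "rot a v \<bullet> rot a u = v \<bullet> u" for u v
  proof -
    define C S where "C = cos a" and "S = sin a"
    have cs: "C * C + S * S = 1" unfolding C_def S_def by (simp flip: power2_eq_square)
    have "rot a v \<bullet> rot a u = (C * C + S * S) * (v \<bullet> u)" by (simp add: inner_2 C_def[symmetric] S_def[symmetric] algebra_simps)
    then show ?thesis unfolding cs by simp
  qed
  then show ?thesis using lin by (simp add: orthogonal_transformation_def)
qed

lemma det_rot: "det (matrix (rot a)) = 1"
  by (simp add: det_2 matrix_def flip: power2_eq_square)

theorem mainTheorem1: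
  fixes \<alpha> :: real
  assumes "0 < \<alpha>" and "\<alpha> < 1"
  shows "(\<exists>\<Omega> \<Psi>. sink_saddle_profile \<alpha> \<Omega> \<Psi>) \<and>
    (\<exists>\<Omega>\<^sub>0 \<Psi>\<^sub>0. two_sink_profile \<alpha> \<Omega>\<^sub>0 \<Psi>\<^sub>0 \<and>
       (\<forall>\<Omega> \<Psi>. two_sink_profile \<alpha> \<Omega> \<Psi> \<longrightarrow>
          (\<exists>s>0. isometric_profiles (\<lambda>x. \<Omega>\<^sub>0 (s *\<^sub>R x)) \<Omega>)))"
proof -
  define q where "q = (1 - \<alpha>) / (2 - \<alpha>)"
  have q: "0 < q" "q < 1" using assms by (auto simp: q_def field_simps)
  have l: "1 < 2 - \<alpha>" "2 - \<alpha> < 2" using assms by auto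
  obtain K where K: "K > 0" "travel (2 - \<alpha>) q K pi = pi / 2" using travel_period_half_pi[OF q l] .
  interpret S: solution \<alpha> "pruefer.S (2 - \<alpha>) q K" "pruefer.S' (2 - \<alpha>) q K" K q "\<alpha> / (2 - \<alpha>)"
    by (rule solution_pruefer[OF assms K(1) q_def K(2)])
  interpret P: pruefer "2 - \<alpha>" q K using q K l by unfold_locales (auto simp: add_pos_pos)
  have "\<exists>s>0. isometric_profiles (\<lambda>x. S.\<Omega> (s *\<^sub>R x)) \<Omega>" if two: "two_sink_profile \<alpha> \<Omega> \<Psi>" for \<Omega> \<Psi>
  proof -
    have hom: "homogeneous_profile \<alpha> \<Omega> \<Psi>" and grad: "gradient_at_stagnation_points (pseudo_velocity \<alpha> \<Psi>)"
      and card: "card {p. is_sink (pseudo_velocity \<alpha> \<Psi>) p} = 2" and sym: "two_fold_symmetric \<Omega>"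
      using two unfolding two_sink_profile_def sink_saddle_profile_def by auto
    obtain \<psi> \<psi>' w where sec: "sectorial \<alpha> \<psi> \<psi>' w ((1 - \<alpha>) / (2 - \<alpha>)) (\<alpha> / (2 - \<alpha>))"
      and \<Psi>: "\<Psi> = homog (2 - \<alpha>) \<psi>" and w: "\<And>t. w t = \<Omega> (dir t)"
      and \<Omega>: "\<And>r t. r > 0 \<Longrightarrow> \<Omega> (r *\<^sub>R dir t) = r powr (- \<alpha>) * w t" "\<Omega> 0 = 0" "\<And>t. \<psi> t = 0 \<Longrightarrow> w t = 0"
      using profile_sectorial[OF assms hom] by metis
    interpret U: sectorial \<alpha> \<psi> \<psi>' w q "\<alpha> / (2 - \<alpha>)" using sec unfolding q_def .
    have wpi: "w (t + pi) = w t" for t using sym unfolding two_fold_symmetric_def w by simp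
    obtain t0 m K' where U: "m > 0" "(2 - \<alpha>)\<^sup>2 + K' > 0" "travel (2 - \<alpha>) q K' pi = pi / 2"
      "\<And>t. \<psi> t = - m * pruefer.S (2 - \<alpha>) q K' (t - t0)"
      using U.two_sink_structure[OF grad[unfolded \<Psi>] card[unfolded \<Psi>] wpi] by metis
    have l0: "2 - \<alpha> > 0" using l by simp
    have "K' = K"
      using travel_period_decreasing[OF q l0 U(2), of K] travel_period_decreasing[OF q l0 P.K, of K'] U(3) K(2)
      by (cases K K' rule: linorder_cases) auto
    then have sol: "\<psi> t = m * P.S (t - t0 + pi / 2)" for t
      using U(4)[of t] S.\<psi>_shift[of "t - t0"] by simp
    have sol': "\<psi>' t = m * P.S' (t - t0 + pi / 2)" for t
    proof -
      have "((\<lambda>t. m * P.S (t - t0 + pi / 2)) has_real_derivative m * (P.S' (t - t0 + pi / 2) * 1)) (at t)"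
        by (intro DERIV_cmult DERIV_chain2[where f=P.S and g="\<lambda>t. t - t0 + pi / 2", OF S.deriv]) (auto intro!: derivative_eq_intros)
      then show ?thesis using U.deriv[of t] DERIV_unique unfolding sol[abs_def] by fastforce
    qed
    have solw: "w t = m * S.w (t - t0 + pi / 2)" for t
    proof (cases "\<psi> t = 0")
      case True
      then have "P.S (t - t0 + pi / 2) = 0" using U(1) unfolding sol by simp
      then show ?thesis using \<Omega>(3)[OF True] by (simp add: S.w_def)
    next
      case False
      then have nz: "P.S (t - t0 + pi / 2) \<noteq> 0" unfolding sol by auto
      have "((\<lambda>t. m * P.S' (t - t0 + pi / 2)) has_real_derivative m * (S.\<psi>2 (t - t0 + pi / 2) * 1)) (at t)"
        by (intro DERIV_cmult DERIV_chain2[where f=P.S' and g="\<lambda>t. t - t0 + pi / 2", OF S.deriv2[OF nz]]) (auto intro!: derivative_eq_intros)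
      then have "w t - (2 - \<alpha>)\<^sup>2 * \<psi> t = m * S.\<psi>2 (t - t0 + pi / 2)"
        using U.ode1[OF False] DERIV_unique unfolding sol'[abs_def] by fastforce
      then show ?thesis by (simp add: S.\<psi>2_def sol algebra_simps)
    qed
    \<comment> \<open>The amplitude is absorbed by scaling, since \<open>\<Omega>\<close> is homogeneous of degree \<open>-\<alpha>\<close>.\<close>
    define s where "s = m powr (- 1 / \<alpha>)"
    have s: "s > 0" "s powr (- \<alpha>) = m" using U(1) assms by (simp_all add: s_def powr_powr)
    define a where "a = pi / 2 - t0"
    have "\<Omega> x = S.\<Omega> (s *\<^sub>R rot a x)" for x
    proof -
      obtain r t where r: "r \<ge> 0" "x = r *\<^sub>R dir t" by (rule polarE)
      show ?thesis
      proof (cases "r = 0")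
        case True
        then have "x = 0" "rot a x = 0" using r by (simp_all add: vec2_eq_iff)
        then show ?thesis using \<Omega>(2) by (simp add: S.\<Omega>_def)
      next
        case False
        then have r0: "r > 0" using r by simp
        have "S.\<Omega> (s *\<^sub>R rot a x) = m * (r powr (- \<alpha>) * S.w (a + t))"
          unfolding r(2) rot_dir S.\<Omega>_def homog_scale[OF s(1)] homog_dir[OF S.per_w(1) r(1)] s(2) ..
        moreover have "a + t = t - t0 + pi / 2" by (simp add: a_def)
        ultimately show ?thesis unfolding r(2) \<Omega>(1)[OF r0] solw by simp
      qed
    qed
    then have "isometric_profiles (\<lambda>x. S.\<Omega> (s *\<^sub>R x)) \<Omega>"
      unfolding isometric_profiles_def by (intro exI[of _ "rot a"]) (simp add: rot_orthogonal det_rot)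
    then show ?thesis using s(1) by blast
  qed
  then show ?thesis using S.two_sinks unfolding two_sink_profile_def by blast
qed

end
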